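(* Let $(M,g,\nabla,\nabla^{*},\Theta)$ be a $\Theta$-statistical manifold. Then \[ R^{\nabla}(X,Y)\Theta Z=\Theta\,R^{\nabla^{*}}(X,Y)Z \] for all $X,Y,Z\in\Gamma(TM)$. If $\Theta$ is invertible, then \[ R^{\nabla}(X,Y)=\Theta\circ R^{\nabla^{*}}(X,Y)\circ\Theta^{-1}. \] Moreover, for every $p\in M$ and every piecewise smooth loop $\gamma$ based at $p$, \[ \mathcal{P}^{\nabla}_{\gamma}\circ\Theta_p=\Theta_p\circ\mathcal{P}^{\nabla^{*}}_{\gamma}. \] Hence, if $\Theta_p$ is invertible, \[ \operatorname{Hol}_{p}(\nabla)=\Theta_p\circ\operatorname{Hol}_{p}(\nabla^{*})\circ\Theta_p^{-1}. \]
   Context: A statistical manifold $(M,g,\nabla,\nabla^{*})$ is a Riemannian manifold $(M,g)$ with two torsion-free affine connections $\nabla,\nabla^{*}$ that are dual with respect to $g$: $Xg(Y,Z)=g(\nabla_XY,Z)+g(Y,\nabla_X^{*}Z)$ for all vector fields $X,Y,Z$. A nonzero $(1,1)$-tensor field $\Theta$ on $M$ is a statistical gauge tensor if it satisfies the gauge equation $\nabla_X(\Theta Y)=\Theta(\nabla_X^{*}Y)$ for all $X,Y\in\Gamma(TM)$; then $(M,g,\nabla,\nabla^{*},\Theta)$ is called a $\Theta$-statistical manifold. For a connection $D$, $R^{D}(X,Y)Z=D_XD_YZ-D_YD_XZ-D_{[X,Y]}Z$ is its curvature; for a piecewise smooth loop $\gamma$ based at $p$, $\mathcal{P}^{D}_{\gamma}:T_pM\to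 T_pM$ is $D$-parallel transport around $\gamma$; and $\operatorname{Hol}_p(D)$ is the holonomy group of $D$ at $p$, consisting of all such maps $\mathcal{P}^{D}_\gamma$. *)

theory Defs
  imports "HOL-Analysis.Analysis" "HOL-Library.Function_Algebras"
begin

section \<open>Pointwise real vector space structure on functions\<close>

instantiation "fun" :: (type, real_vector) real_vector
begin

definition scaleR_fun :: "real \<Rightarrow> ('a \<Rightarrow> 'b) \<Rightarrow> 'a \<Rightarrow> 'b" where
  "scaleR_fun r f = (\<lambda>x. r *\<^sub>R f x)"

instance
  by standard (simp_all add: scaleR_fun_def fun_eq_iff scaleR_add_right scaleR_add_left)

end

lemma scaleR_fun_apply [simp]: "(r *\<^sub>R f) x = r *\<^sub>R f x"
  by (simp add: scaleR_fun_def)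


section \<open>Smooth maps between normed spaces\<close>

text \<open>Only used for open \<open>S\<close> and a finite-dimensional domain; there, continuity of all
  directional derivatives \<open>x \<mapsto> Df(x) v\<close> is continuity of \<open>Df\<close>.\<close>

primrec Ck_on :: "nat \<Rightarrow> 'e::real_normed_vector set \<Rightarrow> ('e \<Rightarrow> 'f::real_normed_vector) \<Rightarrow> bool" where
  "Ck_on 0 S f \<longleftrightarrow> continuous_on S f"
| "Ck_on (Suc k) S f \<longleftrightarrow>
     (\<forall>x\<in>S. f differentiable (at x)) \<and> (\<forall>v. Ck_on k S (\<lambda>x. frechet_derivative f (at x) v))"

definition smooth_on :: "'e::real_normed_vector set \<Rightarrow> ('e \<Rightarrow> 'f::real_normed_vector) \<Rightarrow> bool" where
  "smooth_on S f \<longleftrightarrow> (\<forall>k. Ck_on k S f)"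


section \<open>Smooth manifolds\<close>

text \<open>The underlying set of the manifold is the whole type \<open>'a\<close>, the model space is \<open>'e\<close>.  A chart
  is a pair of its domain and its coordinate map; only the values of the map on the domain matter.
  An atlas need not be maximal.\<close>

type_synonym ('a, 'e) chart = "'a set \<times> ('a \<Rightarrow> 'e)"

abbreviation chart_dom :: "('a, 'e) chart \<Rightarrow> 'a set" where "chart_dom c \<equiv> fst c"
abbreviation chart_map :: "('a, 'e) chart \<Rightarrow> 'a \<Rightarrow> 'e" where "chart_map c \<equiv> snd c"

definition chart_inv :: "('a, 'e) chart \<Rightarrow> 'e \<Rightarrow> 'a" where
  "chart_inv c = inv_into (chart_dom c) (chart_map c)"

definition chart_img :: "('a, 'e) chart \<Rightarrow> 'e set" where
  "chart_img c = chart_map c ` chart_dom c"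

definition is_chart :: "('a::topological_space, 'e::euclidean_space) chart \<Rightarrow> bool" where
  "is_chart c \<longleftrightarrow> open (chart_dom c) \<and> open (chart_img c) \<and>
     homeomorphism (chart_dom c) (chart_img c) (chart_map c) (chart_inv c)"

definition transition :: "('a, 'e) chart \<Rightarrow> ('a, 'e) chart \<Rightarrow> 'e \<Rightarrow> 'e" where
  "transition c d = chart_map d \<circ> chart_inv c"

definition smooth_atlas ::
    "('a::{t2_space, second_countable_topology}, 'e::euclidean_space) chart set \<Rightarrow> bool" where
  "smooth_atlas A \<longleftrightarrow>
     (\<forall>c\<in>A. is_chart c) \<and> (\<Union>c\<in>A. chart_dom c) = UNIV \<and>
     (\<forall>c\<in>A. \<forall>d\<in>A. smooth_on (chart_map c ` (chart_dom c \<inter> chart_dom d)) (transition c d))"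

text \<open>Some chart around \<open>p\<close>; the notions defined through it do not depend on the choice.\<close>

definition chart_at :: "('a, 'e) chart set \<Rightarrow> 'a \<Rightarrow> ('a, 'e) chart" where
  "chart_at A p = (SOME c. c \<in> A \<and> p \<in> chart_dom c)"


section \<open>Tangent spaces, functions, vector fields and tensor fields\<close>

text \<open>A tangent vector at \<open>p\<close> is the family of its coordinate representations in all charts around
  \<open>p\<close>, related to each other by the differentials of the transition maps.  The components at all
  other charts are set to \<open>0\<close>, so that equality and the vector space operations of \<open>T\<^sub>pM\<close>
  are those of the function space.\<close>

type_synonym ('a, 'e) tvec = "('a, 'e) chart \<Rightarrow> 'e"
type_synonym ('a, 'e) vfield = "'a \<Rightarrow> ('a, 'e) tvec"
type_synonym ('a, 'e) tensor11 = "'a \<Rightarrow> ('a, 'e) tvec \<Rightarrow> ('a, 'e) tvec"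
type_synonym ('a, 'e) connection = "('a, 'e) vfield \<Rightarrow> ('a, 'e) vfield \<Rightarrow> ('a, 'e) vfield"

definition tangent_space ::
    "('a, 'e::euclidean_space) chart set \<Rightarrow> 'a \<Rightarrow> ('a, 'e) tvec set" where
  "tangent_space A p = {v.
     (\<forall>c\<in>A. \<forall>d\<in>A. p \<in> chart_dom c \<inter> chart_dom d \<longrightarrow>
        v d = frechet_derivative (transition c d) (at (chart_map c p)) (v c)) \<and>
     (\<forall>c. \<not> (c \<in> A \<and> p \<in> chart_dom c) \<longrightarrow> v c = 0)}"

text \<open>The tangent vector at \<open>p\<close> with coordinates \<open>u\<close> in the chart \<open>c\<close>.\<close>

definition coord_vec ::
    "('a, 'e::euclidean_space) chart set \<Rightarrow> ('a, 'e) chart \<Rightarrow> 'a \<Rightarrow> 'e \<Rightarrow> ('a, 'e) tvec" where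
  "coord_vec A c p u = (\<lambda>d. if d \<in> A \<and> p \<in> chart_dom d
     then frechet_derivative (transition c d) (at (chart_map c p)) u else 0)"

definition smooth_functions ::
    "('a, 'e::euclidean_space) chart set \<Rightarrow> ('a \<Rightarrow> real) set" where
  "smooth_functions A = {f. \<forall>c\<in>A. smooth_on (chart_img c) (f \<circ> chart_inv c)}"

text \<open>The derivative \<open>v f\<close> of the function \<open>f\<close> in the direction of the tangent vector \<open>v\<close> at \<open>p\<close>.\<close>

definition dir_deriv ::
    "('a, 'e::euclidean_space) chart set \<Rightarrow> 'a \<Rightarrow> ('a, 'e) tvec \<Rightarrow> ('a \<Rightarrow> real) \<Rightarrow> real" where
  "dir_deriv A p v f =
     (let c = chart_at A p
      in frechet_derivative (f \<circ> chart_inv c) (at (chart_map c p)) (v c))"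

definition vf_rep :: "('a, 'e) chart \<Rightarrow> ('a, 'e) vfield \<Rightarrow> 'e \<Rightarrow> 'e" where
  "vf_rep c X = (\<lambda>x. X (chart_inv c x) c)"

definition vector_fields ::
    "('a, 'e::euclidean_space) chart set \<Rightarrow> ('a, 'e) vfield set" where
  "vector_fields A = {X. (\<forall>p. X p \<in> tangent_space A p) \<and>
     (\<forall>c\<in>A. smooth_on (chart_img c) (vf_rep c X))}"

text \<open>In coordinates \<open>[X,Y]\<^sup>k = X\<^sup>i \<partial>\<^sub>i Y\<^sup>k - Y\<^sup>i \<partial>\<^sub>i X\<^sup>k\<close>.\<close>

definition lie_bracket ::
    "('a, 'e::euclidean_space) chart set \<Rightarrow> ('a, 'e) vfield \<Rightarrow> ('a, 'e) vfield \<Rightarrow> ('a, 'e) vfield" where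
  "lie_bracket A X Y = (\<lambda>p c. if c \<in> A \<and> p \<in> chart_dom c
     then frechet_derivative (vf_rep c Y) (at (chart_map c p)) (X p c) -
          frechet_derivative (vf_rep c X) (at (chart_map c p)) (Y p c)
     else 0)"

text \<open>The values of \<open>\<Theta> p\<close> outside the tangent space at \<open>p\<close> are irrelevant; the last conjunct says
  that the matrix of \<open>\<Theta>\<close> in each chart depends smoothly on the point.\<close>

definition tensor_field11 ::
    "('a, 'e::euclidean_space) chart set \<Rightarrow> ('a, 'e) tensor11 \<Rightarrow> bool" where
  "tensor_field11 A \<Theta> \<longleftrightarrow>
     (\<forall>p. \<forall>v\<in>tangent_space A p. \<Theta> p v \<in> tangent_space A p) \<and>
     (\<forall>p. \<forall>v\<in>tangent_space A p. \<forall>w\<in>tangent_space A p. \<Theta> p (v + w) = \<Theta> p v + \<Theta> p w) \<and>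
     (\<forall>p. \<forall>v\<in>tangent_space A p. \<forall>r::real. \<Theta> p (r *\<^sub>R v) = r *\<^sub>R \<Theta> p v) \<and>
     (\<forall>c\<in>A. \<forall>u. smooth_on (chart_img c)
        (\<lambda>x. let p = chart_inv c x in \<Theta> p (coord_vec A c p u) c))"

definition tensor_app :: "('a, 'e) tensor11 \<Rightarrow> ('a, 'e) vfield \<Rightarrow> ('a, 'e) vfield" where
  "tensor_app \<Theta> X = (\<lambda>p. \<Theta> p (X p))"

definition invertible_at ::
    "('a, 'e::euclidean_space) chart set \<Rightarrow> ('a, 'e) tensor11 \<Rightarrow> 'a \<Rightarrow> bool" where
  "invertible_at A \<Theta> p \<longleftrightarrow> bij_betw (\<Theta> p) (tangent_space A p) (tangent_space A p)"

definition tensor_inv ::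
    "('a, 'e::euclidean_space) chart set \<Rightarrow> ('a, 'e) tensor11 \<Rightarrow> ('a, 'e) tensor11" where
  "tensor_inv A \<Theta> = (\<lambda>p. inv_into (tangent_space A p) (\<Theta> p))"

definition riemannian_metric ::
    "('a, 'e::euclidean_space) chart set \<Rightarrow> ('a \<Rightarrow> ('a, 'e) tvec \<Rightarrow> ('a, 'e) tvec \<Rightarrow> real) \<Rightarrow> bool" where
  "riemannian_metric A g \<longleftrightarrow>
     (\<forall>p. \<forall>u\<in>tangent_space A p. \<forall>v\<in>tangent_space A p. \<forall>w\<in>tangent_space A p.
        g p (u + v) w = g p u w + g p v w) \<and>
     (\<forall>p. \<forall>u\<in>tangent_space A p. \<forall>v\<in>tangent_space A p. \<forall>r. g p (r *\<^sub>R u) v = r * g p u v) \<and>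
     (\<forall>p. \<forall>u\<in>tangent_space A p. \<forall>v\<in>tangent_space A p. g p u v = g p v u) \<and>
     (\<forall>p. \<forall>u\<in>tangent_space A p. u \<noteq> 0 \<longrightarrow> g p u u > 0) \<and>
     (\<forall>c\<in>A. \<forall>u v. smooth_on (chart_img c)
        (\<lambda>x. let p = chart_inv c x in g p (coord_vec A c p u) (coord_vec A c p v)))"


section \<open>Affine connections and statistical structures\<close>

text \<open>Real-linearity in the second argument follows from additivity and the Leibniz rule for
  constant functions.\<close>

definition affine_connection ::
    "('a, 'e::euclidean_space) chart set \<Rightarrow> ('a, 'e) connection \<Rightarrow> bool" where
  "affine_connection A D \<longleftrightarrow>
     (\<forall>X\<in>vector_fields A. \<forall>Y\<in>vector_fields A. D X Y \<in> vector_fields A) \<and>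
     (\<forall>X\<in>vector_fields A. \<forall>X'\<in>vector_fields A. \<forall>Y\<in>vector_fields A.
        D (X + X') Y = D X Y + D X' Y) \<and>
     (\<forall>f\<in>smooth_functions A. \<forall>X\<in>vector_fields A. \<forall>Y\<in>vector_fields A.
        D (\<lambda>p. f p *\<^sub>R X p) Y = (\<lambda>p. f p *\<^sub>R D X Y p)) \<and>
     (\<forall>X\<in>vector_fields A. \<forall>Y\<in>vector_fields A. \<forall>Y'\<in>vector_fields A.
        D X (Y + Y') = D X Y + D X Y') \<and>
     (\<forall>f\<in>smooth_functions A. \<forall>X\<in>vector_fields A. \<forall>Y\<in>vector_fields A.
        D X (\<lambda>p. f p *\<^sub>R Y p) = (\<lambda>p. dir_deriv A p (X p) f *\<^sub>R Y p + f p *\<^sub>R D X Y p))"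

definition torsion_free ::
    "('a, 'e::euclidean_space) chart set \<Rightarrow> ('a, 'e) connection \<Rightarrow> bool" where
  "torsion_free A D \<longleftrightarrow>
     (\<forall>X\<in>vector_fields A. \<forall>Y\<in>vector_fields A. D X Y - D Y X = lie_bracket A X Y)"

definition dual_connections ::
    "('a, 'e::euclidean_space) chart set \<Rightarrow> ('a \<Rightarrow> ('a, 'e) tvec \<Rightarrow> ('a, 'e) tvec \<Rightarrow> real) \<Rightarrow>
     ('a, 'e) connection \<Rightarrow> ('a, 'e) connection \<Rightarrow> bool" where
  "dual_connections A g D D' \<longleftrightarrow>
     (\<forall>X\<in>vector_fields A. \<forall>Y\<in>vector_fields A. \<forall>Z\<in>vector_fields A. \<forall>p.
        dir_deriv A p (X p) (\<lambda>q. g q (Y q) (Z q)) = g p (D X Y p) (Z p) + g p (Y p) (D' X Z p))"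

definition statistical_manifold ::
    "('a::{t2_space, second_countable_topology}, 'e::euclidean_space) chart set \<Rightarrow>
     ('a \<Rightarrow> ('a, 'e) tvec \<Rightarrow> ('a, 'e) tvec \<Rightarrow> real) \<Rightarrow>
     ('a, 'e) connection \<Rightarrow> ('a, 'e) connection \<Rightarrow> bool" where
  "statistical_manifold A g D D' \<longleftrightarrow>
     smooth_atlas A \<and> riemannian_metric A g \<and>
     affine_connection A D \<and> torsion_free A D \<and>
     affine_connection A D' \<and> torsion_free A D' \<and>
     dual_connections A g D D'"

definition statistical_gauge_tensor ::
    "('a, 'e::euclidean_space) chart set \<Rightarrow> ('a, 'e) connection \<Rightarrow> ('a, 'e) connection \<Rightarrow>
     ('a, 'e) tensor11 \<Rightarrow> bool" where
  "statistical_gauge_tensor A D D' \<Theta> \<longleftrightarrow>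
     tensor_field11 A \<Theta> \<and>
     (\<exists>p. \<exists>v\<in>tangent_space A p. \<Theta> p v \<noteq> 0) \<and>
     (\<forall>X\<in>vector_fields A. \<forall>Y\<in>vector_fields A. D X (tensor_app \<Theta> Y) = tensor_app \<Theta> (D' X Y))"

definition theta_statistical_manifold ::
    "('a::{t2_space, second_countable_topology}, 'e::euclidean_space) chart set \<Rightarrow>
     ('a \<Rightarrow> ('a, 'e) tvec \<Rightarrow> ('a, 'e) tvec \<Rightarrow> real) \<Rightarrow>
     ('a, 'e) connection \<Rightarrow> ('a, 'e) connection \<Rightarrow> ('a, 'e) tensor11 \<Rightarrow> bool" where
  "theta_statistical_manifold A g D D' \<Theta> \<longleftrightarrow>
     statistical_manifold A g D D' \<and> statistical_gauge_tensor A D D' \<Theta>"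

definition curvature ::
    "('a, 'e::euclidean_space) chart set \<Rightarrow> ('a, 'e) connection \<Rightarrow>
     ('a, 'e) vfield \<Rightarrow> ('a, 'e) vfield \<Rightarrow> ('a, 'e) vfield \<Rightarrow> ('a, 'e) vfield" where
  "curvature A D X Y Z = D X (D Y Z) - D Y (D X Z) - D (lie_bracket A X Y) Z"


section \<open>Parallel transport and holonomy\<close>

text \<open>As usual, smoothness on the closed interval \<open>[a,b]\<close> means that a smooth extension to an open
  interval exists.\<close>

definition smooth_curve_on ::
    "('a::topological_space, 'e::euclidean_space) chart set \<Rightarrow> (real \<Rightarrow> 'a) \<Rightarrow> real \<Rightarrow> real \<Rightarrow> bool" where
  "smooth_curve_on A \<gamma> a b \<longleftrightarrow>
     (\<exists>e>0. \<exists>\<eta>. (\<forall>t\<in>{a..b}. \<eta> t = \<gamma> t) \<and> continuous_on {a - e<..<b + e} \<eta> \<and>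
        (\<forall>c\<in>A. smooth_on {t\<in>{a - e<..<b + e}. \<eta> t \<in> chart_dom c} (chart_map c \<circ> \<eta>)))"

definition smooth_subdivision ::
    "('a::topological_space, 'e::euclidean_space) chart set \<Rightarrow> (real \<Rightarrow> 'a) \<Rightarrow> nat \<Rightarrow> (nat \<Rightarrow> real) \<Rightarrow> bool" where
  "smooth_subdivision A \<gamma> m \<tau> \<longleftrightarrow>
     \<tau> 0 = 0 \<and> \<tau> m = 1 \<and>
     (\<forall>i<m. \<tau> i < \<tau> (Suc i) \<and> smooth_curve_on A \<gamma> (\<tau> i) (\<tau> (Suc i)))"

definition piecewise_smooth_loop ::
    "('a::topological_space, 'e::euclidean_space) chart set \<Rightarrow> 'a \<Rightarrow> (real \<Rightarrow> 'a) \<Rightarrow> bool" where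
  "piecewise_smooth_loop A p \<gamma> \<longleftrightarrow>
     path \<gamma> \<and> pathstart \<gamma> = p \<and> pathfinish \<gamma> = p \<and> (\<exists>m \<tau>. smooth_subdivision A \<gamma> m \<tau>)"

definition velocity ::
    "('a, 'e::euclidean_space) chart set \<Rightarrow> (real \<Rightarrow> 'a) \<Rightarrow> real set \<Rightarrow> real \<Rightarrow> ('a, 'e) tvec" where
  "velocity A \<gamma> S t = (\<lambda>c. if c \<in> A \<and> \<gamma> t \<in> chart_dom c
     then vector_derivative (chart_map c \<circ> \<gamma>) (at t within S) else 0)"

text \<open>\<open>w\<close> is the covariant derivative at time \<open>t\<close> of the vector field \<open>V\<close> along \<open>\<gamma>\<close>, where the time
  parameter ranges over the interval \<open>S\<close>.  Near \<open>t\<close> the field is written as \<open>V = \<Sum>\<^sub>i a\<^sub>i (E\<^sub>i \<circ> \<gamma>)\<close>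
  with vector fields \<open>E\<^sub>i\<close> on \<open>M\<close> (always possible, by extending a local frame with a bump function);
  the sum and product rules together with \<open>D(E \<circ> \<gamma>)/dt = D\<^sub>\<gamma>\<^sub>' E\<close>, which characterise the covariant
  derivative along a curve, then give \<open>w = \<Sum>\<^sub>i (a\<^sub>i' E\<^sub>i + a\<^sub>i D\<^sub>\<gamma>\<^sub>' E\<^sub>i)\<close>.  Here \<open>D\<^sub>v E\<close> is the value of
  \<open>D X E\<close> at the base point of \<open>v\<close> for any vector field \<open>X\<close> extending \<open>v\<close>.\<close>

definition has_covariant_derivative_along ::
    "('a, 'e::euclidean_space) chart set \<Rightarrow> ('a, 'e) connection \<Rightarrow> (real \<Rightarrow> 'a) \<Rightarrow> real set \<Rightarrow>
     (real \<Rightarrow> ('a, 'e) tvec) \<Rightarrow> real \<Rightarrow> ('a, 'e) tvec \<Rightarrow> bool" where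
  "has_covariant_derivative_along A D \<gamma> S V t w \<longleftrightarrow>
     (\<exists>(n::nat) E a a' X U.
        X \<in> vector_fields A \<and> X (\<gamma> t) = velocity A \<gamma> S t \<and>
        (\<forall>i<n. E i \<in> vector_fields A \<and> (a i has_real_derivative a' i) (at t within S)) \<and>
        open U \<and> t \<in> U \<and> (\<forall>s\<in>S \<inter> U. V s = (\<Sum>i<n. a i s *\<^sub>R E i (\<gamma> s))) \<and>
        w = (\<Sum>i<n. a' i *\<^sub>R E i (\<gamma> t) + a i t *\<^sub>R D X (E i) (\<gamma> t)))"

text \<open>\<open>V\<close> is a single field on \<open>[0,1]\<close>, so the parallel fields on adjacent smooth pieces have the same
  value at their common endpoint.  Differentiability of a parallel field is built into the previous
  notion; its smoothness on the smooth pieces is then automatic, as it solves a linear differential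
  equation with smooth coefficients.\<close>

definition parallel_along ::
    "('a::topological_space, 'e::euclidean_space) chart set \<Rightarrow> ('a, 'e) connection \<Rightarrow> (real \<Rightarrow> 'a) \<Rightarrow>
     (real \<Rightarrow> ('a, 'e) tvec) \<Rightarrow> bool" where
  "parallel_along A D \<gamma> V \<longleftrightarrow>
     (\<exists>m \<tau>. smooth_subdivision A \<gamma> m \<tau> \<and>
        (\<forall>i<m. \<forall>t\<in>{\<tau> i..\<tau> (Suc i)}.
           has_covariant_derivative_along A D \<gamma> {\<tau> i..\<tau> (Suc i)} V t 0))"

text \<open>As an extensional function on the tangent space at \<open>\<gamma>(0)\<close>; equality of such functions is
  equality of maps between tangent spaces.\<close>

definition parallel_transport ::
    "('a::topological_space, 'e::euclidean_space) chart set \<Rightarrow> ('a, 'e) connection \<Rightarrow> (real \<Rightarrow> 'a) \<Rightarrow>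
     ('a, 'e) tvec \<Rightarrow> ('a, 'e) tvec" where
  "parallel_transport A D \<gamma> = (\<lambda>v\<in>tangent_space A (pathstart \<gamma>).
     THE w. \<exists>V. parallel_along A D \<gamma> V \<and> V 0 = v \<and> V 1 = w)"

definition holonomy ::
    "('a::topological_space, 'e::euclidean_space) chart set \<Rightarrow> ('a, 'e) connection \<Rightarrow> 'a \<Rightarrow>
     (('a, 'e) tvec \<Rightarrow> ('a, 'e) tvec) set" where
  "holonomy A D p = {parallel_transport A D \<gamma> |\<gamma>. piecewise_smooth_loop A p \<gamma>}"

end

theory Submission
  imports Defs
begin

text \<open>The gauge equation \<open>\<nabla>\<^sub>X (\<Theta>Y) = \<Theta> (\<nabla>\<^sup>*\<^sub>X Y)\<close> says that \<open>\<Theta>\<close> intertwines the two connections, and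
  everything built from the connections inherits this.

  For the curvatures one moves \<open>\<Theta>\<close> through the covariant derivatives in each term of
  \<open>\<nabla>\<^sub>X \<nabla>\<^sub>Y - \<nabla>\<^sub>Y \<nabla>\<^sub>X - \<nabla>\<^bsub>[X,Y]\<^esub>\<close>
  (\<open>curvature_gauge\<close>). Conjugation by an invertible \<open>\<Theta>\<close> is the special case of the field
  \<open>\<Theta>\<inverse>Z\<close>; the point to be proved is that this field is smooth (\<open>tensor_inv_app_in\<close>).

  For parallel transport, if \<open>V = \<Sum>\<^sub>i a\<^sub>i E\<^sub>i\<close> along a curve, then \<open>\<Theta>V = \<Sum>\<^sub>i a\<^sub>i \<Theta>E\<^sub>i\<close>, and the gauge
  equation for the fields \<open>E\<^sub>i\<close> shows that the \<open>\<nabla>\<close>-derivative of \<open>\<Theta>V\<close> is \<open>\<Theta>\<close> of the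
  \<open>\<nabla>\<^sup>*\<close>-derivative of \<open>V\<close> (\<open>covariant_derivative_gauge\<close>). So \<open>\<Theta>\<close> maps \<open>\<nabla>\<^sup>*\<close>-parallel fields to
  \<open>\<nabla>\<close>-parallel fields, and comparing the values at both ends of a loop gives the formula for the
  transports and from it the one for the holonomy groups.

  This comparison of values rests on the fact that a parallel field with given initial value
  exists and that its final value is unique (\<open>parallel_field_exists\<close>, \<open>parallel_field_unique\<close>).
  A connection is a map on global vector fields, so it has to be brought into coordinates first:
  bump functions extend the coordinate fields of a chart to \<open>M\<close>, and the Leibniz rule then yields
  \<open>\<nabla>\<^sub>X Y = DY(X) + \<Gamma>(X,Y)\<close> near a given point (\<open>adapted_frame_exists\<close>). In such
  coordinates a parallel field is a solution of a linear differential equation with continuous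
  coefficients, for which existence and uniqueness are proved by contraction
  (\<open>linear_ode_solution\<close>) and by an exponential estimate (\<open>linear_ode_zero\<close>). A compactness
  argument on \<open>[0,1]\<close> passes from small pieces of the curve to the whole curve.\<close>


section \<open>Calculus of smooth maps\<close>

lemma Ck_on_imp_continuous_on: "Ck_on k S f \<Longrightarrow> continuous_on S f"
  by (cases k) (auto intro!: differentiable_imp_continuous_on
      simp: differentiable_on_def differentiable_at_withinI)

lemma Ck_on_Suc_has_derivative:
  "Ck_on (Suc k) S f \<Longrightarrow> x \<in> S \<Longrightarrow> (f has_derivative frechet_derivative f (at x)) (at x)"
  by (simp add: frechet_derivative_works)

lemma Ck_on_SucD: "Ck_on (Suc k) S f \<Longrightarrow> Ck_on k S f"
proof (induction k arbitrary: f)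
  case 0
  then show ?case using Ck_on_imp_continuous_on by (metis Ck_on.simps(1))
next
  case (Suc k)
  then show ?case by (metis Ck_on.simps(2))
qed

lemma Ck_on_mono: "Ck_on k S f \<Longrightarrow> T \<subseteq> S \<Longrightarrow> Ck_on k T f"
  by (induction k arbitrary: f) (auto intro: continuous_on_subset)

lemma Ck_on_cong:
  assumes "open S" "\<And>x. x \<in> S \<Longrightarrow> f x = g x" "Ck_on k S f"
  shows "Ck_on k S g"
  using assms(2,3)
proof (induction k arbitrary: f g)
  case 0
  then show ?case by (simp cong: continuous_on_cong)
next
  case (Suc k)
  have d: "(g has_derivative frechet_derivative f (at x)) (at x)" if "x \<in> S" for x
    using Ck_on_Suc_has_derivative[OF Suc.prems(2) that] assms(1) that Suc.prems(1)
    by (rule has_derivative_transform_within_open)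
  have eq: "frechet_derivative f (at x) = frechet_derivative g (at x)" if "x \<in> S" for x
    using d[OF that] frechet_derivative_at by blast
  have "Ck_on k S (\<lambda>x. frechet_derivative g (at x) v)" for v
    by (rule Suc.IH[of "\<lambda>x. frechet_derivative f (at x) v"]) (use eq Suc.prems in auto)
  then show ?case using d by (auto simp: differentiable_def)
qed

lemma Ck_on_SucI:
  assumes "open S" "\<And>x. x \<in> S \<Longrightarrow> (f has_derivative f' x) (at x)" "\<And>v. Ck_on k S (\<lambda>x. f' x v)"
  shows "Ck_on (Suc k) S f"
proof -
  have "Ck_on k S (\<lambda>x. frechet_derivative f (at x) v)" for v
    by (rule Ck_on_cong[OF assms(1) _ assms(3)[of v]]) (metis assms(2) frechet_derivative_at)
  then show ?thesis using assms(2) by (auto simp: differentiable_def)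
qed

lemma Ck_on_local:
  assumes "\<And>x. x \<in> S \<Longrightarrow> \<exists>T. open T \<and> x \<in> T \<and> Ck_on k T f"
  shows "Ck_on k S f"
  using assms
proof (induction k arbitrary: f)
  case 0
  have "continuous (at x) f" if "x \<in> S" for x
    using 0[OF that] by (auto simp: continuous_on_eq_continuous_at)
  then show ?case by (simp add: continuous_at_imp_continuous_on)
next
  case (Suc k)
  show ?case
    using Suc.prems by (auto intro!: Suc.IH) blast+
qed

lemma Ck_on_const: "Ck_on k S (\<lambda>x. c)"
  by (induction k arbitrary: c) (auto simp: frechet_derivative_const)

lemma Ck_on_ident: "open S \<Longrightarrow> Ck_on k S (\<lambda>x. x)"
  by (cases k) (auto intro!: Ck_on_SucI[where f' = "\<lambda>x v. v"] Ck_on_const simp del: Ck_on.simps(2))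

lemma Ck_on_add:
  assumes "open S" "Ck_on k S f" "Ck_on k S g"
  shows "Ck_on k S (\<lambda>x. f x + g x)"
  using assms(2,3)
proof (induction k arbitrary: f g)
  case 0
  then show ?case by (auto intro: continuous_intros)
next
  case (Suc k)
  show ?case
    by (rule Ck_on_SucI[OF assms(1) has_derivative_add[OF Suc.prems[THEN Ck_on_Suc_has_derivative]]])
      (use Suc in auto)
qed

lemma (in bounded_bilinear) Ck_on_bilinear:
  assumes "open S" "Ck_on k S f" "Ck_on k S g"
  shows "Ck_on k S (\<lambda>x. prod (f x) (g x))"
  using assms(2,3)
proof (induction k arbitrary: f g)
  case 0
  then show ?case by (auto intro: continuous_on)
next
  case (Suc k)
  show ?case
    by (rule Ck_on_SucI[OF assms(1) FDERIV[OF Suc.prems[THEN Ck_on_Suc_has_derivative]]])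
      (use Suc.prems Suc.prems[THEN Ck_on_SucD] in \<open>auto intro!: Ck_on_add[OF assms(1)] Suc.IH\<close>)
qed

lemmas Ck_on_scaleR = bounded_bilinear.Ck_on_bilinear[OF bounded_bilinear_scaleR]
lemmas Ck_on_inner = bounded_bilinear.Ck_on_bilinear[OF bounded_bilinear_inner]
lemmas Ck_on_mult = bounded_bilinear.Ck_on_bilinear[OF bounded_bilinear_mult]

lemma Ck_on_sum:
  assumes "open S" "\<And>i. i \<in> I \<Longrightarrow> Ck_on k S (f i)"
  shows "Ck_on k S (\<lambda>x. \<Sum>i\<in>I. f i x)"
  using assms(2) by (induction I rule: infinite_finite_induct) (auto intro: Ck_on_const Ck_on_add[OF assms(1)])

lemma linear_sum_Basis:
  fixes u :: "'e::euclidean_space"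
  assumes "linear L"
  shows "L u = (\<Sum>b\<in>Basis. (u \<bullet> b) *\<^sub>R L b)"
proof -
  have "L u = L (\<Sum>b\<in>Basis. (u \<bullet> b) *\<^sub>R b)" by (simp add: euclidean_representation)
  also have "\<dots> = (\<Sum>b\<in>Basis. (u \<bullet> b) *\<^sub>R L b)"
    by (simp add: linear_sum[OF assms] linear_scale[OF assms])
  finally show ?thesis .
qed

text \<open>Products of a matrix and a vector, with the matrix given by its columns \<open>M x b\<close>. Derivatives of
  compositions, coordinate changes of vector fields and tensor fields all have this form.\<close>

lemma Ck_on_linear_family:
  fixes u :: "'e::real_normed_vector \<Rightarrow> 'f::euclidean_space"
    and M :: "'e \<Rightarrow> 'f \<Rightarrow> 'g::real_normed_vector"
  assumes "open S" "\<And>x. x \<in> S \<Longrightarrow> linear (M x)" "\<And>b. b \<in> Basis \<Longrightarrow> Ck_on k S (\<lambda>x. M x b)" "Ck_on k S u"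
  shows "Ck_on k S (\<lambda>x. M x (u x))"
  by (rule Ck_on_cong[where f = "\<lambda>x. \<Sum>b\<in>Basis. (u x \<bullet> b) *\<^sub>R M x b"])
    (auto intro!: Ck_on_sum Ck_on_scaleR Ck_on_inner Ck_on_const assms linear_sum_Basis[symmetric])

lemma Ck_on_compose:
  fixes f :: "'e::real_normed_vector \<Rightarrow> 'f::euclidean_space"
    and g :: "'f \<Rightarrow> 'g::real_normed_vector"
  assumes "open S" "open T" "Ck_on k S f" "Ck_on k T g" "f ` S \<subseteq> T"
  shows "Ck_on k S (\<lambda>x. g (f x))"
  using assms(3,4,5)
proof (induction k arbitrary: f g)
  case 0
  then show ?case by (auto intro: continuous_on_compose2)
next
  case (Suc k)
  have df: "(f has_derivative frechet_derivative f (at x)) (at x)" if "x \<in> S" for x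
    using Ck_on_Suc_has_derivative[OF Suc.prems(1) that] .
  have dg: "(g has_derivative frechet_derivative g (at y)) (at y)" if "y \<in> T" for y
    using Ck_on_Suc_has_derivative[OF Suc.prems(2) that] .
  show ?case
  proof (rule Ck_on_SucI[OF assms(1)])
    \<comment> \<open>The chain rule writes the derivative as a linear family applied to a map of class \<open>C\<^sup>k\<close>; the
      columns \<open>Dg (f x) b\<close> of the family are compositions covered by the induction hypothesis.\<close>
    show "((\<lambda>x. g (f x)) has_derivative
        (\<lambda>v. frechet_derivative g (at (f x)) (frechet_derivative f (at x) v))) (at x)" if "x \<in> S" for x
      using diff_chain_at[OF df[OF that] dg[of "f x"]] Suc.prems(3) that by (auto simp: o_def)
    show "Ck_on k S (\<lambda>x. frechet_derivative g (at (f x)) (frechet_derivative f (at x) v))" for v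
    proof (rule Ck_on_linear_family[OF assms(1)])
      show "linear (frechet_derivative g (at (f x)))" if "x \<in> S" for x
        using dg[of "f x"] Suc.prems(3) that by (auto dest: has_derivative_linear)
      show "Ck_on k S (\<lambda>x. frechet_derivative g (at (f x)) b)" for b
        by (rule Suc.IH) (use Suc.prems Ck_on_SucD[OF Suc.prems(1)] in auto)
    qed (use Suc.prems in auto)
  qed
qed

lemma smooth_on_imp_differentiable: "smooth_on S f \<Longrightarrow> x \<in> S \<Longrightarrow> f differentiable (at x)"
  unfolding smooth_on_def by (metis Ck_on.simps(2))

lemma smooth_on_imp_has_derivative:
  "smooth_on S f \<Longrightarrow> x \<in> S \<Longrightarrow> (f has_derivative frechet_derivative f (at x)) (at x)"
  using smooth_on_imp_differentiable frechet_derivative_works by blast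

lemma smooth_on_imp_continuous_on: "smooth_on S f \<Longrightarrow> continuous_on S f"
  unfolding smooth_on_def by (meson Ck_on_imp_continuous_on)

lemma smooth_on_derivative: "smooth_on S f \<Longrightarrow> smooth_on S (\<lambda>x. frechet_derivative f (at x) v)"
  unfolding smooth_on_def by (metis Ck_on.simps(2))

lemma smooth_on_subset: "smooth_on S f \<Longrightarrow> T \<subseteq> S \<Longrightarrow> smooth_on T f"
  unfolding smooth_on_def using Ck_on_mono by blast

lemma smooth_on_cong: "open S \<Longrightarrow> (\<And>x. x \<in> S \<Longrightarrow> f x = g x) \<Longrightarrow> smooth_on S f \<Longrightarrow> smooth_on S g"
  unfolding smooth_on_def using Ck_on_cong by blast

lemma smooth_on_local:
  "(\<And>x. x \<in> S \<Longrightarrow> \<exists>T. open T \<and> x \<in> T \<and> smooth_on T f) \<Longrightarrow> smooth_on S f"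
  unfolding smooth_on_def by (intro allI Ck_on_local) blast

lemma smooth_on_const: "smooth_on S (\<lambda>x. c)"
  unfolding smooth_on_def by (simp add: Ck_on_const)

lemma smooth_on_ident: "open S \<Longrightarrow> smooth_on S (\<lambda>x. x)"
  unfolding smooth_on_def by (simp add: Ck_on_ident)

lemma smooth_on_add:
  "open S \<Longrightarrow> smooth_on S f \<Longrightarrow> smooth_on S g \<Longrightarrow> smooth_on S (\<lambda>x. f x + g x)"
  unfolding smooth_on_def by (simp add: Ck_on_add)

lemma smooth_on_scaleR:
  "open S \<Longrightarrow> smooth_on S f \<Longrightarrow> smooth_on S g \<Longrightarrow> smooth_on S (\<lambda>x. f x *\<^sub>R g x)"
  unfolding smooth_on_def by (simp add: Ck_on_scaleR)

lemma smooth_on_mult: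
  fixes f g :: "'e::real_normed_vector \<Rightarrow> real"
  shows "open S \<Longrightarrow> smooth_on S f \<Longrightarrow> smooth_on S g \<Longrightarrow> smooth_on S (\<lambda>x. f x * g x)"
  unfolding smooth_on_def by (simp add: Ck_on_mult)

lemma smooth_on_inner:
  "open S \<Longrightarrow> smooth_on S f \<Longrightarrow> smooth_on S g \<Longrightarrow> smooth_on S (\<lambda>x. f x \<bullet> g x)"
  unfolding smooth_on_def by (simp add: Ck_on_inner)

lemma smooth_on_linear_family:
  fixes u :: "'e::real_normed_vector \<Rightarrow> 'f::euclidean_space"
    and M :: "'e \<Rightarrow> 'f \<Rightarrow> 'g::real_normed_vector"
  assumes "open S" "\<And>x. x \<in> S \<Longrightarrow> linear (M x)" "\<And>b. smooth_on S (\<lambda>x. M x b)" "smooth_on S u"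
  shows "smooth_on S (\<lambda>x. M x (u x))"
  unfolding smooth_on_def
proof
  show "Ck_on k S (\<lambda>x. M x (u x))" for k
    by (rule Ck_on_linear_family[where M = M and u = u, OF assms(1,2)])
      (use assms(3,4) in \<open>simp_all add: smooth_on_def\<close>)
qed

lemma smooth_on_compose:
  fixes f :: "'e::real_normed_vector \<Rightarrow> 'f::euclidean_space"
    and g :: "'f \<Rightarrow> 'g::real_normed_vector"
  assumes "open S" "open T" "smooth_on S f" "smooth_on T g" "f ` S \<subseteq> T"
  shows "smooth_on S (\<lambda>x. g (f x))"
  unfolding smooth_on_def
proof
  show "Ck_on k S (\<lambda>x. g (f x))" for k
    by (rule Ck_on_compose[where f = f and g = g, OF assms(1,2) _ _ assms(5)])
      (use assms(3,4) in \<open>simp_all add: smooth_on_def\<close>)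
qed


section \<open>Smoothness of the inverse of a family of linear maps\<close>

lemma linear_family_diff_le:
  fixes L L' :: "'f::euclidean_space \<Rightarrow> 'g::real_normed_vector"
  assumes "linear L" "linear L'"
  shows "norm (L u - L' u) \<le> norm u * (\<Sum>b\<in>Basis. norm (L b - L' b))"
proof -
  have "norm (L u - L' u) = norm (\<Sum>b\<in>Basis. (u \<bullet> b) *\<^sub>R (L b - L' b))"
    using linear_sum_Basis[OF linear_compose_sub[OF assms], of u] by simp
  also have "\<dots> \<le> (\<Sum>b\<in>Basis. norm u * norm (L b - L' b))"
    by (rule sum_norm_le) (simp add: Basis_le_norm mult_right_mono)
  finally show ?thesis by (simp add: sum_distrib_left)
qed

lemma linear_family_tendsto_0:
  fixes M :: "'e::real_normed_vector \<Rightarrow> 'f::euclidean_space \<Rightarrow> 'g::real_normed_vector"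
  assumes "open S" "x0 \<in> S" "\<And>b. continuous_on S (\<lambda>x. M x b)"
  shows "((\<lambda>x. \<Sum>b\<in>Basis. norm (M x b - M x0 b)) \<longlongrightarrow> 0) (at x0)"
proof -
  have "((\<lambda>x. M x b) \<longlongrightarrow> M x0 b) (at x0)" for b
    using assms by (metis continuous_on_eq_continuous_at isContD)
  then have "((\<lambda>x. \<Sum>b\<in>Basis. norm (M x b - M x0 b)) \<longlongrightarrow> (\<Sum>b\<in>(Basis::'f set). norm (M x0 b - M x0 b))) (at x0)"
    by (intro tendsto_intros)
  then show ?thesis by simp
qed

text \<open>An injective linear map is bounded below, and a small perturbation of it still is. This turns
  bounds for \<open>M x u\<close> near \<open>x0\<close> into bounds for \<open>u\<close>.\<close>

lemma linear_family_bounded_below: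
  fixes M :: "'e::real_normed_vector \<Rightarrow> 'f::euclidean_space \<Rightarrow> 'f"
  assumes "open S" "x0 \<in> S" and lin: "\<And>x. x \<in> S \<Longrightarrow> linear (M x)" and "inj (M x0)"
    and cont: "\<And>b. continuous_on S (\<lambda>x. M x b)"
  obtains c where "c > 0" "eventually (\<lambda>x. x \<in> S \<and> (\<forall>u. c * norm u \<le> norm (M x u))) (at x0)"
proof -
  obtain B where B: "B > 0" "\<And>u. B * norm u \<le> norm (M x0 u)"
    using linear_inj_bounded_below_pos[OF lin[OF assms(2)] assms(4)] by blast
  let ?r = "\<lambda>x. \<Sum>b\<in>Basis. norm (M x b - M x0 b)"
  have "(?r \<longlongrightarrow> 0) (at x0)" by (rule linear_family_tendsto_0[OF assms(1,2) cont])
  then have "eventually (\<lambda>x. ?r x < B / 2) (at x0)"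
    using B(1) by (intro order_tendstoD(2)[where y = 0]) auto
  moreover have "eventually (\<lambda>x. x \<in> S) (at x0)"
    using assms(1,2) by (rule eventually_at_in_open')
  ultimately have "eventually (\<lambda>x. x \<in> S \<and> (\<forall>u. B / 2 * norm u \<le> norm (M x u))) (at x0)"
  proof eventually_elim
    case (elim x)
    have "B / 2 * norm u \<le> norm (M x u)" for u
    proof -
      have "norm (M x u - M x0 u) \<le> norm u * ?r x"
        using lin elim(2) assms(2) by (intro linear_family_diff_le) auto
      also have "\<dots> \<le> norm u * (B / 2)" using elim(1) by (intro mult_left_mono) auto
      finally have "norm (M x u - M x0 u) \<le> norm u * (B / 2)" .
      moreover have "norm (M x0 u) \<le> norm (M x u) + norm (M x u - M x0 u)"
        by (metis norm_minus_commute norm_triangle_sub)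
      ultimately show ?thesis using B(2)[of u] by (simp add: field_simps)
    qed
    then show ?case using elim(2) by blast
  qed
  then show thesis using that[of "B / 2"] B(1) by simp
qed

lemma linear_family_solution_isCont:
  fixes M :: "'e::real_normed_vector \<Rightarrow> 'f::euclidean_space \<Rightarrow> 'f"
  assumes "open S" "x0 \<in> S" and lin: "\<And>x. x \<in> S \<Longrightarrow> linear (M x)" and "inj (M x0)"
    and cont: "\<And>b. continuous_on S (\<lambda>x. M x b)"
    and eq: "\<And>x. x \<in> S \<Longrightarrow> M x (y x) = z x" and "continuous_on S z"
  shows "isCont y x0"
proof -
  obtain c where c: "c > 0" "eventually (\<lambda>x. x \<in> S \<and> (\<forall>u. c * norm u \<le> norm (M x u))) (at x0)"
    using linear_family_bounded_below[OF assms(1,2) lin assms(4) cont] by blast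
  have t: "((\<lambda>x. norm (z x - M x (y x0)) / c) \<longlongrightarrow> norm (z x0 - M x0 (y x0)) / c) (at x0)"
    using cont[of "y x0"] assms(1,2,7) c(1)
    by (intro tendsto_intros) (auto simp: continuous_on_eq_continuous_at isCont_def)
  have "((\<lambda>x. y x - y x0) \<longlongrightarrow> 0) (at x0)"
  proof (rule Lim_null_comparison)
    show "((\<lambda>x. norm (z x - M x (y x0)) / c) \<longlongrightarrow> 0) (at x0)"
      using t eq[OF assms(2)] by simp
    show "eventually (\<lambda>x. norm (y x - y x0) \<le> norm (z x - M x (y x0)) / c) (at x0)"
      using c(2)
    proof eventually_elim
      case (elim x)
      then have "c * norm (y x - y x0) \<le> norm (M x (y x - y x0))" by blast
      also have "M x (y x - y x0) = z x - M x (y x0)"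
        using elim eq lin by (metis linear_diff)
      finally show ?case using c(1) by (simp add: field_simps)
    qed
  qed
  then show ?thesis by (simp add: isCont_def LIM_zero_iff)
qed

text \<open>The candidate \<open>L\<close> for the derivative of \<open>y\<close> comes from differentiating
  \<open>M x0 (y x - y x0) \<approx> z x - M x (y x0)\<close>. With \<open>q x = z x - M x (y x0)\<close> and \<open>h = x - x0\<close>, the vector
  \<open>M x (y x - y x0 - L h)\<close> is the remainder of \<open>q\<close> minus \<open>(M x - M x0) (L h)\<close>, hence of order
  \<open>o(\<bar>h\<bar>)\<close>, and the lower bound for \<open>M x\<close> passes this on to \<open>y x - y x0 - L h\<close>.\<close>

lemma linear_family_solution_has_derivative:
  fixes M :: "'e::real_normed_vector \<Rightarrow> 'f::euclidean_space \<Rightarrow> 'f"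
  assumes "open S" "x0 \<in> S" and lin: "\<And>x. x \<in> S \<Longrightarrow> linear (M x)" and "inj (M x0)"
    and cont: "\<And>b. continuous_on S (\<lambda>x. M x b)"
    and eq: "\<And>x. x \<in> S \<Longrightarrow> M x (y x) = z x"
    and dq: "((\<lambda>x. z x - M x (y x0)) has_derivative q') (at x0)"
    and L: "\<And>v. M x0 (L v) = q' v"
  shows "(y has_derivative L) (at x0)"
proof -
  obtain c where c: "c > 0" "eventually (\<lambda>x. x \<in> S \<and> (\<forall>u. c * norm u \<le> norm (M x u))) (at x0)"
    using linear_family_bounded_below[OF assms(1,2) lin assms(4) cont] by blast
  have blq: "bounded_linear q'" using dq by (rule has_derivative_bounded_linear)
  have "linear L"
  proof (rule linearI)
    show "L (v + w) = L v + L w" for v w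
      using injD[OF assms(4)] L lin[OF assms(2)] bounded_linear.linear[OF blq] by (metis linear_add)
    show "L (r *\<^sub>R v) = r *\<^sub>R L v" for r v
      using injD[OF assms(4)] L lin[OF assms(2)] bounded_linear.linear[OF blq] by (metis linear_scale)
  qed
  obtain B where B: "B > 0" "\<And>u. B * norm u \<le> norm (M x0 u)"
    using linear_inj_bounded_below_pos[OF lin[OF assms(2)] assms(4)] by blast
  obtain K where K: "K > 0" "\<And>v. norm (q' v) \<le> norm v * K"
    using bounded_linear.pos_bounded[OF blq] by blast
  have LK: "norm (L v) \<le> norm v * (K / B)" for v
    using B(2)[of "L v"] L[of v] K(2)[of v] B(1) by (simp add: field_simps)
  have blL: "bounded_linear L"
    using \<open>linear L\<close> LK by (intro bounded_linear_intro[where K = "K / B"]) (auto simp: linear_add linear_scale)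
  let ?q = "\<lambda>x. z x - M x (y x0)" and ?r = "\<lambda>x. \<Sum>b\<in>Basis. norm (M x b - M x0 b)"
  let ?e = "\<lambda>x. norm (?q x - ?q x0 - q' (x - x0)) / norm (x - x0)"
  have "((\<lambda>x. norm (y x - y x0 - L (x - x0)) / norm (x - x0)) \<longlongrightarrow> 0) (at x0)"
  proof (rule Lim_null_comparison)
    have "(?e \<longlongrightarrow> 0) (at x0)" using dq by (simp add: has_derivative_iff_norm)
    moreover have "(?r \<longlongrightarrow> 0) (at x0)" by (rule linear_family_tendsto_0[OF assms(1,2) cont])
    ultimately have "((\<lambda>x. (?e x + K / B * ?r x) / c) \<longlongrightarrow> (0 + K / B * 0) / c) (at x0)"
      using c(1) by (intro tendsto_intros) auto
    then show "((\<lambda>x. (?e x + K / B * ?r x) / c) \<longlongrightarrow> 0) (at x0)" by simp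
    have "eventually (\<lambda>x. x \<noteq> x0) (at x0)" by (simp add: eventually_at_filter)
    with c(2) show "eventually (\<lambda>x. norm (norm (y x - y x0 - L (x - x0)) / norm (x - x0))
        \<le> (?e x + K / B * ?r x) / c) (at x0)"
    proof eventually_elim
      case (elim x)
      let ?h = "x - x0"
      have l: "linear (M x)" "linear (M x0)" using lin elim assms(2) by auto
      have "c * norm (y x - y x0 - L ?h) \<le> norm (M x (y x - y x0 - L ?h))" using elim by blast
      also have "M x (y x - y x0 - L ?h) = (?q x - ?q x0 - q' ?h) - (M x (L ?h) - M x0 (L ?h))"
        using elim eq[of x] eq[OF assms(2)] by (simp add: linear_diff[OF l(1)] L)
      also have "norm \<dots> \<le> norm (?q x - ?q x0 - q' ?h) + norm (M x (L ?h) - M x0 (L ?h))"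
        by (rule norm_triangle_ineq4)
      also have "norm (M x (L ?h) - M x0 (L ?h)) \<le> norm (L ?h) * ?r x"
        by (rule linear_family_diff_le[OF l])
      also have "\<dots> \<le> norm ?h * (K / B) * ?r x"
        by (intro mult_right_mono LK sum_nonneg) auto
      finally have "c * norm (y x - y x0 - L ?h) \<le>
          norm (?q x - ?q x0 - q' ?h) + norm ?h * (K / B) * ?r x" by simp
      then have "norm (y x - y x0 - L ?h) \<le>
          (norm (?q x - ?q x0 - q' ?h) + norm ?h * (K / B) * ?r x) / c"
        using c(1) by (simp add: field_simps)
      then have "norm (y x - y x0 - L ?h) / norm ?h \<le>
          (norm (?q x - ?q x0 - q' ?h) + norm ?h * (K / B) * ?r x) / c / norm ?h"
        by (rule divide_right_mono) simp
      also have "\<dots> = (?e x + K / B * ?r x) / c"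
        using elim by (simp add: add_divide_distrib)
      finally show ?case by simp
    qed
  qed
  then show ?thesis using blL by (simp add: has_derivative_iff_norm)
qed

text \<open>Differentiating \<open>M x (y x) = z x\<close> gives the equation
  \<open>M x (Dy x v) = Dz x v - DM x v (y x)\<close> of the same form for the derivative of \<open>y\<close>,
  so the order of differentiability can be raised one step at a time.\<close>

lemma Ck_on_linear_family_solution:
  fixes M :: "'e::real_normed_vector \<Rightarrow> 'f::euclidean_space \<Rightarrow> 'f"
  assumes S: "open S" and lin: "\<And>x. x \<in> S \<Longrightarrow> linear (M x)" and inj: "\<And>x. x \<in> S \<Longrightarrow> inj (M x)"
    and M: "\<And>u. smooth_on S (\<lambda>x. M x u)"
    and "Ck_on k S z" "\<And>x. x \<in> S \<Longrightarrow> M x (y x) = z x"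
  shows "Ck_on k S y"
  using assms(5,6)
proof (induction k arbitrary: z y)
  case 0
  have "isCont y x" if "x \<in> S" for x
    using linear_family_solution_isCont[of S x M y z] 0 S that lin inj M smooth_on_imp_continuous_on
    by (metis Ck_on.simps(1))
  then show ?case by (simp add: continuous_at_imp_continuous_on)
next
  case (Suc k)
  have contM: "continuous_on S (\<lambda>x. M x b)" for b using M smooth_on_imp_continuous_on by blast
  have y: "Ck_on k S y" using Suc.IH[OF Ck_on_SucD] Suc.prems by blast
  define DM where "DM = (\<lambda>x v u. frechet_derivative (\<lambda>x. M x u) (at x) v)"
  have dM: "((\<lambda>x. M x u) has_derivative (\<lambda>v. DM x v u)) (at x)" if "x \<in> S" for x u
    using smooth_on_imp_has_derivative[OF M that] unfolding DM_def .
  have linDM: "linear (DM x v)" if x: "x \<in> S" for x v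
  proof (rule linearI)
    fix u w r
    have ev: "((\<lambda>x. M x u + M x w) has_derivative (\<lambda>v. DM x v (u + w))) (at x)"
      by (rule has_derivative_transform_within_open[OF dM[OF x, of "u + w"] S x]) (simp add: lin linear_add)
    show "DM x v (u + w) = DM x v u + DM x v w"
      using has_derivative_unique[OF ev has_derivative_add[OF dM[OF x, of u] dM[OF x, of w]]] by meson
    have ev: "((\<lambda>x. r *\<^sub>R M x u) has_derivative (\<lambda>v. DM x v (r *\<^sub>R u))) (at x)"
      by (rule has_derivative_transform_within_open[OF dM[OF x, of "r *\<^sub>R u"] S x]) (simp add: lin linear_scale)
    show "DM x v (r *\<^sub>R u) = r *\<^sub>R DM x v u"
      using has_derivative_unique[OF ev has_derivative_scaleR_right[OF dM[OF x, of u]]] by meson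
  qed
  define q where "q = (\<lambda>x v. frechet_derivative z (at x) v - DM x v (y x))"
  have qC: "Ck_on k S (\<lambda>x. q x v)" for v
  proof -
    have 1: "Ck_on k S (\<lambda>x. (-1) *\<^sub>R DM x v (y x))"
      by (rule Ck_on_scaleR[OF S Ck_on_const Ck_on_linear_family[where M = "\<lambda>x. DM x v", OF S linDM _ y]])
        (use smooth_on_derivative[OF M] in \<open>auto simp: DM_def smooth_on_def\<close>)
    have "Ck_on k S (\<lambda>x. frechet_derivative z (at x) v)" using Suc.prems(1) by simp
    from Ck_on_add[OF S this 1] show ?thesis by (simp add: q_def)
  qed
  define L where "L = (\<lambda>x v. SOME w. M x w = q x v)"
  have L: "M x (L x v) = q x v" if "x \<in> S" for x v
  proof -
    have "surj (M x)" using lin inj that linear_injective_imp_surjective by blast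
    then show ?thesis unfolding L_def by (metis (mono_tags, lifting) someI surjD)
  qed
  show ?case
  proof (rule Ck_on_SucI[OF S])
    fix x assume x: "x \<in> S"
    have dq: "((\<lambda>x'. z x' - M x' (y x)) has_derivative q x) (at x)"
      using has_derivative_diff[OF Ck_on_Suc_has_derivative[OF Suc.prems(1) x] dM[OF x, of "y x"]]
      unfolding q_def .
    show "(y has_derivative L x) (at x)"
      by (rule linear_family_solution_has_derivative[OF S x lin inj[OF x] contM Suc.prems(2) dq])
        (use L x in auto)
  next
    show "Ck_on k S (\<lambda>x. L x v)" for v
      by (rule Suc.IH[OF qC[of v]]) (rule L)
  qed
qed

lemma smooth_on_linear_family_solution:
  fixes M :: "'e::real_normed_vector \<Rightarrow> 'f::euclidean_space \<Rightarrow> 'f"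
  assumes "open S" "\<And>x. x \<in> S \<Longrightarrow> linear (M x)" "\<And>x. x \<in> S \<Longrightarrow> inj (M x)"
    "\<And>u. smooth_on S (\<lambda>x. M x u)" "smooth_on S z" "\<And>x. x \<in> S \<Longrightarrow> M x (y x) = z x"
  shows "smooth_on S y"
  unfolding smooth_on_def
proof
  show "Ck_on k S y" for k
    by (rule Ck_on_linear_family_solution[OF assms(1-4) _ assms(6)])
      (use assms(5) in \<open>auto simp: smooth_on_def\<close>)
qed


section \<open>Bump functions\<close>

text \<open>For \<open>p = 1\<close> this is the smooth flat function \<open>e\<^bsup>-1/x\<^esup>\<close>. The polynomial factor in \<open>1/x\<close> makes the
  class closed under differentiation.\<close>

definition flat_fun :: "real poly \<Rightarrow> real \<Rightarrow> real" where
  "flat_fun p x = (if x > 0 then poly p (1 / x) * exp (- (1 / x)) else 0)"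

lemma tendsto_poly_exp_neg: "((\<lambda>y. poly p y * exp (- y)) \<longlongrightarrow> (0::real)) at_top"
proof -
  have "((\<lambda>y. \<Sum>i\<le>degree p. coeff p i * (y ^ i / exp y)) \<longlongrightarrow> (\<Sum>i\<le>degree p. coeff p i * 0)) at_top"
    by (intro tendsto_intros tendsto_power_div_exp_0)
  then show ?thesis
    by (simp add: poly_altdef exp_minus field_simps sum_distrib_left sum_divide_distrib)
qed

lemma flat_fun_has_derivative:
  "(flat_fun p has_real_derivative flat_fun (monom 1 2 * (p - pderiv p)) x) (at x)"
proof -
  consider "x > 0" | "x < 0" | "x = 0" by linarith
  then show ?thesis
  proof cases
    case 1
    have "((\<lambda>x. poly p (1 / x) * exp (- (1 / x))) has_real_derivative
        flat_fun (monom 1 2 * (p - pderiv p)) x) (at x)"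
      using 1 by (auto intro!: derivative_eq_intros DERIV_chain2[OF poly_DERIV]
          simp: flat_fun_def poly_monom field_simps power2_eq_square)
    then show ?thesis
      by (rule has_field_derivative_transform_within_open[of _ _ _ "{0<..}"]) (use 1 in \<open>auto simp: flat_fun_def\<close>)
  next
    case 2
    have "((\<lambda>x. 0) has_real_derivative flat_fun (monom 1 2 * (p - pderiv p)) x) (at x)"
      using 2 by (simp add: flat_fun_def)
    then show ?thesis
      by (rule has_field_derivative_transform_within_open[of _ _ _ "{..<0}"]) (use 2 in \<open>auto simp: flat_fun_def\<close>)
  next
    \<comment> \<open>The quotient \<open>p(1/h) e\<^bsup>-1/h\<^esup> / h\<close> is again of the form \<open>r(1/h) e\<^bsup>-1/h\<^esup>\<close>, with \<open>r(y) = y p(y)\<close>.\<close>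
  case 3
    have "((\<lambda>h. flat_fun p h / h) \<longlongrightarrow> 0) (at_right 0)"
    proof -
      have "((\<lambda>h. poly (pCons 0 p) (1 / h) * exp (- (1 / h))) \<longlongrightarrow> 0) (at_right (0::real))"
        using filterlim_compose[OF tendsto_poly_exp_neg filterlim_inverse_at_top_right, of "pCons 0 p"]
        by (simp add: inverse_eq_divide)
      then show ?thesis
        by (rule Lim_transform_eventually) (auto simp: flat_fun_def eventually_at_filter)
    qed
    moreover have "((\<lambda>h. flat_fun p h / h) \<longlongrightarrow> 0) (at_left 0)"
      by (rule Lim_transform_eventually[OF tendsto_const]) (auto simp: flat_fun_def eventually_at_filter)
    ultimately have "((\<lambda>h. flat_fun p h / h) \<longlongrightarrow> 0) (at 0)"
      by (simp add: filterlim_split_at)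
    then show ?thesis using 3 by (simp add: DERIV_def flat_fun_def)
  qed
qed

lemma Ck_on_flat_fun: "Ck_on k UNIV (flat_fun p)"
proof (induction k arbitrary: p)
  case 0
  show ?case
    using flat_fun_has_derivative by (auto intro!: continuous_at_imp_continuous_on DERIV_isCont)
next
  case (Suc k)
  show ?case
    by (rule Ck_on_SucI[OF open_UNIV flat_fun_has_derivative[unfolded has_field_derivative_def]])
      (auto intro: Ck_on_mult Ck_on_const Suc.IH)
qed

text \<open>With \<open>h(x) = e\<^bsup>-1/x\<^esup>\<close> for \<open>x > 0\<close> and \<open>h = 0\<close> otherwise, the function
  \<open>e h(1 - e h(s - 1))\<close> has the required values, because \<open>h\<close> vanishes on
  \<open>x \<le> 0\<close>, \<open>e h(1) = 1\<close>, and \<open>e h(s - 1) \<ge> 1\<close> for \<open>s \<ge> 2\<close>. Composing \<open>h\<close> with itself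
  avoids a quotient of smooth functions.\<close>

lemma smooth_cutoff_real:
  obtains \<theta> :: "real \<Rightarrow> real" where "smooth_on UNIV \<theta>"
    "\<And>s. s \<le> 1 \<Longrightarrow> \<theta> s = 1" "\<And>s. s \<ge> 2 \<Longrightarrow> \<theta> s = 0"
proof
  let ?h = "flat_fun 1"
  have h: "smooth_on UNIV ?h" unfolding smooth_on_def by (simp add: Ck_on_flat_fun)
  have shift: "smooth_on UNIV (\<lambda>s::real. s + (-1))"
    by (intro smooth_on_add smooth_on_ident smooth_on_const open_UNIV)
  have g: "smooth_on UNIV (\<lambda>s. 1 + (- exp 1) * ?h (s + (-1)))"
    by (intro smooth_on_add smooth_on_mult smooth_on_const open_UNIV
        smooth_on_compose[OF open_UNIV open_UNIV shift h]) auto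
  show "smooth_on UNIV (\<lambda>s. exp 1 * ?h (1 + (- exp 1) * ?h (s + (-1))))"
    by (intro smooth_on_mult smooth_on_const open_UNIV smooth_on_compose[OF open_UNIV open_UNIV g h]) auto
  show "exp 1 * ?h (1 + (- exp 1) * ?h (s + (-1))) = 1" if "s \<le> 1" for s
    using that by (simp add: flat_fun_def exp_minus)
  show "exp 1 * ?h (1 + (- exp 1) * ?h (s + (-1))) = 0" if "s \<ge> 2" for s
  proof -
    have "exp (-1) \<le> exp (- (1 / (s - 1)))" using that by simp
    then have "exp 1 * exp (-1) \<le> exp 1 * ?h (s + (-1))"
      using that by (intro mult_left_mono) (auto simp: flat_fun_def)
    then show ?thesis by (simp add: flat_fun_def exp_minus)
  qed
qed


lemma smooth_bump:
  fixes x0 :: "'e::euclidean_space"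
  assumes "r > 0"
  obtains \<psi> :: "'e \<Rightarrow> real" and \<epsilon> where "smooth_on UNIV \<psi>" "\<epsilon> > 0"
    "\<And>x. x \<in> ball x0 \<epsilon> \<Longrightarrow> \<psi> x = 1" "\<And>x. x \<notin> cball x0 r \<Longrightarrow> \<psi> x = 0"
proof -
  obtain \<theta> :: "real \<Rightarrow> real" where \<theta>: "smooth_on UNIV \<theta>"
    "\<And>s. s \<le> 1 \<Longrightarrow> \<theta> s = 1" "\<And>s. s \<ge> 2 \<Longrightarrow> \<theta> s = 0"
    by (rule smooth_cutoff_real) (rule that)
  \<comment> \<open>Scaled so that \<open>?s = 2\<close> on the sphere of radius \<open>r\<close> and \<open>?s \<le> 1\<close> on the ball of radius \<open>r / 2\<close>.\<close>
  let ?s = "\<lambda>x. 2 / r\<^sup>2 * ((x + (- x0)) \<bullet> (x + (- x0)))"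
  have s: "smooth_on UNIV ?s"
    by (intro smooth_on_mult smooth_on_const smooth_on_inner smooth_on_add smooth_on_ident open_UNIV)
  have s_eq: "?s x = 2 * (norm (x - x0))\<^sup>2 / r\<^sup>2" for x by (simp add: dot_square_norm)
  show thesis
  proof
    show "smooth_on UNIV (\<lambda>x. \<theta> (?s x))"
      by (rule smooth_on_compose[OF open_UNIV open_UNIV s \<theta>(1)]) simp
    show "r / 2 > 0" using assms by simp
    show "\<theta> (?s x) = 1" if "x \<in> ball x0 (r / 2)" for x
    proof (rule \<theta>(2))
      have "(norm (x - x0))\<^sup>2 \<le> (r / 2)\<^sup>2" using that by (intro power_mono) (auto simp: dist_norm norm_minus_commute)
      then have "(norm (x - x0))\<^sup>2 * 4 \<le> r\<^sup>2" by (simp add: power_divide)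
      then have "2 * (norm (x - x0))\<^sup>2 \<le> r\<^sup>2"
        using zero_le_power2[of "norm (x - x0)"] by linarith
      then show "?s x \<le> 1" unfolding s_eq using assms by simp
    qed
    show "\<theta> (?s x) = 0" if "x \<notin> cball x0 r" for x
    proof (rule \<theta>(3))
      have "r\<^sup>2 \<le> (norm (x - x0))\<^sup>2" using that assms by (intro power_mono) (auto simp: dist_norm norm_minus_commute)
      then have "2 * r\<^sup>2 \<le> 2 * (norm (x - x0))\<^sup>2" by simp
      then show "2 \<le> ?s x" unfolding s_eq using assms by (simp add: pos_le_divide_eq del: mult_le_cancel_left_pos)
    qed
  qed
qed


section \<open>Linear differential equations\<close>

lemma continuous_on_linear_family:
  fixes M :: "'t::topological_space \<Rightarrow> 'e::euclidean_space \<Rightarrow> 'f::real_normed_vector"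
  assumes "\<And>t. t \<in> S \<Longrightarrow> linear (M t)" "\<And>b. b \<in> Basis \<Longrightarrow> continuous_on S (\<lambda>t. M t b)" "continuous_on S u"
  shows "continuous_on S (\<lambda>t. M t (u t))"
proof -
  have "continuous_on S (\<lambda>t. \<Sum>b\<in>Basis. (u t \<bullet> b) *\<^sub>R M t b)"
    using assms(2,3) by (intro continuous_intros) auto
  then show ?thesis
    by (rule continuous_on_eq) (simp add: linear_sum_Basis[OF assms(1), symmetric])
qed

lemma linear_family_bounded_on_interval:
  fixes M :: "real \<Rightarrow> 'e::euclidean_space \<Rightarrow> 'f::real_normed_vector"
  assumes "\<And>t. t \<in> {a..b} \<Longrightarrow> linear (M t)" "\<And>i. i \<in> Basis \<Longrightarrow> continuous_on {a..b} (\<lambda>t. M t i)"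
  obtains K where "K > 0" "\<And>t u. t \<in> {a..b} \<Longrightarrow> norm (M t u) \<le> K * norm u"
proof -
  have "continuous_on {a..b} (\<lambda>t. \<Sum>i\<in>Basis. norm (M t i))"
    using assms(2) by (intro continuous_intros)
  then have "bounded ((\<lambda>t. \<Sum>i\<in>Basis. norm (M t i)) ` {a..b})"
    by (intro compact_imp_bounded compact_continuous_image) auto
  then obtain K where K: "K > 0" "\<And>t. t \<in> {a..b} \<Longrightarrow> norm (\<Sum>i\<in>Basis. norm (M t i)) \<le> K"
    by (auto simp: bounded_pos)
  have "norm (M t u) \<le> K * norm u" if "t \<in> {a..b}" for t u
  proof -
    have "norm (M t u) \<le> norm u * (\<Sum>i\<in>Basis. norm (M t i))"
      using linear_family_diff_le[OF assms(1)[OF that] linear_zero, of u] by simp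
    also have "\<dots> \<le> norm u * K" using K(2)[OF that] by (intro mult_left_mono) auto
    finally show ?thesis by (simp add: mult.commute)
  qed
  with K(1) that show thesis by blast
qed

text \<open>Picard iteration. The operator acts on bounded continuous functions on the whole line, which form
  a complete space; clamping the time to \<open>[a,b]\<close> keeps its values in that space. On an interval so
  short that \<open>K (b - a) \<le> 1 / 2\<close> the operator is a contraction.\<close>

lemma linear_ode_short_interval:
  fixes M :: "real \<Rightarrow> 'e::euclidean_space \<Rightarrow> 'e"
  assumes "a \<le> b" and lin: "\<And>t. t \<in> {a..b} \<Longrightarrow> linear (M t)"
    and cont: "\<And>i. i \<in> Basis \<Longrightarrow> continuous_on {a..b} (\<lambda>t. M t i)"
    and K: "0 \<le> K" "\<And>t u. t \<in> {a..b} \<Longrightarrow> norm (M t u) \<le> K * norm u" "K * (b - a) \<le> 1 / 2"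
  shows "\<exists>u. u a = u0 \<and> (\<forall>t\<in>{a..b}. (u has_vector_derivative M t (u t)) (at t within {a..b}))"
proof -
  let ?cl = "\<lambda>t. max a (min b t)"
  let ?I = "\<lambda>f t. integral {a..t} (\<lambda>s. M s (f s))"
  define T :: "(real \<Rightarrow>\<^sub>C 'e) \<Rightarrow> (real \<Rightarrow>\<^sub>C 'e)" where "T = (\<lambda>f. Bcontfun (\<lambda>t. u0 + ?I f (?cl t)))"
  have cl: "?cl t \<in> {a..b}" for t using assms(1) by auto
  have cM: "continuous_on {a..b} (\<lambda>s. M s (f s))" if "continuous_on {a..b} f" for f
    using continuous_on_linear_family[OF lin cont that] by simp
  have cf: "continuous_on {a..b} (apply_bcontfun f)" for f :: "real \<Rightarrow>\<^sub>C 'e"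
    using apply_bcontfun[of f] by (auto simp: bcontfun_def intro: continuous_on_subset)
  have T: "apply_bcontfun (T f) t = u0 + ?I f (?cl t)" for f t
  proof -
    have c: "continuous_on {a..b} (\<lambda>t. u0 + ?I f t)"
      using cM[OF cf] by (intro continuous_intros indefinite_integral_continuous_1 integrable_continuous_real)
    have "continuous_on UNIV (\<lambda>t. u0 + ?I f (?cl t))"
      by (rule continuous_on_compose2[OF c]) (use cl in \<open>auto intro!: continuous_intros\<close>)
    moreover have "bounded (range (\<lambda>t. u0 + ?I f (?cl t)))"
      by (rule bounded_subset[OF compact_imp_bounded[OF compact_continuous_image[OF c]]]) (use cl in auto)
    ultimately show ?thesis
      unfolding T_def by (subst Bcontfun_inverse) (auto simp: bcontfun_def)
  qed
  have "dist (T f) (T g) \<le> 1 / 2 * dist f g" for f g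
  proof (rule dist_bound)
    fix t
    let ?t = "?cl t"
    have sub: "{a..?t} \<subseteq> {a..b}" and at: "a \<le> ?t" and tb: "?t - a \<le> b - a" using cl[of t] by auto
    have int: "(\<lambda>s. M s (f s)) integrable_on {a..?t}" for f :: "real \<Rightarrow>\<^sub>C 'e"
      by (rule integrable_continuous_real) (rule continuous_on_subset[OF cM[OF cf] sub])
    have cd: "continuous_on {a..?t} (\<lambda>s. M s (f s) - M s (g s))"
      by (intro continuous_intros continuous_on_subset[OF cM[OF cf] sub])
    have bd: "norm (M s (f s) - M s (g s)) \<le> K * dist f g" if "s \<in> {a..?t}" for s
    proof -
      have s: "s \<in> {a..b}" using that sub by blast
      have "norm (M s (f s) - M s (g s)) = norm (M s (f s - g s))" using linear_diff[OF lin[OF s]] by simp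
      also have "\<dots> \<le> K * dist (f s) (g s)" using K(2)[OF s] by (simp add: dist_norm)
      also have "\<dots> \<le> K * dist f g" using K(1) by (intro mult_left_mono dist_bounded) auto
      finally show ?thesis .
    qed
    have "dist (T f t) (T g t) = norm (integral {a..?t} (\<lambda>s. M s (f s) - M s (g s)))"
      unfolding T dist_norm integral_diff[OF int int] by simp
    also have "\<dots> \<le> K * dist f g * (?t - a)" by (rule integral_bound[OF at cd bd])
    also have "\<dots> \<le> K * dist f g * (b - a)" using tb K(1) by (intro mult_left_mono) auto
    also have "\<dots> = K * (b - a) * dist f g" by simp
    also have "\<dots> \<le> 1 / 2 * dist f g" using K(3) by (intro mult_right_mono) auto
    finally show "dist (T f t) (T g t) \<le> 1 / 2 * dist f g" .
  qed
  then have "\<exists>!u. T u = u" by (intro banach_fix_type[of "1 / 2"]) auto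
  then obtain u where u: "T u = u" by blast
  have eq: "apply_bcontfun u t = u0 + ?I u t" if "t \<in> {a..b}" for t
    using T[of u t] that unfolding u by simp
  have "(apply_bcontfun u has_vector_derivative M t (u t)) (at t within {a..b})" if t: "t \<in> {a..b}" for t
  proof (rule has_vector_derivative_transform[OF t])
    show "((\<lambda>t. u0 + ?I u t) has_vector_derivative M t (u t)) (at t within {a..b})"
      using has_vector_derivative_add[OF has_vector_derivative_const
          integral_has_vector_derivative[OF cM[OF cf] t], of u0] by simp
  qed (rule eq)
  moreover have "u a = u0" using eq[of a] assms(1) by simp
  ultimately show ?thesis by blast
qed

text \<open>A coefficient bound \<open>K\<close> on the whole interval makes \<open>1 / (2 K)\<close> an admissible length everywhere.
  Since initial values are arbitrary, solutions on adjacent intervals can be joined; at the common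
  point both one-sided derivatives are given by the equation and therefore agree.\<close>

lemma linear_ode_solution:
  fixes M :: "real \<Rightarrow> 'e::euclidean_space \<Rightarrow> 'e"
  assumes "a \<le> b" and lin: "\<And>t. t \<in> {a..b} \<Longrightarrow> linear (M t)"
    and cont: "\<And>i. i \<in> Basis \<Longrightarrow> continuous_on {a..b} (\<lambda>t. M t i)"
  obtains u where "u a = u0" "\<And>t. t \<in> {a..b} \<Longrightarrow> (u has_vector_derivative M t (u t)) (at t within {a..b})"
proof -
  obtain K where K: "K > 0" "\<And>t u. t \<in> {a..b} \<Longrightarrow> norm (M t u) \<le> K * norm u"
    using linear_family_bounded_on_interval[OF lin cont] by blast
  define sol where "sol = (\<lambda>r s u. \<forall>t\<in>{r..s}. (u has_vector_derivative M t (u t)) (at t within {r..s}))"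
  let ?P = "\<lambda>r s. a \<le> r \<longrightarrow> s \<le> b \<longrightarrow> (\<forall>u0. \<exists>u. u r = u0 \<and> sol r s u)"
  have "?P a b"
  proof (rule Bolzano[where P = ?P, OF assms(1)])
    fix r c s assume trans: "?P r c" "?P c s" "r \<le> c" "c \<le> s"
    show "?P r s"
    proof (intro impI allI)
      fix u0 assume "a \<le> r" "s \<le> b"
      with trans have "\<forall>u0. \<exists>u. u r = u0 \<and> sol r c u" "\<forall>u0. \<exists>u. u c = u0 \<and> sol c s u" by auto
      then obtain u v where u: "u r = u0" "sol r c u" and v: "v c = u c" "sol c s v" by meson
      define w where "w = (\<lambda>t. if t \<in> {r..c} then u t else v t)"
      have "(w has_vector_derivative M t (w t)) (at t within {r..s})" if t: "t \<in> {r..s}" for t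
      proof -
        have e: "{r..c} \<union> (closure {r..c} \<inter> closure {c..s}) = {r..c}"
          "{c..s} \<union> (closure {r..c} \<inter> closure {c..s}) = {c..s}" "{r..s} = {r..c} \<union> {c..s}"
          using trans by auto
        have "(w has_vector_derivative (if t \<in> {r..c} then M t (u t) else M t (v t))) (at t within {r..s})"
          unfolding w_def
        proof (rule has_vector_derivative_If_within_closures[OF _ e(3), unfolded e(1,2)])
          show "t \<in> {r..c} \<union> {c..s}" using t trans by auto
          show "(u has_vector_derivative M t (u t)) (at t within {r..c})" if "t \<in> {r..c}"
            using that u(2) by (simp add: sol_def)
          show "(v has_vector_derivative M t (v t)) (at t within {c..s})" if "t \<in> {c..s}"
            using that v(2) by (simp add: sol_def)
          assume "t \<in> closure {r..c}" "t \<in> closure {c..s}"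
          then have "t = c" by simp
          with v(1) show "u t = v t" "M t (u t) = M t (v t)" by simp_all
        qed
        then show ?thesis by (simp add: w_def if_distrib)
      qed
      moreover have "w r = u0" using u(1) trans by (simp add: w_def)
      ultimately show "\<exists>w. w r = u0 \<and> sol r s w" unfolding sol_def by blast
    qed
  next
    fix x
    show "\<exists>d>0. \<forall>r s. r \<le> x \<and> x \<le> s \<and> s - r < d \<longrightarrow> ?P r s"
    proof (rule exI[of _ "1 / (2 * K)"], intro conjI allI impI)
      show "1 / (2 * K) > 0" using K(1) by simp
      fix r s u0 assume rs: "r \<le> x \<and> x \<le> s \<and> s - r < 1 / (2 * K)" "a \<le> r" "s \<le> b"
      then have sub: "{r..s} \<subseteq> {a..b}" by auto
      have "K * (s - r) \<le> K * (1 / (2 * K))" using rs K(1) by (intro mult_left_mono) auto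
      then have "K * (s - r) \<le> 1 / 2" using K(1) by simp
      then show "\<exists>u. u r = u0 \<and> sol r s u" unfolding sol_def
      proof (intro linear_ode_short_interval[where K = K])
        show "continuous_on {r..s} (\<lambda>t. M t i)" if "i \<in> Basis" for i
          by (rule continuous_on_subset[OF cont[OF that] sub])
      qed (use rs sub K lin in auto)
    qed
  qed
  then show thesis using that unfolding sol_def by blast
qed

text \<open>The function \<open>e\<^bsup>-2Kt\<^esup> \<bar>u(t)\<bar>\<^sup>2\<close> does not increase when \<open>K\<close> bounds the coefficient matrix.\<close>

lemma linear_ode_zero:
  fixes M :: "real \<Rightarrow> 'e::euclidean_space \<Rightarrow> 'e"
  assumes "a \<le> b" and lin: "\<And>t. t \<in> {a..b} \<Longrightarrow> linear (M t)"
    and cont: "\<And>i. i \<in> Basis \<Longrightarrow> continuous_on {a..b} (\<lambda>t. M t i)"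
    and u: "\<And>t. t \<in> {a..b} \<Longrightarrow> (u has_vector_derivative M t (u t)) (at t within {a..b})" and "u a = 0"
  shows "u b = 0"
proof -
  obtain K where K: "K > 0" "\<And>t u. t \<in> {a..b} \<Longrightarrow> norm (M t u) \<le> K * norm u"
    using linear_family_bounded_on_interval[OF lin cont] by blast
  let ?h = "\<lambda>t. exp (- (2 * K * t)) * (u t \<bullet> u t)"
  have cu: "continuous_on {a..b} u" using u by (rule continuous_on_vector_derivative)
  have "?h b \<le> ?h a"
  proof (rule DERIV_nonpos_imp_decreasing_open[OF assms(1)])
    show "continuous_on {a..b} ?h" by (intro continuous_intros cu)
    fix t assume t: "a < t" "t < b"
    then have "(u has_vector_derivative M t (u t)) (at t)"
      using u[of t] by (simp add: at_within_Icc_at)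
    then have d: "(u has_derivative (\<lambda>h. h *\<^sub>R M t (u t))) (at t)" by (simp add: has_vector_derivative_def)
    have "(?h has_real_derivative exp (- (2 * K * t)) * (2 * (u t \<bullet> M t (u t)) - 2 * K * (u t \<bullet> u t))) (at t)"
      unfolding has_field_derivative_def
      by (rule derivative_eq_intros d refl)+ (auto simp: algebra_simps inner_commute)
    moreover have "u t \<bullet> M t (u t) \<le> K * (u t \<bullet> u t)"
    proof -
      have "u t \<bullet> M t (u t) \<le> norm (u t) * norm (M t (u t))" by (rule norm_cauchy_schwarz)
      also have "\<dots> \<le> norm (u t) * (K * norm (u t))" using K(2)[of t] t by (intro mult_left_mono) auto
      finally show ?thesis by (simp add: dot_square_norm power2_eq_square mult_ac)
    qed
    ultimately show "\<exists>y. (?h has_real_derivative y) (at t) \<and> y \<le> 0"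
      by (intro exI conjI) (auto simp: mult_le_0_iff)
  qed
  then have "exp (- (2 * K * b)) * (u b \<bullet> u b) \<le> 0" using assms(5) by simp
  then have "u b \<bullet> u b \<le> 0" by (simp add: mult_le_0_iff)
  then show ?thesis using inner_ge_zero[of "u b"] inner_eq_zero_iff[of "u b"] by simp
qed


section \<open>Tangent spaces and vector fields\<close>

lemma sum_fun_apply: "(\<Sum>i\<in>I. g i) x = (\<Sum>i\<in>I. g i x)"
  by (induction I rule: infinite_finite_induct) (simp_all add: plus_fun_def zero_fun_def)

lemma frechet_derivative_eqI: "(f has_derivative f') (at x) \<Longrightarrow> frechet_derivative f (at x) = f'"
  using frechet_derivative_at by metis

locale smooth_manifold =
  fixes A :: "('a::{t2_space, second_countable_topology}, 'e::euclidean_space) chart set"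
  assumes smooth_atlas: "smooth_atlas A"
begin

lemma
  assumes "c \<in> A"
  shows open_chart_dom: "open (chart_dom c)" and open_chart_img: "open (chart_img c)"
    and chart_homeomorphism: "homeomorphism (chart_dom c) (chart_img c) (chart_map c) (chart_inv c)"
  using smooth_atlas assms unfolding smooth_atlas_def is_chart_def by auto

lemma chart_map_in_img: "q \<in> chart_dom c \<Longrightarrow> chart_map c q \<in> chart_img c"
  by (simp add: chart_img_def)

lemma chart_inv_map: "c \<in> A \<Longrightarrow> q \<in> chart_dom c \<Longrightarrow> chart_inv c (chart_map c q) = q"
  using chart_homeomorphism homeomorphism_apply1 by blast

lemma chart_map_inv: "c \<in> A \<Longrightarrow> x \<in> chart_img c \<Longrightarrow> chart_map c (chart_inv c x) = x"
  using chart_homeomorphism homeomorphism_apply2 by blast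

lemma chart_inv_in_dom: "c \<in> A \<Longrightarrow> x \<in> chart_img c \<Longrightarrow> chart_inv c x \<in> chart_dom c"
  using chart_homeomorphism[of c] unfolding homeomorphism_def by blast

lemma continuous_on_chart_map: "c \<in> A \<Longrightarrow> continuous_on (chart_dom c) (chart_map c)"
  using chart_homeomorphism[of c] unfolding homeomorphism_def by blast

lemma continuous_on_chart_inv: "c \<in> A \<Longrightarrow> continuous_on (chart_img c) (chart_inv c)"
  using chart_homeomorphism[of c] unfolding homeomorphism_def by blast

lemma chart_exists: obtains c where "c \<in> A" "p \<in> chart_dom c"
  using smooth_atlas unfolding smooth_atlas_def by blast

lemma open_chart_image:
  assumes "c \<in> A" "open W"
  shows "open (chart_map c ` (chart_dom c \<inter> W))"
proof -
  have "chart_map c ` (chart_dom c \<inter> W) = chart_img c \<inter> chart_inv c -` W"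
  proof safe
    fix x assume "x \<in> chart_img c" "chart_inv c x \<in> W"
    then show "x \<in> chart_map c ` (chart_dom c \<inter> W)"
      using chart_map_inv[OF assms(1)] chart_inv_in_dom[OF assms(1)] by (metis IntI image_eqI)
  qed (auto simp: chart_map_in_img chart_inv_map assms(1))
  then show ?thesis
    using continuous_open_preimage[OF continuous_on_chart_inv[OF assms(1)] open_chart_img[OF assms(1)] assms(2)]
    by simp
qed

abbreviation overlap :: "('a, 'e) chart \<Rightarrow> ('a, 'e) chart \<Rightarrow> 'e set" where
  "overlap c d \<equiv> chart_map c ` (chart_dom c \<inter> chart_dom d)"

lemma open_overlap: "c \<in> A \<Longrightarrow> d \<in> A \<Longrightarrow> open (overlap c d)"
  by (simp add: open_chart_image open_chart_dom)

lemma smooth_transition: "c \<in> A \<Longrightarrow> d \<in> A \<Longrightarrow> smooth_on (overlap c d) (transition c d)"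
  using smooth_atlas unfolding smooth_atlas_def by blast

lemma transition_chart_map: "c \<in> A \<Longrightarrow> q \<in> chart_dom c \<Longrightarrow> transition c d (chart_map c q) = chart_map d q"
  by (simp add: transition_def chart_inv_map)

definition dtrans :: "('a, 'e) chart \<Rightarrow> ('a, 'e) chart \<Rightarrow> 'a \<Rightarrow> 'e \<Rightarrow> 'e" where
  "dtrans c d q = frechet_derivative (transition c d) (at (chart_map c q))"

lemma transition_has_derivative:
  assumes "c \<in> A" "d \<in> A" "q \<in> chart_dom c" "q \<in> chart_dom d"
  shows "(transition c d has_derivative dtrans c d q) (at (chart_map c q))"
  unfolding dtrans_def
  by (rule smooth_on_imp_has_derivative[OF smooth_transition[OF assms(1,2)]]) (use assms in auto)

lemma linear_dtrans:
  "c \<in> A \<Longrightarrow> d \<in> A \<Longrightarrow> q \<in> chart_dom c \<Longrightarrow> q \<in> chart_dom d \<Longrightarrow> linear (dtrans c d q)"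
  using transition_has_derivative has_derivative_linear by blast

lemma dtrans_self:
  assumes "c \<in> A" "q \<in> chart_dom c"
  shows "dtrans c c q u = u"
proof -
  have "(transition c c has_derivative (\<lambda>u. u)) (at (chart_map c q))"
    by (rule has_derivative_transform_within_open[OF has_derivative_ident open_chart_img[OF assms(1)]])
      (auto simp: assms chart_map_in_img transition_def chart_map_inv)
  then show ?thesis by (simp add: dtrans_def frechet_derivative_eqI)
qed

text \<open>The cocycle rule for the differentials of the transition maps: it is what makes \<open>coord_vec\<close> a
  tangent vector.\<close>

lemma dtrans_comp:
  assumes "c \<in> A" "d \<in> A" "e \<in> A" "q \<in> chart_dom c" "q \<in> chart_dom d" "q \<in> chart_dom e"
  shows "dtrans d e q (dtrans c d q u) = dtrans c e q u"
proof -
  have "(transition d e \<circ> transition c d has_derivative dtrans d e q \<circ> dtrans c d q) (at (chart_map c q))"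
    by (rule diff_chain_at)
      (use assms transition_has_derivative[of c d q] transition_has_derivative[of d e q]
        in \<open>simp_all add: transition_chart_map\<close>)
  then have "(transition c e has_derivative dtrans d e q \<circ> dtrans c d q) (at (chart_map c q))"
    by (rule has_derivative_transform_within_open[OF _ open_overlap[OF assms(1,2)]])
      (use assms in \<open>auto simp: transition_def chart_inv_map\<close>)
  then show ?thesis by (simp add: dtrans_def[of c e] frechet_derivative_eqI)
qed

lemma coord_vec_apply:
  "coord_vec A c q u d = (if d \<in> A \<and> q \<in> chart_dom d then dtrans c d q u else 0)"
  by (simp add: coord_vec_def dtrans_def)

lemma coord_vec_same: "c \<in> A \<Longrightarrow> q \<in> chart_dom c \<Longrightarrow> coord_vec A c q u c = u"
  by (simp add: coord_vec_apply dtrans_self)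

lemma coord_vec_in_tangent_space: "c \<in> A \<Longrightarrow> q \<in> chart_dom c \<Longrightarrow> coord_vec A c q u \<in> tangent_space A q"
  unfolding tangent_space_def by (simp add: coord_vec_apply dtrans_comp flip: dtrans_def)

lemma tangent_vec_transform:
  "v \<in> tangent_space A q \<Longrightarrow> c \<in> A \<Longrightarrow> d \<in> A \<Longrightarrow> q \<in> chart_dom c \<Longrightarrow> q \<in> chart_dom d \<Longrightarrow> v d = dtrans c d q (v c)"
  unfolding tangent_space_def dtrans_def by blast

lemma coord_vec_eq_tangent_vec:
  assumes "v \<in> tangent_space A q" "c \<in> A" "q \<in> chart_dom c"
  shows "coord_vec A c q (v c) = v"
proof
  fix d show "coord_vec A c q (v c) d = v d"
  proof (cases "d \<in> A \<and> q \<in> chart_dom d")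
    case True
    then show ?thesis
      using tangent_vec_transform[OF assms(1,2) _ assms(3), of d] by (simp add: coord_vec_apply)
  next
    case False
    then have "v d = 0" using assms(1) unfolding tangent_space_def by blast
    with False show ?thesis by (simp only: coord_vec_apply if_False)
  qed
qed

lemma tangent_vec_eqI:
  "v \<in> tangent_space A q \<Longrightarrow> w \<in> tangent_space A q \<Longrightarrow> c \<in> A \<Longrightarrow> q \<in> chart_dom c \<Longrightarrow> v c = w c \<Longrightarrow> v = w"
  using coord_vec_eq_tangent_vec by metis

lemma linear_coord_vec:
  assumes "c \<in> A" "q \<in> chart_dom c"
  shows "linear (coord_vec A c q)"
  by (rule linearI; rule ext)
    (use linear_dtrans[OF assms(1) _ assms(2)] in \<open>auto simp: coord_vec_apply linear_add linear_scale\<close>)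

lemma subspace_tangent_space: "subspace (tangent_space A q)"
proof (rule subspaceI)
  obtain c where c: "c \<in> A" "q \<in> chart_dom c" by (rule chart_exists)
  note l = linear_coord_vec[OF c]
  show "0 \<in> tangent_space A q"
    using coord_vec_in_tangent_space[OF c, of 0] linear_0[OF l] by simp
  fix v assume v: "v \<in> tangent_space A q"
  have "coord_vec A c q (r *\<^sub>R v c) = r *\<^sub>R v" for r
    using linear_scale[OF l] coord_vec_eq_tangent_vec[OF v c] by simp
  then show "r *\<^sub>R v \<in> tangent_space A q" for r
    using coord_vec_in_tangent_space[OF c, of "r *\<^sub>R v c"] by simp
  fix w assume w: "w \<in> tangent_space A q"
  have "coord_vec A c q (v c + w c) = v + w"
    using linear_add[OF l] coord_vec_eq_tangent_vec[OF v c] coord_vec_eq_tangent_vec[OF w c] by simp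
  then show "v + w \<in> tangent_space A q"
    using coord_vec_in_tangent_space[OF c, of "v c + w c"] by simp
qed

lemma vector_field_in_tangent_space: "X \<in> vector_fields A \<Longrightarrow> X q \<in> tangent_space A q"
  unfolding vector_fields_def by blast

lemma smooth_vf_rep: "X \<in> vector_fields A \<Longrightarrow> c \<in> A \<Longrightarrow> smooth_on (chart_img c) (vf_rep c X)"
  unfolding vector_fields_def by blast

lemma vf_rep_chart_map: "c \<in> A \<Longrightarrow> q \<in> chart_dom c \<Longrightarrow> vf_rep c X (chart_map c q) = X q c"
  by (simp add: vf_rep_def chart_inv_map)

lemma vector_field_add:
  assumes "X \<in> vector_fields A" "Y \<in> vector_fields A"
  shows "X + Y \<in> vector_fields A"
proof -
  have "smooth_on (chart_img c) (vf_rep c (X + Y))" if "c \<in> A" for c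
    using smooth_on_add[OF open_chart_img[OF that] smooth_vf_rep[OF assms(1) that] smooth_vf_rep[OF assms(2) that]]
    by (simp add: vf_rep_def plus_fun_def)
  then show ?thesis
    using assms subspace_add[OF subspace_tangent_space] unfolding vector_fields_def by (auto simp: plus_fun_def)
qed

lemma vector_field_scale:
  assumes "f \<in> smooth_functions A" "X \<in> vector_fields A"
  shows "(\<lambda>q. f q *\<^sub>R X q) \<in> vector_fields A"
proof -
  have "smooth_on (chart_img c) (vf_rep c (\<lambda>q. f q *\<^sub>R X q))" if "c \<in> A" for c
    using smooth_on_scaleR[OF open_chart_img[OF that] _ smooth_vf_rep[OF assms(2) that], of "f \<circ> chart_inv c"]
      assms(1) that by (simp add: vf_rep_def smooth_functions_def o_def)
  then show ?thesis
    using assms subspace_scale[OF subspace_tangent_space] unfolding vector_fields_def by auto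
qed

lemma const_smooth_function: "(\<lambda>q. r) \<in> smooth_functions A"
  by (simp add: smooth_functions_def o_def smooth_on_const)

lemma vector_field_scale_const: "X \<in> vector_fields A \<Longrightarrow> r *\<^sub>R X \<in> vector_fields A"
  using vector_field_scale[OF const_smooth_function] by (simp add: scaleR_fun_def)

lemma vector_field_0: "0 \<in> vector_fields A"
  using subspace_0[OF subspace_tangent_space]
  by (simp add: vector_fields_def vf_rep_def zero_fun_def smooth_on_const)

lemma vector_field_diff: "X \<in> vector_fields A \<Longrightarrow> Y \<in> vector_fields A \<Longrightarrow> X - Y \<in> vector_fields A"
  using vector_field_add[OF _ vector_field_scale_const[of Y "-1"], of X] by simp

lemma vector_field_sum: "(\<And>i. i \<in> I \<Longrightarrow> X i \<in> vector_fields A) \<Longrightarrow> (\<Sum>i\<in>I. X i) \<in> vector_fields A"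
  by (induction I rule: infinite_finite_induct) (auto intro: vector_field_0 vector_field_add)

text \<open>The definition of \<open>dir_deriv\<close> picks some chart around \<open>q\<close>. By the chain rule, the passage to another
  chart is absorbed by the transformation of \<open>v\<close>.\<close>

lemma dir_deriv_chart:
  assumes f: "f \<in> smooth_functions A" and v: "v \<in> tangent_space A q" and c: "c \<in> A" "q \<in> chart_dom c"
  shows "dir_deriv A q v f = frechet_derivative (f \<circ> chart_inv c) (at (chart_map c q)) (v c)"
proof -
  define d where "d = chart_at A q"
  have d: "d \<in> A" "q \<in> chart_dom d"
    unfolding d_def chart_at_def using someI[of "\<lambda>c. c \<in> A \<and> q \<in> chart_dom c" c] c by auto
  let ?f' = "frechet_derivative (f \<circ> chart_inv d) (at (chart_map d q))"
  have "((f \<circ> chart_inv d) has_derivative ?f') (at (chart_map d q))"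
    using f d by (intro smooth_on_imp_has_derivative[of "chart_img d"]) (auto simp: smooth_functions_def chart_map_in_img)
  then have "((f \<circ> chart_inv d) \<circ> transition c d has_derivative ?f' \<circ> dtrans c d q) (at (chart_map c q))"
    by (intro diff_chain_at) (simp_all add: transition_has_derivative c d transition_chart_map)
  then have "((f \<circ> chart_inv c) has_derivative ?f' \<circ> dtrans c d q) (at (chart_map c q))"
    by (rule has_derivative_transform_within_open[OF _ open_overlap[OF c(1) d(1)]])
      (use c d in \<open>auto simp: transition_def chart_inv_map\<close>)
  then show ?thesis
    by (simp add: dir_deriv_def Let_def frechet_derivative_eqI tangent_vec_transform[OF v c(1) d(1) c(2) d(2)] flip: d_def)
qed


section \<open>Extension of local functions and fields by zero\<close>

definition extend_function :: "('a, 'e) chart \<Rightarrow> ('e \<Rightarrow> real) \<Rightarrow> 'a \<Rightarrow> real" where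
  "extend_function c h = (\<lambda>q. if q \<in> chart_dom c then h (chart_map c q) else 0)"

definition extend_field :: "('a, 'e) chart \<Rightarrow> ('e \<Rightarrow> 'e) \<Rightarrow> ('a, 'e) vfield" where
  "extend_field c h = (\<lambda>q. if q \<in> chart_dom c then coord_vec A c q (h (chart_map c q)) else 0)"

text \<open>The overlap with the chart \<open>c\<close> and the complement of \<open>K\<close> are open and cover \<open>d\<close>: compact sets in a
  Hausdorff space are closed. This is where the Hausdorff axiom enters.\<close>

lemma smooth_on_chart_img_local:
  assumes c: "c \<in> A" and d: "d \<in> A" and K: "compact K" "K \<subseteq> chart_dom c"
    and 1: "smooth_on (overlap d c) g" and 2: "\<And>x. x \<in> chart_img d \<Longrightarrow> chart_inv d x \<notin> K \<Longrightarrow> g x = 0"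
  shows "smooth_on (chart_img d) g"
proof (rule smooth_on_local)
  fix x assume x: "x \<in> chart_img d"
  show "\<exists>T. open T \<and> x \<in> T \<and> smooth_on T g"
  proof (cases "chart_inv d x \<in> chart_dom c")
    case True
    then have "x \<in> overlap d c"
      using chart_map_inv[OF d x] chart_inv_in_dom[OF d x] by (metis IntI image_eqI)
    then show ?thesis using 1 open_overlap[OF d c] by blast
  next
    case False
    let ?T = "chart_map d ` (chart_dom d \<inter> - K)"
    have T: "open ?T" by (rule open_chart_image[OF d]) (simp add: K(1) compact_imp_closed open_Compl)
    have "smooth_on ?T g"
      by (rule smooth_on_cong[OF T _ smooth_on_const[of _ 0]])
        (use 2 in \<open>auto simp: chart_inv_map d chart_map_in_img\<close>)
    moreover have "x \<in> ?T"
      using False K(2) chart_map_inv[OF d x] chart_inv_in_dom[OF d x] by (metis ComplI IntI image_eqI subsetD)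
    ultimately show ?thesis using T by blast
  qed
qed

lemma extend_function_smooth:
  assumes c: "c \<in> A" and K: "compact K" "K \<subseteq> chart_dom c" and h: "smooth_on (chart_img c) h"
    and h0: "\<And>q. q \<in> chart_dom c \<Longrightarrow> q \<notin> K \<Longrightarrow> h (chart_map c q) = 0"
  shows "extend_function c h \<in> smooth_functions A"
  unfolding smooth_functions_def
proof (intro CollectI ballI)
  fix d assume d: "d \<in> A"
  show "smooth_on (chart_img d) (extend_function c h \<circ> chart_inv d)"
  proof (rule smooth_on_chart_img_local[OF c d K])
    have s: "smooth_on (overlap d c) (\<lambda>x. h (transition d c x))"
      by (rule smooth_on_compose[OF open_overlap[OF d c] open_chart_img[OF c] smooth_transition[OF d c] h])
        (auto simp: transition_chart_map d chart_map_in_img)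
    show "smooth_on (overlap d c) (extend_function c h \<circ> chart_inv d)"
      by (rule smooth_on_cong[OF open_overlap[OF d c] _ s])
        (auto simp: transition_chart_map d chart_inv_map extend_function_def)
  qed (auto simp: extend_function_def h0)
qed

lemma extend_field_smooth:
  assumes c: "c \<in> A" and K: "compact K" "K \<subseteq> chart_dom c" and h: "smooth_on (chart_img c) h"
    and h0: "\<And>q. q \<in> chart_dom c \<Longrightarrow> q \<notin> K \<Longrightarrow> h (chart_map c q) = 0"
  shows "extend_field c h \<in> vector_fields A"
  unfolding vector_fields_def
proof (intro CollectI conjI allI ballI)
  show "extend_field c h q \<in> tangent_space A q" for q
    using subspace_0[OF subspace_tangent_space] coord_vec_in_tangent_space[OF c] by (auto simp: extend_field_def)
next
  fix d assume d: "d \<in> A"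
  show "smooth_on (chart_img d) (vf_rep d (extend_field c h))"
  proof (rule smooth_on_chart_img_local[OF c d K])
    \<comment> \<open>In the chart \<open>d\<close> the field is the differential of the transition map, applied to \<open>h\<close> in the
      coordinates of \<open>c\<close>.\<close>
    let ?M = "\<lambda>x. frechet_derivative (transition c d) (at (transition d c x))"
    have 1: "smooth_on (overlap d c) (\<lambda>x. h (transition d c x))"
      by (rule smooth_on_compose[OF open_overlap[OF d c] open_chart_img[OF c] smooth_transition[OF d c] h])
        (auto simp: transition_chart_map d chart_map_in_img)
    have 2: "smooth_on (overlap d c) (\<lambda>x. ?M x b)" for b
      by (rule smooth_on_compose[OF open_overlap[OF d c] open_overlap[OF c d] smooth_transition[OF d c]
            smooth_on_derivative[OF smooth_transition[OF c d]]])
        (auto simp: transition_chart_map d)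
    have 3: "linear (?M x)" if "x \<in> overlap d c" for x
      using that linear_dtrans[OF c d] by (auto simp: transition_chart_map d dtrans_def)
    have s: "smooth_on (overlap d c) (\<lambda>x. ?M x (h (transition d c x)))"
      by (rule smooth_on_linear_family[where M = ?M, OF open_overlap[OF d c] 3 2 1])
    show "smooth_on (overlap d c) (vf_rep d (extend_field c h))"
      by (rule smooth_on_cong[OF open_overlap[OF d c] _ s])
        (auto simp: transition_chart_map d chart_inv_map extend_field_def vf_rep_def coord_vec_apply dtrans_def)
  next
    fix x assume "x \<in> chart_img d" "chart_inv d x \<notin> K"
    then show "vf_rep d (extend_field c h) x = 0"
      using h0 linear_0[OF linear_coord_vec[OF c]] by (auto simp: vf_rep_def extend_field_def zero_fun_def)
  qed
qed

lemma chart_bump: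
  assumes c: "c \<in> A" and p: "p \<in> chart_dom c"
  obtains N \<psi> K where "open N" "p \<in> N" "N \<subseteq> chart_dom c" "smooth_on (chart_img c) \<psi>"
    "\<And>q. q \<in> N \<Longrightarrow> \<psi> (chart_map c q) = (1::real)" "compact K" "K \<subseteq> chart_dom c"
    "\<And>q. q \<in> chart_dom c \<Longrightarrow> q \<notin> K \<Longrightarrow> \<psi> (chart_map c q) = 0"
proof -
  obtain r where r: "r > 0" "cball (chart_map c p) r \<subseteq> chart_img c"
    using open_chart_img[OF c] chart_map_in_img[OF p] open_contains_cball by metis
  obtain \<psi> :: "'e \<Rightarrow> real" and \<epsilon> where \<psi>: "smooth_on UNIV \<psi>" "\<epsilon> > 0"
    "\<And>x. x \<in> ball (chart_map c p) \<epsilon> \<Longrightarrow> \<psi> x = 1" "\<And>x. x \<notin> cball (chart_map c p) r \<Longrightarrow> \<psi> x = 0"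
    by (rule smooth_bump[OF r(1)]) (rule that)
  show thesis
  proof
    show "open (chart_dom c \<inter> chart_map c -` ball (chart_map c p) \<epsilon>)"
      by (rule continuous_open_preimage[OF continuous_on_chart_map[OF c] open_chart_dom[OF c] open_ball])
    show "compact (chart_inv c ` cball (chart_map c p) r)"
      by (rule compact_continuous_image[OF continuous_on_subset[OF continuous_on_chart_inv[OF c] r(2)] compact_cball])
    show "chart_inv c ` cball (chart_map c p) r \<subseteq> chart_dom c"
      using r(2) chart_inv_in_dom[OF c] by blast
    show "\<psi> (chart_map c q) = 0" if "q \<in> chart_dom c" "q \<notin> chart_inv c ` cball (chart_map c p) r" for q
      using that \<psi>(4) chart_inv_map[OF c that(1)] by (metis image_eqI)
    show "smooth_on (chart_img c) \<psi>" by (rule smooth_on_subset[OF \<psi>(1)]) simp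
  qed (use p \<psi> in auto)
qed

end


section \<open>Affine connections in coordinates\<close>

locale affine_manifold = smooth_manifold A
  for A :: "('a::{t2_space, second_countable_topology}, 'e::euclidean_space) chart set" +
  fixes D :: "('a, 'e) connection"
  assumes affine: "affine_connection A D"
begin

lemma connection_in: "X \<in> vector_fields A \<Longrightarrow> Y \<in> vector_fields A \<Longrightarrow> D X Y \<in> vector_fields A"
  using affine unfolding affine_connection_def by blast

lemma connection_add_left:
  "X \<in> vector_fields A \<Longrightarrow> X' \<in> vector_fields A \<Longrightarrow> Y \<in> vector_fields A \<Longrightarrow> D (X + X') Y = D X Y + D X' Y"
  using affine unfolding affine_connection_def by blast

lemma connection_scale_left:
  "f \<in> smooth_functions A \<Longrightarrow> X \<in> vector_fields A \<Longrightarrow> Y \<in> vector_fields A \<Longrightarrow>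
    D (\<lambda>p. f p *\<^sub>R X p) Y = (\<lambda>p. f p *\<^sub>R D X Y p)"
  using affine unfolding affine_connection_def by blast

lemma connection_add_right:
  "X \<in> vector_fields A \<Longrightarrow> Y \<in> vector_fields A \<Longrightarrow> Y' \<in> vector_fields A \<Longrightarrow> D X (Y + Y') = D X Y + D X Y'"
  using affine unfolding affine_connection_def by blast

lemma connection_leibniz:
  "f \<in> smooth_functions A \<Longrightarrow> X \<in> vector_fields A \<Longrightarrow> Y \<in> vector_fields A \<Longrightarrow>
    D X (\<lambda>p. f p *\<^sub>R Y p) = (\<lambda>p. dir_deriv A p (X p) f *\<^sub>R Y p + f p *\<^sub>R D X Y p)"
  using affine unfolding affine_connection_def by blast

lemma connection_0_right: "X \<in> vector_fields A \<Longrightarrow> D X 0 = 0"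
  using connection_add_right[of X 0 0] vector_field_0 by simp

lemma connection_0_left: "Y \<in> vector_fields A \<Longrightarrow> D 0 Y = 0"
  using connection_add_left[of 0 0 Y] vector_field_0 by simp

lemma connection_sum_right:
  assumes "X \<in> vector_fields A" "finite I"
    "\<And>i. i \<in> I \<Longrightarrow> f i \<in> smooth_functions A" "\<And>i. i \<in> I \<Longrightarrow> Y i \<in> vector_fields A"
  shows "D X (\<Sum>i\<in>I. (\<lambda>p. f i p *\<^sub>R Y i p)) =
    (\<Sum>i\<in>I. (\<lambda>p. dir_deriv A p (X p) (f i) *\<^sub>R Y i p + f i p *\<^sub>R D X (Y i) p))"
  using assms(2-4)
proof (induction I rule: finite_induct)
  case empty
  show ?case unfolding sum.empty by (rule connection_0_right[OF assms(1)])
next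
  case (insert i I)
  have i: "f i \<in> smooth_functions A" "Y i \<in> vector_fields A" using insert.prems by auto
  have s: "(\<Sum>i\<in>I. (\<lambda>p. f i p *\<^sub>R Y i p)) \<in> vector_fields A"
    using insert.prems by (intro vector_field_sum vector_field_scale) auto
  have IH: "D X (\<Sum>i\<in>I. (\<lambda>p. f i p *\<^sub>R Y i p)) =
      (\<Sum>i\<in>I. (\<lambda>p. dir_deriv A p (X p) (f i) *\<^sub>R Y i p + f i p *\<^sub>R D X (Y i) p))"
    using insert.prems by (intro insert.IH) auto
  show ?case
    by (simp only: sum.insert[OF insert.hyps] connection_add_right[OF assms(1) vector_field_scale[OF i] s]
        connection_leibniz[OF i(1) assms(1) i(2)] IH)
qed

lemma connection_sum_left:
  assumes "Y \<in> vector_fields A" "finite I"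
    "\<And>i. i \<in> I \<Longrightarrow> f i \<in> smooth_functions A" "\<And>i. i \<in> I \<Longrightarrow> X i \<in> vector_fields A"
  shows "D (\<Sum>i\<in>I. (\<lambda>p. f i p *\<^sub>R X i p)) Y = (\<Sum>i\<in>I. (\<lambda>p. f i p *\<^sub>R D (X i) Y p))"
  using assms(2-4)
proof (induction I rule: finite_induct)
  case empty
  show ?case unfolding sum.empty by (rule connection_0_left[OF assms(1)])
next
  case (insert i I)
  have i: "f i \<in> smooth_functions A" "X i \<in> vector_fields A" using insert.prems by auto
  have s: "(\<Sum>i\<in>I. (\<lambda>p. f i p *\<^sub>R X i p)) \<in> vector_fields A"
    using insert.prems by (intro vector_field_sum vector_field_scale) auto
  have IH: "D (\<Sum>i\<in>I. (\<lambda>p. f i p *\<^sub>R X i p)) Y = (\<Sum>i\<in>I. (\<lambda>p. f i p *\<^sub>R D (X i) Y p))"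
    using insert.prems by (intro insert.IH) auto
  show ?case
    by (simp only: sum.insert[OF insert.hyps] connection_add_left[OF vector_field_scale[OF i] s assms(1)]
        connection_scale_left[OF i assms(1)] IH)
qed

text \<open>The bilinear expression \<open>\<Gamma>\<^sup>k\<^sub>a\<^sub>b x\<^sup>a u\<^sup>b\<close>, where the Christoffel symbols are read off from the derivatives
  of the fields \<open>F\<close> along each other.\<close>

definition christoffel :: "('a, 'e) chart \<Rightarrow> ('e \<Rightarrow> ('a, 'e) vfield) \<Rightarrow> 'a \<Rightarrow> 'e \<Rightarrow> 'e \<Rightarrow> 'e" where
  "christoffel c F q x u = (\<Sum>a\<in>Basis. \<Sum>b\<in>Basis. ((x \<bullet> a) * (u \<bullet> b)) *\<^sub>R D (F a) (F b) q c)"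

text \<open>The connection acts on global vector fields, whereas the coordinate fields of a chart exist only on its
  domain. They are replaced by global fields with the same values near the point of interest.\<close>

definition adapted_frame :: "('a, 'e) chart \<Rightarrow> 'a set \<Rightarrow> ('e \<Rightarrow> ('a, 'e) vfield) \<Rightarrow> bool" where
  "adapted_frame c N F \<longleftrightarrow> c \<in> A \<and> open N \<and> N \<subseteq> chart_dom c \<and> (\<forall>b. F b \<in> vector_fields A) \<and>
    (\<forall>q\<in>N. \<forall>b. F b q = coord_vec A c q b) \<and>
    (\<forall>X\<in>vector_fields A. \<forall>Y\<in>vector_fields A. \<forall>q\<in>N.
      D X Y q c = frechet_derivative (vf_rep c Y) (at (chart_map c q)) (X q c) +
        christoffel c F q (X q c) (Y q c))"

lemma linear_christoffel: "linear (christoffel c F q x)"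
  by (rule linearI)
    (simp_all add: christoffel_def inner_add_left scaleR_add_left distrib_left sum.distrib scaleR_sum_right mult_ac)

text \<open>With a bump function \<open>\<psi>\<close>, the fields \<open>F b = \<psi> \<partial>\<^sub>b\<close> and the functions \<open>f Y b = \<psi> Y\<^sup>b\<close> extend by zero to
  all of \<open>M\<close>, and \<open>\<psi>\<^sup>2 Y = \<Sum>\<^sub>b (f Y b) (F b)\<close> holds globally. Applying the Leibniz rule to both sides, and
  tensoriality to the same expansion of the direction \<open>X\<close>, gives the formula wherever \<open>\<psi> = 1\<close>,
  because \<open>\<psi>\<^sup>2\<close> has derivative \<open>0\<close> there. This also shows that the connection is local.\<close>

lemma adapted_frame_exists:
  assumes c: "c \<in> A" and p: "p \<in> chart_dom c"
  obtains N F where "p \<in> N" "adapted_frame c N F"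
proof -
  obtain N \<psi> K where N: "open N" "p \<in> N" "N \<subseteq> chart_dom c"
    and \<psi>: "smooth_on (chart_img c) \<psi>" "\<And>q. q \<in> N \<Longrightarrow> \<psi> (chart_map c q) = (1::real)"
    and K: "compact K" "K \<subseteq> chart_dom c" "\<And>q. q \<in> chart_dom c \<Longrightarrow> q \<notin> K \<Longrightarrow> \<psi> (chart_map c q) = 0"
    by (rule chart_bump[OF c p]) (rule that)
  define F where "F = (\<lambda>b. extend_field c (\<lambda>x. \<psi> x *\<^sub>R b))"
  define f where "f = (\<lambda>Y b. extend_function c (\<lambda>x. \<psi> x * (vf_rep c Y x \<bullet> b)))"
  define \<phi> where "\<phi> = extend_function c (\<lambda>x. \<psi> x * \<psi> x)"
  note img = open_chart_img[OF c]
  have F: "F b \<in> vector_fields A" for b unfolding F_def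
    by (rule extend_field_smooth[OF c K(1,2)])
      (auto intro: smooth_on_scaleR[OF img] \<psi>(1) smooth_on_const simp: K(3))
  have f: "f Y b \<in> smooth_functions A" if "Y \<in> vector_fields A" for Y b unfolding f_def
    by (rule extend_function_smooth[OF c K(1,2)])
      (auto intro!: smooth_on_mult[OF img] smooth_on_inner[OF img] \<psi>(1) smooth_on_const smooth_vf_rep[OF that c] simp: K(3))
  have \<phi>: "\<phi> \<in> smooth_functions A" unfolding \<phi>_def
    by (rule extend_function_smooth[OF c K(1,2)])
      (auto intro!: smooth_on_mult[OF img] \<psi>(1) simp: K(3))
  have F_N: "F b q = coord_vec A c q b" if "q \<in> N" for b q
    using that N(3) by (auto simp: F_def extend_field_def \<psi>(2))
  have F_c: "F b q c = b" if "q \<in> N" for b q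
    using that N(3) by (auto simp: F_N coord_vec_same c)
  have f_N: "f Y b q = Y q c \<bullet> b" if "q \<in> N" for Y b q
    using that N(3) by (auto simp: f_def extend_function_def \<psi>(2) vf_rep_chart_map[OF c])
  have \<phi>_N: "\<phi> q = 1" if "q \<in> N" for q
    using that N(3) by (auto simp: \<phi>_def extend_function_def \<psi>(2))
  have expand: "(\<lambda>q. \<phi> q *\<^sub>R Y q) = (\<Sum>b\<in>Basis. (\<lambda>q. f Y b q *\<^sub>R F b q))" if Y: "Y \<in> vector_fields A" for Y
  proof
    fix q
    show "\<phi> q *\<^sub>R Y q = (\<Sum>b\<in>Basis. (\<lambda>q. f Y b q *\<^sub>R F b q)) q"
    proof (cases "q \<in> chart_dom c")
      case True
      let ?x = "chart_map c q"
      have "Y q = (\<Sum>b\<in>Basis. (Y q c \<bullet> b) *\<^sub>R coord_vec A c q b)"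
        using linear_sum_Basis[OF linear_coord_vec[OF c True], of "Y q c"]
          coord_vec_eq_tangent_vec[OF vector_field_in_tangent_space[OF Y] c True] by simp
      then have "\<phi> q *\<^sub>R Y q = (\<psi> ?x * \<psi> ?x) *\<^sub>R (\<Sum>b\<in>Basis. (Y q c \<bullet> b) *\<^sub>R coord_vec A c q b)"
        using True by (simp add: \<phi>_def extend_function_def)
      also have "\<dots> = (\<Sum>b\<in>Basis. f Y b q *\<^sub>R F b q)"
        using True by (simp add: scaleR_sum_right f_def F_def extend_function_def extend_field_def
            linear_scale[OF linear_coord_vec[OF c True]] vf_rep_chart_map[OF c] mult_ac)
      finally show ?thesis by (simp add: sum_fun_apply)
    next
      case False
      then show ?thesis by (simp add: sum_fun_apply \<phi>_def f_def extend_function_def)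
    qed
  qed
  have img_N: "open (chart_map c ` N)"
    using open_chart_image[OF c N(1)] N(3) by (simp add: Int_absorb1)
  have local_D: "frechet_derivative (h \<circ> chart_inv c) (at (chart_map c q)) = h'"
    if "q \<in> N" "(g has_derivative h') (at (chart_map c q))" "\<And>q. q \<in> N \<Longrightarrow> h q = g (chart_map c q)"
    for h :: "'a \<Rightarrow> real" and g h' q
  proof (rule frechet_derivative_eqI, rule has_derivative_transform_within_open[OF that(2) img_N])
    show "chart_map c q \<in> chart_map c ` N" using that(1) by simp
    fix x assume "x \<in> chart_map c ` N"
    then show "g x = (h \<circ> chart_inv c) x" using N(3) that(3) chart_inv_map[OF c] by auto
  qed
  have right: "D X Y q = (\<Sum>b\<in>Basis. dir_deriv A q (X q) (f Y b) *\<^sub>R F b q + (Y q c \<bullet> b) *\<^sub>R D X (F b) q)"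
    if X: "X \<in> vector_fields A" and Y: "Y \<in> vector_fields A" and q: "q \<in> N" for X Y q
  proof -
    have "dir_deriv A q (X q) \<phi> = 0"
      using N(3) q
      by (simp add: dir_deriv_chart[OF \<phi> vector_field_in_tangent_space[OF X] c] subsetD
          local_D[OF q has_derivative_const[of 1]] \<phi>_N)
    then have "D X Y q = D X (\<lambda>q. \<phi> q *\<^sub>R Y q) q"
      by (simp add: connection_leibniz[OF \<phi> X Y] \<phi>_N[OF q])
    also have "\<dots> = (\<Sum>b\<in>Basis. dir_deriv A q (X q) (f Y b) *\<^sub>R F b q + (Y q c \<bullet> b) *\<^sub>R D X (F b) q)"
      unfolding expand[OF Y] by (simp add: connection_sum_right[OF X finite_Basis f[OF Y] F] sum_fun_apply f_N[OF q])
    finally show ?thesis .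
  qed
  have left: "D X Y q = (\<Sum>a\<in>Basis. (X q c \<bullet> a) *\<^sub>R D (F a) Y q)"
    if X: "X \<in> vector_fields A" and Y: "Y \<in> vector_fields A" and q: "q \<in> N" for X Y q
  proof -
    have "D X Y q = D (\<lambda>q. \<phi> q *\<^sub>R X q) Y q"
      by (simp add: connection_scale_left[OF \<phi> X Y] \<phi>_N[OF q])
    also have "\<dots> = (\<Sum>a\<in>Basis. (X q c \<bullet> a) *\<^sub>R D (F a) Y q)"
      unfolding expand[OF X] by (simp add: connection_sum_left[OF Y finite_Basis f[OF X] F] sum_fun_apply f_N[OF q])
    finally show ?thesis .
  qed
  have "D X Y q c = frechet_derivative (vf_rep c Y) (at (chart_map c q)) (X q c) + christoffel c F q (X q c) (Y q c)"
    if X: "X \<in> vector_fields A" and Y: "Y \<in> vector_fields A" and q: "q \<in> N" for X Y q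
  proof -
    let ?Y' = "frechet_derivative (vf_rep c Y) (at (chart_map c q))"
    have qc: "q \<in> chart_dom c" using q N(3) by blast
    have dY: "(vf_rep c Y has_derivative ?Y') (at (chart_map c q))"
      by (rule smooth_on_imp_has_derivative[OF smooth_vf_rep[OF Y c] chart_map_in_img[OF qc]])
    have "dir_deriv A q (X q) (f Y b) = ?Y' (X q c) \<bullet> b" for b
      unfolding dir_deriv_chart[OF f[OF Y] vector_field_in_tangent_space[OF X] c qc]
      by (subst local_D[OF q has_derivative_inner_left[OF dY]])
        (use N(3) in \<open>auto simp: f_N vf_rep_chart_map[OF c]\<close>)
    then have "D X Y q c = (\<Sum>b\<in>Basis. (?Y' (X q c) \<bullet> b) *\<^sub>R b) + (\<Sum>b\<in>Basis. (Y q c \<bullet> b) *\<^sub>R D X (F b) q c)"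
      by (simp add: right[OF X Y q] sum_fun_apply F_c[OF q] sum.distrib)
    also have "(\<Sum>b\<in>Basis. (Y q c \<bullet> b) *\<^sub>R D X (F b) q c) = christoffel c F q (X q c) (Y q c)"
      unfolding christoffel_def
      by (subst sum.swap) (simp add: left[OF X F q] sum_fun_apply scaleR_sum_right mult_ac)
    finally show ?thesis by (simp add: euclidean_representation)
  qed
  then have "adapted_frame c N F"
    unfolding adapted_frame_def using c N F F_N by blast
  with N(2) show thesis using that by blast
qed

text \<open>The fields \<open>F b\<close> have constant coordinates on \<open>N\<close>, so the derivative term vanishes.\<close>

lemma connection_adapted_frame:
  assumes "adapted_frame c N F" "X \<in> vector_fields A" "q \<in> N"
  shows "D X (F b) q c = christoffel c F q (X q c) b"
proof -
  have c: "c \<in> A" and N: "open N" "N \<subseteq> chart_dom c" and F: "F b \<in> vector_fields A"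
    and F_N: "\<And>q. q \<in> N \<Longrightarrow> F b q = coord_vec A c q b"
    using assms(1) unfolding adapted_frame_def by auto
  have "open (chart_map c ` N)"
    using open_chart_image[OF c N(1)] N(2) by (simp add: Int_absorb1)
  then have "(vf_rep c (F b) has_derivative (\<lambda>_. 0)) (at (chart_map c q))"
    by (rule has_derivative_transform_within_open[OF has_derivative_const[of b]])
      (use assms(3) N(2) in \<open>auto simp: vf_rep_chart_map[OF c] F_N coord_vec_same c subsetD\<close>)
  moreover have "F b q c = b" using assms(3) N(2) by (auto simp: F_N coord_vec_same c)
  ultimately show ?thesis
    using assms F unfolding adapted_frame_def by (auto simp: frechet_derivative_eqI)
qed

end


section \<open>Smooth curves\<close>

context smooth_manifold
begin

lemma smooth_curve_on_subinterval:
  assumes "smooth_curve_on A \<gamma> a b" "a \<le> a'" "b' \<le> b"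
  shows "smooth_curve_on A \<gamma> a' b'"
proof -
  obtain e \<eta> where e: "e > 0" and \<eta>: "\<And>t. t \<in> {a..b} \<Longrightarrow> \<eta> t = \<gamma> t" "continuous_on {a - e<..<b + e} \<eta>"
    "\<And>c. c \<in> A \<Longrightarrow> smooth_on {t\<in>{a - e<..<b + e}. \<eta> t \<in> chart_dom c} (chart_map c \<circ> \<eta>)"
    using assms(1) unfolding smooth_curve_on_def by blast
  have "smooth_on {t\<in>{a' - e<..<b' + e}. \<eta> t \<in> chart_dom c} (chart_map c \<circ> \<eta>)" if "c \<in> A" for c
    by (rule smooth_on_subset[OF \<eta>(3)[OF that]]) (use assms in auto)
  moreover have "continuous_on {a' - e<..<b' + e} \<eta>"
    by (rule continuous_on_subset[OF \<eta>(2)]) (use assms in auto)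
  moreover have "\<forall>t\<in>{a'..b'}. \<eta> t = \<gamma> t" using \<eta>(1) assms by auto
  ultimately show ?thesis using e unfolding smooth_curve_on_def by blast
qed

lemma smooth_curve_on_continuous: "smooth_curve_on A \<gamma> a b \<Longrightarrow> continuous_on {a..b} \<gamma>"
proof -
  assume "smooth_curve_on A \<gamma> a b"
  then obtain e \<eta> where e: "e > 0" and \<eta>: "\<And>t. t \<in> {a..b} \<Longrightarrow> \<eta> t = \<gamma> t" "continuous_on {a - e<..<b + e} \<eta>"
    unfolding smooth_curve_on_def by blast
  have "continuous_on {a..b} \<eta>" by (rule continuous_on_subset[OF \<eta>(2)]) (use e in auto)
  then show ?thesis by (rule continuous_on_eq) (rule \<eta>(1))
qed

lemma
  assumes sm: "smooth_curve_on A \<gamma> a b" and ab: "a < b" and c: "c \<in> A"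
  shows velocity_has_vector_derivative: "t \<in> {a..b} \<Longrightarrow> \<gamma> t \<in> chart_dom c \<Longrightarrow>
      (chart_map c \<circ> \<gamma> has_vector_derivative velocity A \<gamma> {a..b} t c) (at t within {a..b})"
    and continuous_on_velocity: "\<gamma> ` {a..b} \<subseteq> chart_dom c \<Longrightarrow> continuous_on {a..b} (\<lambda>t. velocity A \<gamma> {a..b} t c)"
proof -
  obtain e \<eta> where e: "e > 0" and \<eta>: "\<And>t. t \<in> {a..b} \<Longrightarrow> \<eta> t = \<gamma> t" "continuous_on {a - e<..<b + e} \<eta>"
    and sm': "\<forall>c\<in>A. smooth_on {t\<in>{a - e<..<b + e}. \<eta> t \<in> chart_dom c} (chart_map c \<circ> \<eta>)"
    using sm unfolding smooth_curve_on_def by blast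
  note sm = bspec[OF sm' c]
  let ?O = "{t\<in>{a - e<..<b + e}. \<eta> t \<in> chart_dom c}"
  define x' where "x' = (\<lambda>t. frechet_derivative (chart_map c \<circ> \<eta>) (at t) 1)"
  have deriv: "(chart_map c \<circ> \<gamma> has_vector_derivative x' t) (at t within {a..b})"
    if t: "t \<in> {a..b}" "\<gamma> t \<in> chart_dom c" for t
  proof -
    have "t \<in> ?O" using t e \<eta>(1)[OF t(1)] by auto
    then have d: "(chart_map c \<circ> \<eta> has_derivative frechet_derivative (chart_map c \<circ> \<eta>) (at t)) (at t)"
      using smooth_on_imp_has_derivative[OF sm] by blast
    have "frechet_derivative (chart_map c \<circ> \<eta>) (at t) = (\<lambda>h. h *\<^sub>R x' t)"
    proof
      show "frechet_derivative (chart_map c \<circ> \<eta>) (at t) h = h *\<^sub>R x' t" for h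
        using linear_scale[OF has_derivative_linear[OF d], of h 1] by (simp add: x'_def)
    qed
    with d have "(chart_map c \<circ> \<eta> has_vector_derivative x' t) (at t)"
      by (simp add: has_vector_derivative_def)
    then have "(chart_map c \<circ> \<eta> has_vector_derivative x' t) (at t within {a..b})"
      by (rule has_vector_derivative_at_within)
    then show ?thesis
      by (rule has_vector_derivative_transform[OF t(1), rotated]) (simp add: \<eta>(1))
  qed
  have vel: "velocity A \<gamma> {a..b} t c = x' t" if "t \<in> {a..b}" "\<gamma> t \<in> chart_dom c" for t
    using vector_derivative_within_closed_interval[OF ab that(1) deriv[OF that]] that c
    by (simp add: velocity_def)
  show "(chart_map c \<circ> \<gamma> has_vector_derivative velocity A \<gamma> {a..b} t c) (at t within {a..b})"
    if "t \<in> {a..b}" "\<gamma> t \<in> chart_dom c"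
    using deriv[OF that] vel[OF that] by simp
  show "continuous_on {a..b} (\<lambda>t. velocity A \<gamma> {a..b} t c)" if im: "\<gamma> ` {a..b} \<subseteq> chart_dom c"
  proof (rule continuous_on_eq)
    show "continuous_on {a..b} x'" unfolding x'_def
      by (rule continuous_on_subset[OF smooth_on_imp_continuous_on[OF smooth_on_derivative[OF sm]]])
        (use e \<eta>(1) im in auto)
    show "x' t = velocity A \<gamma> {a..b} t c" if "t \<in> {a..b}" for t
      using vel[OF that] im that by (simp add: image_subset_iff)
  qed
qed

text \<open>An end point of \<open>[a',b']\<close> may be interior to \<open>[a,b]\<close>, and there a one-sided derivative is
  compared with a two-sided one. They agree because the curve is differentiable in \<open>[a,b]\<close>.\<close>

lemma velocity_subinterval:
  assumes "smooth_curve_on A \<gamma> a b" "a \<le> a'" "b' \<le> b" "a' < b'" "t \<in> {a'..b'}"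
  shows "velocity A \<gamma> {a'..b'} t = velocity A \<gamma> {a..b} t"
proof
  fix c
  show "velocity A \<gamma> {a'..b'} t c = velocity A \<gamma> {a..b} t c"
  proof (cases "c \<in> A \<and> \<gamma> t \<in> chart_dom c")
    case True
    have "(chart_map c \<circ> \<gamma> has_vector_derivative velocity A \<gamma> {a..b} t c) (at t within {a..b})"
      by (rule velocity_has_vector_derivative) (use assms True in auto)
    then have "(chart_map c \<circ> \<gamma> has_vector_derivative velocity A \<gamma> {a..b} t c) (at t within {a'..b'})"
      by (rule has_vector_derivative_within_subset) (use assms in auto)
    from vector_derivative_within_closed_interval[OF assms(4,5) this] True
    show ?thesis by (simp add: velocity_def[of A \<gamma> "{a'..b'}"])
  next
    case False
    then show ?thesis unfolding velocity_def by (simp only: if_False)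
  qed
qed

lemma velocity_eq_coord_vec:
  assumes sm: "smooth_curve_on A \<gamma> a b" and ab: "a < b" and t: "t \<in> {a..b}" and c: "c \<in> A" "\<gamma> t \<in> chart_dom c"
  shows "velocity A \<gamma> {a..b} t = coord_vec A c (\<gamma> t) (velocity A \<gamma> {a..b} t c)"
proof
  fix d
  show "velocity A \<gamma> {a..b} t d = coord_vec A c (\<gamma> t) (velocity A \<gamma> {a..b} t c) d"
  proof (cases "d \<in> A \<and> \<gamma> t \<in> chart_dom d")
    case True
    then have d: "d \<in> A" "\<gamma> t \<in> chart_dom d" by auto
    let ?v = "velocity A \<gamma> {a..b} t c"
    have "(transition c d has_derivative dtrans c d (\<gamma> t)) (at ((chart_map c \<circ> \<gamma>) t) within (chart_map c \<circ> \<gamma>) ` {a..b})"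
      using transition_has_derivative[OF c(1) d(1) c(2) d(2)] by (simp add: has_derivative_at_withinI)
    from vector_derivative_diff_chain_within[OF velocity_has_vector_derivative[OF sm ab c(1) t c(2)] this]
    have chain: "(transition c d \<circ> (chart_map c \<circ> \<gamma>) has_vector_derivative dtrans c d (\<gamma> t) ?v) (at t within {a..b})" .
    obtain T where T: "open T" "T \<inter> {a..b} = \<gamma> -` chart_dom c \<inter> {a..b}"
      using smooth_curve_on_continuous[OF sm] open_chart_dom[OF c(1)] unfolding continuous_on_open_invariant by blast
    then obtain \<epsilon> where \<epsilon>: "\<epsilon> > 0" "ball t \<epsilon> \<subseteq> T"
      using t c(2) open_contains_ball by blast
    have "(chart_map d \<circ> \<gamma> has_vector_derivative dtrans c d (\<gamma> t) ?v) (at t within {a..b})"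
    proof (rule has_vector_derivative_transform_within[OF chain \<epsilon>(1) t])
      fix s assume "s \<in> {a..b}" "dist s t < \<epsilon>"
      then have "\<gamma> s \<in> chart_dom c" using T(2) \<epsilon>(2) by (auto simp: dist_commute subset_iff)
      then show "(transition c d \<circ> (chart_map c \<circ> \<gamma>)) s = (chart_map d \<circ> \<gamma>) s"
        using c(1) by (simp add: transition_chart_map)
    qed
    from vector_derivative_within_closed_interval[OF ab t this] d
    show ?thesis by (simp add: velocity_def coord_vec_apply)
  next
    case False
    then show ?thesis unfolding velocity_def coord_vec_def by (simp only: if_False)
  qed
qed

end


section \<open>Covariant derivatives along curves in coordinates\<close>

context affine_manifold
begin

lemma covariant_derivative_subinterval:
  assumes "has_covariant_derivative_along A D \<gamma> {a..b} V t w" "smooth_curve_on A \<gamma> a b"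
    "a \<le> a'" "b' \<le> b" "a' < b'" "t \<in> {a'..b'}"
  shows "has_covariant_derivative_along A D \<gamma> {a'..b'} V t w"
proof -
  have sub: "{a'..b'} \<subseteq> {a..b}" using assms by auto
  obtain n E \<alpha> \<alpha>' X U where *: "X \<in> vector_fields A" "X (\<gamma> t) = velocity A \<gamma> {a..b} t"
      "\<forall>i<n::nat. E i \<in> vector_fields A \<and> (\<alpha> i has_real_derivative \<alpha>' i) (at t within {a..b})"
      "open U" "t \<in> U" "\<forall>s\<in>{a..b} \<inter> U. V s = (\<Sum>i<n. \<alpha> i s *\<^sub>R E i (\<gamma> s))"
      "w = (\<Sum>i<n. \<alpha>' i *\<^sub>R E i (\<gamma> t) + \<alpha> i t *\<^sub>R D X (E i) (\<gamma> t))"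
    using assms(1) unfolding has_covariant_derivative_along_def by blast
  have "\<forall>i<n. E i \<in> vector_fields A \<and> (\<alpha> i has_real_derivative \<alpha>' i) (at t within {a'..b'})"
    using *(3) sub by (blast intro: DERIV_subset)
  moreover have "X (\<gamma> t) = velocity A \<gamma> {a'..b'} t"
    using *(2) velocity_subinterval[OF assms(2-6)] by simp
  moreover have "\<forall>s\<in>{a'..b'} \<inter> U. V s = (\<Sum>i<n. \<alpha> i s *\<^sub>R E i (\<gamma> s))" using *(6) sub by blast
  ultimately show ?thesis unfolding has_covariant_derivative_along_def using *(1,4,5,7) by blast
qed

lemma covariant_derivative_in_tangent_space:
  assumes "has_covariant_derivative_along A D \<gamma> S V t w" "t \<in> S"
  shows "V t \<in> tangent_space A (\<gamma> t)"
proof -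
  obtain n E and \<alpha> :: "nat \<Rightarrow> real \<Rightarrow> real" and U where *: "\<forall>i<n::nat. E i \<in> vector_fields A"
      "t \<in> U" "\<forall>s\<in>S \<inter> U. V s = (\<Sum>i<n. \<alpha> i s *\<^sub>R E i (\<gamma> s))"
    using assms(1) unfolding has_covariant_derivative_along_def by blast
  have "(\<Sum>i<n. \<alpha> i t *\<^sub>R E i (\<gamma> t)) \<in> tangent_space A (\<gamma> t)"
    using *(1) by (intro subspace_sum[OF subspace_tangent_space] subspace_scale[OF subspace_tangent_space])
      (auto intro: vector_field_in_tangent_space)
  with * assms(2) show ?thesis by simp
qed

text \<open>In coordinates the covariant derivative of \<open>V\<close> is \<open>V' + \<Gamma>(x', V)\<close>: each summand \<open>a\<^sub>i E\<^sub>i\<close> contributes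
  \<open>a\<^sub>i' E\<^sub>i + a\<^sub>i DE\<^sub>i(x')\<close> to the derivative of the coordinates and, by the coordinate formula for the
  connection, \<open>a\<^sub>i \<Gamma>(x', E\<^sub>i)\<close> to the term with \<open>\<Gamma>\<close>. In particular the result does not depend on how
  \<open>V\<close> is written as a sum.\<close>

lemma covariant_derivative_coordinates:
  assumes fr: "adapted_frame c N F" and sm: "smooth_curve_on A \<gamma> a b" and ab: "a < b"
    and t: "t \<in> {a..b}" "\<gamma> t \<in> N" and cov: "has_covariant_derivative_along A D \<gamma> {a..b} V t w"
  shows "((\<lambda>s. V s c) has_vector_derivative
    w c - christoffel c F (\<gamma> t) (velocity A \<gamma> {a..b} t c) (V t c)) (at t within {a..b})"
proof -
  have c: "c \<in> A" "\<gamma> t \<in> chart_dom c" using fr t(2) unfolding adapted_frame_def by auto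
  obtain n E \<alpha> \<alpha>' X U where X: "X \<in> vector_fields A" "X (\<gamma> t) = velocity A \<gamma> {a..b} t"
    and E: "\<And>i. i < n \<Longrightarrow> E i \<in> vector_fields A"
    and \<alpha>: "\<And>i. i < n \<Longrightarrow> (\<alpha> i has_real_derivative \<alpha>' i) (at t within {a..b})"
    and U: "open U" "t \<in> U" "\<And>s. s \<in> {a..b} \<inter> U \<Longrightarrow> V s = (\<Sum>i<n::nat. \<alpha> i s *\<^sub>R E i (\<gamma> s))"
    and w: "w = (\<Sum>i<n. \<alpha>' i *\<^sub>R E i (\<gamma> t) + \<alpha> i t *\<^sub>R D X (E i) (\<gamma> t))"
    using cov unfolding has_covariant_derivative_along_def by blast
  let ?x = "chart_map c \<circ> \<gamma>" and ?x' = "velocity A \<gamma> {a..b} t c" and ?G = "christoffel c F (\<gamma> t)"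
  let ?E' = "\<lambda>i. frechet_derivative (vf_rep c (E i)) (at (?x t))"
  have dE: "((vf_rep c (E i) \<circ> ?x) has_vector_derivative ?E' i ?x') (at t within {a..b})" if "i < n" for i
  proof (rule vector_derivative_diff_chain_within[OF velocity_has_vector_derivative[OF sm ab c(1) t(1) c(2)]])
    show "(vf_rep c (E i) has_derivative ?E' i) (at (?x t) within ?x ` {a..b})"
      using smooth_on_imp_has_derivative[OF smooth_vf_rep[OF E[OF that] c(1)] chart_map_in_img[OF c(2)]]
      by (simp add: has_derivative_at_withinI)
  qed
  have df: "((\<lambda>s. \<Sum>i<n. \<alpha> i s *\<^sub>R (vf_rep c (E i) \<circ> ?x) s) has_vector_derivative
      (\<Sum>i<n. \<alpha> i t *\<^sub>R ?E' i ?x' + \<alpha>' i *\<^sub>R (vf_rep c (E i) \<circ> ?x) t)) (at t within {a..b})"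
  proof (rule has_vector_derivative_sum)
    fix i assume "i \<in> {..<n}"
    then have "i < n" by simp
    then show "((\<lambda>s. \<alpha> i s *\<^sub>R (vf_rep c (E i) \<circ> ?x) s) has_vector_derivative
        \<alpha> i t *\<^sub>R ?E' i ?x' + \<alpha>' i *\<^sub>R (vf_rep c (E i) \<circ> ?x) t) (at t within {a..b})"
      by (intro has_vector_derivative_scaleR \<alpha> dE)
  qed
  obtain T where T: "open T" "T \<inter> {a..b} = \<gamma> -` chart_dom c \<inter> {a..b}"
    using smooth_curve_on_continuous[OF sm] open_chart_dom[OF c(1)] unfolding continuous_on_open_invariant by blast
  have "open (U \<inter> T)" "t \<in> U \<inter> T" using U T t c(2) by auto
  then obtain \<epsilon> where \<epsilon>: "\<epsilon> > 0" "ball t \<epsilon> \<subseteq> U \<inter> T" using open_contains_ball by blast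
  have "((\<lambda>s. V s c) has_vector_derivative
      (\<Sum>i<n. \<alpha> i t *\<^sub>R ?E' i ?x' + \<alpha>' i *\<^sub>R (vf_rep c (E i) \<circ> ?x) t)) (at t within {a..b})"
  proof (rule has_vector_derivative_transform_within[OF df \<epsilon>(1) t(1)])
    fix s assume s: "s \<in> {a..b}" "dist s t < \<epsilon>"
    then have "s \<in> U" "s \<in> T" using \<epsilon>(2) by (auto simp: dist_commute subset_iff)
    then have "\<gamma> s \<in> chart_dom c" "V s = (\<Sum>i<n. \<alpha> i s *\<^sub>R E i (\<gamma> s))" using s(1) T(2) U(3)[of s] by auto
    then show "(\<Sum>i<n. \<alpha> i s *\<^sub>R (vf_rep c (E i) \<circ> ?x) s) = V s c"
      by (simp add: sum_fun_apply vf_rep_chart_map[OF c(1)])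
  qed
  also have "(\<Sum>i<n. \<alpha> i t *\<^sub>R ?E' i ?x' + \<alpha>' i *\<^sub>R (vf_rep c (E i) \<circ> ?x) t) =
      (\<Sum>i<n. \<alpha> i t *\<^sub>R (D X (E i) (\<gamma> t) c - ?G ?x' (E i (\<gamma> t) c)) + \<alpha>' i *\<^sub>R E i (\<gamma> t) c)"
  proof (rule sum.cong[OF refl])
    fix i assume "i \<in> {..<n}"
    then have "D X (E i) (\<gamma> t) c = ?E' i ?x' + ?G ?x' (E i (\<gamma> t) c)"
      using fr X E t(2) unfolding adapted_frame_def by simp
    then show "\<alpha> i t *\<^sub>R ?E' i ?x' + \<alpha>' i *\<^sub>R (vf_rep c (E i) \<circ> ?x) t =
        \<alpha> i t *\<^sub>R (D X (E i) (\<gamma> t) c - ?G ?x' (E i (\<gamma> t) c)) + \<alpha>' i *\<^sub>R E i (\<gamma> t) c"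
      by (simp add: vf_rep_chart_map[OF c])
  qed
  also have "\<dots> = w c - ?G ?x' (V t c)"
    using U(2,3) t(1)
    by (simp add: w sum_fun_apply linear_sum[OF linear_christoffel] linear_scale[OF linear_christoffel]
        scaleR_diff_right sum.distrib sum_subtractf algebra_simps)
  finally show ?thesis .
qed

text \<open>The converse direction: a solution of the equation for the coordinates gives a parallel field,
  written with the frame fields as the \<open>E\<^sub>i\<close> and the components of the solution as the coefficients.\<close>

lemma frame_field_covariant_derivative:
  assumes fr: "adapted_frame c N F" and sm: "smooth_curve_on A \<gamma> a b" and ab: "a < b"
    and t: "t \<in> {a..b}" "\<gamma> t \<in> N"
    and u: "(u has_vector_derivative - christoffel c F (\<gamma> t) (velocity A \<gamma> {a..b} t c) (u t)) (at t within {a..b})"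
  shows "has_covariant_derivative_along A D \<gamma> {a..b} (\<lambda>s. \<Sum>k\<in>Basis. (u s \<bullet> k) *\<^sub>R F k (\<gamma> s)) t 0"
proof -
  have c: "c \<in> A" "\<gamma> t \<in> chart_dom c" and F: "\<And>b. F b \<in> vector_fields A"
    and F_N: "\<And>b. F b (\<gamma> t) = coord_vec A c (\<gamma> t) b"
    using fr t(2) unfolding adapted_frame_def by auto
  let ?x' = "velocity A \<gamma> {a..b} t c" and ?G = "christoffel c F (\<gamma> t)"
  let ?u' = "- ?G ?x' (u t)"
  obtain h :: "nat \<Rightarrow> 'e" where h: "bij_betw h {0..<DIM('e)} Basis"
    using ex_bij_betw_nat_finite[OF finite_Basis] by blast
  define X where "X = (\<Sum>a\<in>Basis. (?x' \<bullet> a) *\<^sub>R F a)"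
  have X: "X \<in> vector_fields A"
    unfolding X_def by (intro vector_field_sum vector_field_scale_const F)
  have X_t: "X (\<gamma> t) = velocity A \<gamma> {a..b} t"
    by (subst velocity_eq_coord_vec[OF sm ab t(1) c]) (simp only: X_def sum_fun_apply scaleR_fun_apply F_N linear_sum_Basis[OF linear_coord_vec[OF c], symmetric])
  have G: "D X (F b) (\<gamma> t) c = ?G ?x' b" for b
    using connection_adapted_frame[OF fr X t(2)] X_t by simp
  have sum_h: "(\<Sum>i<DIM('e). g (h i)) = (\<Sum>b\<in>Basis. g b)" for g :: "'e \<Rightarrow> ('a, 'e) tvec"
    using sum.reindex_bij_betw[OF h, of g] by (simp add: atLeast0LessThan)
  have d: "((\<lambda>s. u s \<bullet> k) has_real_derivative ?u' \<bullet> k) (at t within {a..b})" for k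
    unfolding has_field_derivative_def
    by (rule has_derivative_eq_rhs[OF has_derivative_inner_left[OF u[unfolded has_vector_derivative_def]]])
      (simp add: fun_eq_iff)
  have 0: "(\<Sum>b\<in>Basis. (?u' \<bullet> b) *\<^sub>R F b (\<gamma> t) + (u t \<bullet> b) *\<^sub>R D X (F b) (\<gamma> t)) = 0" (is "?w = 0")
  proof (rule tangent_vec_eqI[OF _ _ c])
    show "?w \<in> tangent_space A (\<gamma> t)"
      by (intro subspace_sum subspace_add subspace_scale subspace_tangent_space vector_field_in_tangent_space F connection_in X)
    show "0 \<in> tangent_space A (\<gamma> t)" by (intro subspace_0 subspace_tangent_space)
    have "?w c = (\<Sum>b\<in>Basis. (?u' \<bullet> b) *\<^sub>R b) + (\<Sum>b\<in>Basis. (u t \<bullet> b) *\<^sub>R ?G ?x' b)"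
      by (simp add: sum_fun_apply F_N coord_vec_same[OF c] G sum.distrib sum_subtractf sum_negf)
    also have "\<dots> = 0"
      by (simp only: linear_sum_Basis[OF linear_christoffel, symmetric] euclidean_representation) simp
    finally show "?w c = 0 c" by simp
  qed
  show ?thesis
    unfolding has_covariant_derivative_along_def
  proof (intro exI conjI)
    show "\<forall>i<DIM('e). F (h i) \<in> vector_fields A \<and>
        ((\<lambda>s. u s \<bullet> h i) has_real_derivative ?u' \<bullet> h i) (at t within {a..b})" using F d by blast
    show "0 = (\<Sum>i<DIM('e). (?u' \<bullet> h i) *\<^sub>R F (h i) (\<gamma> t) + (u t \<bullet> h i) *\<^sub>R D X (F (h i)) (\<gamma> t))"
      using sum_h[of "\<lambda>b. (?u' \<bullet> b) *\<^sub>R F b (\<gamma> t) + (u t \<bullet> b) *\<^sub>R D X (F b) (\<gamma> t)"] unfolding 0 by simp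
    show "\<forall>s\<in>{a..b} \<inter> UNIV. (\<Sum>b\<in>Basis. (u s \<bullet> b) *\<^sub>R F b (\<gamma> s)) = (\<Sum>i<DIM('e). (u s \<bullet> h i) *\<^sub>R F (h i) (\<gamma> s))"
      using sum_h[of "\<lambda>b. (u s \<bullet> b) *\<^sub>R F b (\<gamma> s)" for s] by simp
  qed (use X X_t in simp_all)
qed

end


section \<open>Existence and uniqueness of parallel transport\<close>

context affine_manifold
begin

lemma continuous_on_christoffel:
  assumes fr: "adapted_frame c N F" and sm: "smooth_curve_on A \<gamma> a b" and ab: "a < b"
    and im: "\<gamma> ` {a..b} \<subseteq> N"
  shows "continuous_on {a..b} (\<lambda>t. christoffel c F (\<gamma> t) (velocity A \<gamma> {a..b} t c) u)"
proof -
  have c: "c \<in> A" and N: "N \<subseteq> chart_dom c" and F: "\<And>b. F b \<in> vector_fields A"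
    using fr unfolding adapted_frame_def by auto
  have im_c: "\<gamma> ` {a..b} \<subseteq> chart_dom c" using im N by blast
  have x: "continuous_on {a..b} (\<lambda>t. chart_map c (\<gamma> t))"
    by (rule continuous_on_compose2[OF continuous_on_chart_map[OF c] smooth_curve_on_continuous[OF sm] im_c])
  have "continuous_on {a..b} (\<lambda>t. D (F i) (F j) (\<gamma> t) c)" for i j
  proof (rule continuous_on_eq)
    show "continuous_on {a..b} (\<lambda>t. vf_rep c (D (F i) (F j)) (chart_map c (\<gamma> t)))"
      by (rule continuous_on_compose2[OF smooth_on_imp_continuous_on[OF
              smooth_vf_rep[OF connection_in[OF F F] c]] x])
        (use im_c in \<open>auto intro: chart_map_in_img\<close>)
    show "vf_rep c (D (F i) (F j)) (chart_map c (\<gamma> t)) = D (F i) (F j) (\<gamma> t) c" if "t \<in> {a..b}" for t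
      using im_c that by (simp add: vf_rep_chart_map[OF c] image_subset_iff)
  qed
  then show ?thesis unfolding christoffel_def
    by (intro continuous_intros continuous_on_velocity[OF sm ab c im_c])
qed

lemma parallel_field_exists_local:
  assumes fr: "adapted_frame c N F" and sm: "smooth_curve_on A \<gamma> a b" and ab: "a < b"
    and im: "\<gamma> ` {a..b} \<subseteq> N" and v: "v \<in> tangent_space A (\<gamma> a)"
  obtains V where "V a = v" "\<And>t. t \<in> {a..b} \<Longrightarrow> has_covariant_derivative_along A D \<gamma> {a..b} V t 0"
proof -
  have a: "\<gamma> a \<in> N" using im ab by auto
  have c: "c \<in> A" "\<gamma> a \<in> chart_dom c" and F_N: "\<And>b. F b (\<gamma> a) = coord_vec A c (\<gamma> a) b"
    using fr a unfolding adapted_frame_def by auto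
  let ?M = "\<lambda>t u. - christoffel c F (\<gamma> t) (velocity A \<gamma> {a..b} t c) u"
  have "a \<le> b" using ab by simp
  moreover have "linear (?M t)" for t using linear_compose_neg[OF linear_christoffel] .
  moreover have "continuous_on {a..b} (\<lambda>t. ?M t i)" for i
    by (intro continuous_on_minus continuous_on_christoffel[OF fr sm ab im])
  ultimately obtain u where u: "u a = v c"
    "\<And>t. t \<in> {a..b} \<Longrightarrow> (u has_vector_derivative ?M t (u t)) (at t within {a..b})"
    by (rule linear_ode_solution[where M = ?M]) (rule that)
  let ?V = "\<lambda>s. \<Sum>k\<in>Basis. (u s \<bullet> k) *\<^sub>R F k (\<gamma> s)"
  show thesis
  proof
    show "?V a = v"
      using linear_sum_Basis[OF linear_coord_vec[OF c], of "v c"] coord_vec_eq_tangent_vec[OF v c]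
      by (simp only: F_N u(1))
    show "has_covariant_derivative_along A D \<gamma> {a..b} ?V t 0" if "t \<in> {a..b}" for t
      by (rule frame_field_covariant_derivative[OF fr sm ab that _ u(2)[OF that]]) (use im that in auto)
  qed
qed

text \<open>The difference of the coordinates of \<open>V\<close> and \<open>W\<close> solves the linear equation with initial value \<open>0\<close>.\<close>

lemma parallel_field_unique_local:
  assumes fr: "adapted_frame c N F" and sm: "smooth_curve_on A \<gamma> a b" and ab: "a < b"
    and im: "\<gamma> ` {a..b} \<subseteq> N"
    and V: "\<And>t. t \<in> {a..b} \<Longrightarrow> has_covariant_derivative_along A D \<gamma> {a..b} V t 0"
    and W: "\<And>t. t \<in> {a..b} \<Longrightarrow> has_covariant_derivative_along A D \<gamma> {a..b} W t 0"
    and "V a = W a"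
  shows "V b = W b"
proof -
  have b: "b \<in> {a..b}" using ab by simp
  then have "\<gamma> b \<in> N" using im by blast
  then have c: "c \<in> A" "\<gamma> b \<in> chart_dom c" using fr unfolding adapted_frame_def by auto
  let ?M = "\<lambda>t u. - christoffel c F (\<gamma> t) (velocity A \<gamma> {a..b} t c) u"
  have lin: "linear (?M t)" for t using linear_compose_neg[OF linear_christoffel] .
  have "V b c - W b c = 0"
  proof (rule linear_ode_zero[where M = ?M and u = "\<lambda>t. V t c - W t c"])
    show "continuous_on {a..b} (\<lambda>t. ?M t i)" for i
      by (intro continuous_on_minus continuous_on_christoffel[OF fr sm ab im])
    fix t assume t: "t \<in> {a..b}"
    then have "\<gamma> t \<in> N" using im by blast
    from has_vector_derivative_diff[OF covariant_derivative_coordinates[OF fr sm ab t this V[OF t]]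
        covariant_derivative_coordinates[OF fr sm ab t this W[OF t]]]
    show "((\<lambda>t. V t c - W t c) has_vector_derivative ?M t (V t c - W t c)) (at t within {a..b})"
      by (simp add: linear_diff[OF linear_christoffel])
  qed (use ab lin assms(7) in auto)
  then show ?thesis
    using tangent_vec_eqI[OF covariant_derivative_in_tangent_space[OF V[OF b] b]
        covariant_derivative_in_tangent_space[OF W[OF b] b] c] by simp
qed

text \<open>\<open>V\<close> is parallel along \<open>\<gamma>\<close> on \<open>[r,s]\<close> with respect to some subdivision. The inductive form makes
  concatenation easy; the subdivision is recovered afterwards.\<close>

inductive parallel_chain :: "(real \<Rightarrow> 'a) \<Rightarrow> (real \<Rightarrow> ('a, 'e) tvec) \<Rightarrow> real \<Rightarrow> real \<Rightarrow> bool"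
  for \<gamma> V where
  parallel_chain_refl: "parallel_chain \<gamma> V r r"
| parallel_chain_step: "parallel_chain \<gamma> V r c \<Longrightarrow> c < s \<Longrightarrow> smooth_curve_on A \<gamma> c s \<Longrightarrow>
    (\<And>t. t \<in> {c..s} \<Longrightarrow> has_covariant_derivative_along A D \<gamma> {c..s} V t 0) \<Longrightarrow> parallel_chain \<gamma> V r s"

lemma parallel_chain_le: "parallel_chain \<gamma> V r s \<Longrightarrow> r \<le> s"
  by (induction rule: parallel_chain.induct) auto

lemma parallel_chain_trans: "parallel_chain \<gamma> V c s \<Longrightarrow> parallel_chain \<gamma> V r c \<Longrightarrow> parallel_chain \<gamma> V r s"
  by (induction rule: parallel_chain.induct) (auto intro: parallel_chain_step)

lemma covariant_derivative_cong:
  assumes "has_covariant_derivative_along A D \<gamma> S V t w" "\<And>s. s \<in> S \<Longrightarrow> V s = W s"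
  shows "has_covariant_derivative_along A D \<gamma> S W t w"
proof -
  have "(\<forall>s\<in>S \<inter> U. V s = h s) = (\<forall>s\<in>S \<inter> U. W s = h s)" for U h using assms(2) by auto
  then show ?thesis using assms(1) unfolding has_covariant_derivative_along_def by simp
qed

lemma parallel_chain_cong:
  "parallel_chain \<gamma> V r s \<Longrightarrow> (\<And>t. t \<in> {r..s} \<Longrightarrow> V t = W t) \<Longrightarrow> parallel_chain \<gamma> W r s"
proof (induction rule: parallel_chain.induct)
  case (parallel_chain_refl r)
  show ?case by (rule parallel_chain.parallel_chain_refl)
next
  case (parallel_chain_step r c s)
  note rc = parallel_chain_le[OF parallel_chain_step(1)]
  show ?case
  proof (rule parallel_chain.parallel_chain_step)
    show "parallel_chain \<gamma> W r c" by (rule parallel_chain_step.IH) (use parallel_chain_step in auto)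
    show "has_covariant_derivative_along A D \<gamma> {c..s} W t 0" if "t \<in> {c..s}" for t
      by (rule covariant_derivative_cong[OF parallel_chain_step(4)[OF that]]) (use parallel_chain_step.prems rc in auto)
  qed (use parallel_chain_step in auto)
qed

lemma parallel_chain_imp_subdivision:
  "parallel_chain \<gamma> V r s \<Longrightarrow> \<exists>m \<tau>. \<tau> 0 = r \<and> \<tau> m = s \<and>
    (\<forall>i<m. \<tau> i < \<tau> (Suc i) \<and> smooth_curve_on A \<gamma> (\<tau> i) (\<tau> (Suc i)) \<and>
      (\<forall>t\<in>{\<tau> i..\<tau> (Suc i)}. has_covariant_derivative_along A D \<gamma> {\<tau> i..\<tau> (Suc i)} V t 0))"
proof (induction rule: parallel_chain.induct)
  case (parallel_chain_refl r)
  show ?case by (rule exI[of _ 0], rule exI[of _ "\<lambda>_. r"]) simp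
next
  case (parallel_chain_step r c s)
  then obtain m \<tau> where \<tau>: "\<tau> 0 = r" "\<tau> m = c"
    "\<forall>i<m. \<tau> i < \<tau> (Suc i) \<and> smooth_curve_on A \<gamma> (\<tau> i) (\<tau> (Suc i)) \<and>
      (\<forall>t\<in>{\<tau> i..\<tau> (Suc i)}. has_covariant_derivative_along A D \<gamma> {\<tau> i..\<tau> (Suc i)} V t 0)" by blast
  let ?\<tau> = "\<tau>(Suc m := s)"
  have "\<forall>i<Suc m. ?\<tau> i < ?\<tau> (Suc i) \<and> smooth_curve_on A \<gamma> (?\<tau> i) (?\<tau> (Suc i)) \<and>
      (\<forall>t\<in>{?\<tau> i..?\<tau> (Suc i)}. has_covariant_derivative_along A D \<gamma> {?\<tau> i..?\<tau> (Suc i)} V t 0)"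
  proof (intro allI impI)
    fix i assume "i < Suc m"
    then consider "i < m" | "i = m" by linarith
    then show "?\<tau> i < ?\<tau> (Suc i) \<and> smooth_curve_on A \<gamma> (?\<tau> i) (?\<tau> (Suc i)) \<and>
      (\<forall>t\<in>{?\<tau> i..?\<tau> (Suc i)}. has_covariant_derivative_along A D \<gamma> {?\<tau> i..?\<tau> (Suc i)} V t 0)"
      using \<tau> parallel_chain_step(2-4) by cases simp_all
  qed
  moreover have "?\<tau> 0 = r" "?\<tau> (Suc m) = s" using \<tau>(1) by auto
  ultimately show ?case by blast
qed

lemma parallel_chain_imp_parallel_along: "parallel_chain \<gamma> V 0 1 \<Longrightarrow> parallel_along A D \<gamma> V"
  using parallel_chain_imp_subdivision[of \<gamma> V 0 1] unfolding parallel_along_def smooth_subdivision_def by blast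

end

lemma interval_in_subdivision_piece:
  fixes \<tau> :: "nat \<Rightarrow> real"
  assumes "\<tau> 0 \<le> r" "s \<le> \<tau> m" "r < s" "\<And>i. i \<le> m \<Longrightarrow> \<tau> i \<le> r \<or> s \<le> \<tau> i"
  shows "\<exists>i<m. \<tau> i \<le> r \<and> s \<le> \<tau> (Suc i)"
  using assms(2,4)
proof (induction m)
  case 0
  then show ?case using assms(1,3) by simp
next
  case (Suc m)
  then consider "\<tau> m \<le> r" | "s \<le> \<tau> m" by (meson le_SucI order_refl)
  then show ?case
  proof cases
    case 1
    then show ?thesis using Suc.prems(1) by blast
  next
    case 2
    then show ?thesis using Suc by (meson le_SucI less_SucI)
  qed
qed

context smooth_manifold
begin

text \<open>An interval with \<open>x\<close> in its interior need not lie in one piece of the subdivision, since \<open>x\<close> may be a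
  break point. Short intervals with \<open>x\<close> as an end point do.\<close>

lemma one_sided_neighbourhood:
  assumes \<tau>: "smooth_subdivision A \<gamma> m \<tau>" and \<gamma>: "continuous_on {0..1} \<gamma>"
    and x: "x \<in> {0..1}" and N: "open N" "\<gamma> x \<in> N"
  obtains \<delta> where "\<delta> > 0"
    "\<And>r s. 0 \<le> r \<Longrightarrow> r < s \<Longrightarrow> s \<le> 1 \<Longrightarrow> s - r < \<delta> \<Longrightarrow> x = r \<or> x = s \<Longrightarrow>
      \<gamma> ` {r..s} \<subseteq> N \<and> (\<exists>i<m. \<tau> i \<le> r \<and> s \<le> \<tau> (Suc i))"
proof -
  obtain \<delta>1 where \<delta>1: "\<delta>1 > 0" "\<And>y. y \<in> \<tau> ` {..m} \<Longrightarrow> y \<noteq> x \<Longrightarrow> \<delta>1 \<le> dist x y"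
    using finite_set_avoid[of "\<tau> ` {..m}" x] by auto
  obtain T where T: "open T" "T \<inter> {0..1} = \<gamma> -` N \<inter> {0..1}"
    using \<gamma> N(1) unfolding continuous_on_open_invariant by blast
  then obtain \<delta>2 where \<delta>2: "\<delta>2 > 0" "ball x \<delta>2 \<subseteq> T" using x N(2) open_contains_ball by blast
  show thesis
  proof
    show "min \<delta>1 \<delta>2 > 0" using \<delta>1 \<delta>2 by simp
    fix r s assume rs: "0 \<le> r" "r < s" "s \<le> 1" "s - r < min \<delta>1 \<delta>2" "x = r \<or> x = s"
    have "\<gamma> t \<in> N" if "t \<in> {r..s}" for t
    proof -
      have "t \<in> ball x \<delta>2" using that rs by (auto simp: dist_real_def)
      then have "t \<in> T \<inter> {0..1}" using \<delta>2(2) that rs by auto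
      then show ?thesis using T(2) by auto
    qed
    moreover have "\<exists>i<m. \<tau> i \<le> r \<and> s \<le> \<tau> (Suc i)"
    proof (rule interval_in_subdivision_piece)
      show "\<tau> 0 \<le> r" "s \<le> \<tau> m" using \<tau> rs unfolding smooth_subdivision_def by auto
      show "\<tau> i \<le> r \<or> s \<le> \<tau> i" if "i \<le> m" for i
        using \<delta>1(2)[of "\<tau> i"] that rs by (cases "\<tau> i = x") (auto simp: dist_real_def abs_if split: if_splits)
    qed (rule rs(2))
    ultimately show "\<gamma> ` {r..s} \<subseteq> N \<and> (\<exists>i<m. \<tau> i \<le> r \<and> s \<le> \<tau> (Suc i))" by blast
  qed
qed

end

context affine_manifold
begin

text \<open>Local fields are joined by Bolzano's bisection principle: the property of having a parallel field
  for every initial value passes to unions of adjacent intervals and holds on all short intervals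
  around any point. The subdivision produced is in general finer than the given one.\<close>

lemma parallel_field_exists:
  assumes \<tau>: "smooth_subdivision A \<gamma> m \<tau>" and \<gamma>: "continuous_on {0..1} \<gamma>" and v: "v \<in> tangent_space A (\<gamma> 0)"
  obtains V where "parallel_along A D \<gamma> V" "V 0 = v"
proof -
  let ?P = "\<lambda>r s. 0 \<le> r \<longrightarrow> s \<le> 1 \<longrightarrow> r \<le> s \<longrightarrow>
    (\<forall>v\<in>tangent_space A (\<gamma> r). \<exists>V. V r = v \<and> V s \<in> tangent_space A (\<gamma> s) \<and> parallel_chain \<gamma> V r s)"
  have trans: "?P r s" if h: "?P r c" "?P c s" "r \<le> c" "c \<le> s" for r c s
  proof (intro impI ballI)
    fix v assume rs: "0 \<le> r" "s \<le> 1" and v: "v \<in> tangent_space A (\<gamma> r)"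
    have c: "c \<le> 1" "0 \<le> c" using rs h(3,4) by auto
    obtain V where V: "V r = v" "V c \<in> tangent_space A (\<gamma> c)" "parallel_chain \<gamma> V r c"
      using h(1)[rule_format, OF rs(1) c(1) h(3) v] by blast
    obtain W where W: "W c = V c" "W s \<in> tangent_space A (\<gamma> s)" "parallel_chain \<gamma> W c s"
      using h(2)[rule_format, OF c(2) rs(2) h(4) V(2)] by blast
    let ?U = "\<lambda>t. if t \<le> c then V t else W t"
    have "parallel_chain \<gamma> ?U r c" by (rule parallel_chain_cong[OF V(3)]) simp
    moreover have "parallel_chain \<gamma> ?U c s" by (rule parallel_chain_cong[OF W(3)]) (use W(1) in auto)
    ultimately have "parallel_chain \<gamma> ?U r s" by (rule parallel_chain_trans[rotated])
    moreover have "?U r = v" using V(1) h(3) by simp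
    moreover have "?U s \<in> tangent_space A (\<gamma> s)" using V(2) W(2) h(4) by (cases "s = c") simp_all
    ultimately show "\<exists>V. V r = v \<and> V s \<in> tangent_space A (\<gamma> s) \<and> parallel_chain \<gamma> V r s"
      by (intro exI[of _ ?U] conjI)
  qed
  have "?P 0 1"
  proof (rule Bolzano[where P = ?P, OF zero_le_one])
    show "?P r s" if "?P r c" "?P c s" "r \<le> c" "c \<le> s" for r c s
      by (rule trans[OF that])
    fix x :: real assume x: "0 \<le> x" "x \<le> 1"
    obtain c where c: "c \<in> A" "\<gamma> x \<in> chart_dom c" by (rule chart_exists)
    obtain N F where N: "\<gamma> x \<in> N" and fr: "adapted_frame c N F" by (rule adapted_frame_exists[OF c])
    have oN: "open N" using fr unfolding adapted_frame_def by blast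
    have x01: "x \<in> {0..1}" using x by simp
    obtain \<delta> where \<delta>: "\<delta> > 0"
      "\<And>r s. 0 \<le> r \<Longrightarrow> r < s \<Longrightarrow> s \<le> 1 \<Longrightarrow> s - r < \<delta> \<Longrightarrow> x = r \<or> x = s \<Longrightarrow>
        \<gamma> ` {r..s} \<subseteq> N \<and> (\<exists>i<m. \<tau> i \<le> r \<and> s \<le> \<tau> (Suc i))"
      by (rule one_sided_neighbourhood[OF \<tau> \<gamma> x01 oN N]) (rule that)
    have side: "?P r s" if rs: "s - r < \<delta>" "x = r \<or> x = s" for r s
    proof (intro impI ballI)
      fix v assume *: "0 \<le> r" "s \<le> 1" "r \<le> s" and v: "v \<in> tangent_space A (\<gamma> r)"
      show "\<exists>V. V r = v \<and> V s \<in> tangent_space A (\<gamma> s) \<and> parallel_chain \<gamma> V r s"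
      proof (cases "r = s")
        case True
        then show ?thesis using v parallel_chain_refl by (intro exI[of _ "\<lambda>_. v"]) auto
      next
        case False
        with * have lt: "r < s" by simp
        obtain i where i: "i < m" "\<tau> i \<le> r" "s \<le> \<tau> (Suc i)" and im: "\<gamma> ` {r..s} \<subseteq> N"
          using \<delta>(2)[OF *(1) lt *(2) rs] by blast
        have sm: "smooth_curve_on A \<gamma> r s"
          by (rule smooth_curve_on_subinterval[OF _ i(2,3)]) (use \<tau> i(1) in \<open>auto simp: smooth_subdivision_def\<close>)
        obtain V where V: "V r = v" "\<And>t. t \<in> {r..s} \<Longrightarrow> has_covariant_derivative_along A D \<gamma> {r..s} V t 0"
          by (rule parallel_field_exists_local[OF fr sm lt im v]) (rule that)
        have "s \<in> {r..s}" using lt by simp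
        then have "V s \<in> tangent_space A (\<gamma> s)" using covariant_derivative_in_tangent_space V(2) by blast
        moreover have "parallel_chain \<gamma> V r s"
          by (rule parallel_chain_step[OF parallel_chain_refl lt sm V(2)])
        ultimately show ?thesis using V(1) by blast
      qed
    qed
    show "\<exists>d>0. \<forall>r s. r \<le> x \<and> x \<le> s \<and> s - r < d \<longrightarrow> ?P r s"
    proof (rule exI[of _ \<delta>], rule conjI[OF \<delta>(1)], rule allI, rule allI, rule impI)
      fix r s assume rs: "r \<le> x \<and> x \<le> s \<and> s - r < \<delta>"
      \<comment> \<open>Split at \<open>x\<close>, so that each half has \<open>x\<close> as an end point.\<close>
      show "?P r s" by (rule trans[of r x s]; (rule side)?) (use rs in auto)
    qed
  qed
  then obtain V where "V 0 = v" "parallel_chain \<gamma> V 0 1" using v by fastforce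
  then show thesis using that parallel_chain_imp_parallel_along by blast
qed

text \<open>The two fields may be parallel with respect to different subdivisions. They are therefore compared
  only on intervals contained in one piece of each, again joined by bisection.\<close>

lemma parallel_field_unique:
  assumes V: "parallel_along A D \<gamma> V" and W: "parallel_along A D \<gamma> W" and \<gamma>: "continuous_on {0..1} \<gamma>"
    and eq: "V 0 = W 0"
  shows "V 1 = W 1"
proof -
  obtain m \<tau> where \<tau>: "smooth_subdivision A \<gamma> m \<tau>" and V: "\<And>i t. i < m \<Longrightarrow> t \<in> {\<tau> i..\<tau> (Suc i)} \<Longrightarrow>
      has_covariant_derivative_along A D \<gamma> {\<tau> i..\<tau> (Suc i)} V t 0"
    using V unfolding parallel_along_def by blast
  obtain n \<sigma> where \<sigma>: "smooth_subdivision A \<gamma> n \<sigma>" and W: "\<And>i t. i < n \<Longrightarrow> t \<in> {\<sigma> i..\<sigma> (Suc i)} \<Longrightarrow>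
      has_covariant_derivative_along A D \<gamma> {\<sigma> i..\<sigma> (Suc i)} W t 0"
    using W unfolding parallel_along_def by blast
  let ?P = "\<lambda>r s. 0 \<le> r \<longrightarrow> s \<le> 1 \<longrightarrow> r \<le> s \<longrightarrow> V r = W r \<longrightarrow> V s = W s"
  have "?P 0 1"
  proof (rule Bolzano[where P = ?P, OF zero_le_one])
    show "?P r s" if "?P r c" "?P c s" "r \<le> c" "c \<le> s" for r c s using that by auto
    fix x :: real assume x: "0 \<le> x" "x \<le> 1"
    obtain c where c: "c \<in> A" "\<gamma> x \<in> chart_dom c" by (rule chart_exists)
    obtain N F where N: "\<gamma> x \<in> N" and fr: "adapted_frame c N F" by (rule adapted_frame_exists[OF c])
    have oN: "open N" using fr unfolding adapted_frame_def by blast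
    have x01: "x \<in> {0..1}" using x by simp
    obtain \<delta> where \<delta>: "\<delta> > 0"
      "\<And>r s. 0 \<le> r \<Longrightarrow> r < s \<Longrightarrow> s \<le> 1 \<Longrightarrow> s - r < \<delta> \<Longrightarrow> x = r \<or> x = s \<Longrightarrow>
        \<gamma> ` {r..s} \<subseteq> N \<and> (\<exists>i<m. \<tau> i \<le> r \<and> s \<le> \<tau> (Suc i))"
      by (rule one_sided_neighbourhood[OF \<tau> \<gamma> x01 oN N]) (rule that)
    obtain \<epsilon> where \<epsilon>: "\<epsilon> > 0"
      "\<And>r s. 0 \<le> r \<Longrightarrow> r < s \<Longrightarrow> s \<le> 1 \<Longrightarrow> s - r < \<epsilon> \<Longrightarrow> x = r \<or> x = s \<Longrightarrow>
        \<gamma> ` {r..s} \<subseteq> N \<and> (\<exists>i<n. \<sigma> i \<le> r \<and> s \<le> \<sigma> (Suc i))"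
      by (rule one_sided_neighbourhood[OF \<sigma> \<gamma> x01 oN N]) (rule that)
    have side: "V s = W s"
      if rs: "0 \<le> r" "s \<le> 1" "r \<le> s" "s - r < min \<delta> \<epsilon>" "x = r \<or> x = s" and eq: "V r = W r" for r s
    proof (cases "r = s")
      case True
      then show ?thesis using eq by simp
    next
      case False
      with rs have lt: "r < s" and less: "s - r < \<delta>" "s - r < \<epsilon>" by auto
      obtain i where i: "i < m" "\<tau> i \<le> r" "s \<le> \<tau> (Suc i)" and im: "\<gamma> ` {r..s} \<subseteq> N"
        using \<delta>(2)[OF rs(1) lt rs(2) less(1) rs(5)] by blast
      obtain j where j: "j < n" "\<sigma> j \<le> r" "s \<le> \<sigma> (Suc j)"
        using \<epsilon>(2)[OF rs(1) lt rs(2) less(2) rs(5)] by blast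
      have smi: "smooth_curve_on A \<gamma> (\<tau> i) (\<tau> (Suc i))" using \<tau> i(1) by (simp add: smooth_subdivision_def)
      have smj: "smooth_curve_on A \<gamma> (\<sigma> j) (\<sigma> (Suc j))" using \<sigma> j(1) by (simp add: smooth_subdivision_def)
      have sm: "smooth_curve_on A \<gamma> r s" by (rule smooth_curve_on_subinterval[OF smi i(2,3)])
      show ?thesis
      proof (rule parallel_field_unique_local[where V = V and W = W, OF fr sm lt im _ _ eq])
        fix t assume t: "t \<in> {r..s}"
        show "has_covariant_derivative_along A D \<gamma> {r..s} V t 0"
          by (rule covariant_derivative_subinterval[OF V[OF i(1)] smi i(2,3) lt t]) (use t i in auto)
        show "has_covariant_derivative_along A D \<gamma> {r..s} W t 0"
          by (rule covariant_derivative_subinterval[OF W[OF j(1)] smj j(2,3) lt t]) (use t j in auto)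
      qed
    qed
    show "\<exists>d>0. \<forall>r s. r \<le> x \<and> x \<le> s \<and> s - r < d \<longrightarrow> ?P r s"
    proof (rule exI[of _ "min \<delta> \<epsilon>"], rule conjI, simp add: \<delta>(1) \<epsilon>(1), intro allI impI)
      fix r s assume rs: "r \<le> x \<and> x \<le> s \<and> s - r < min \<delta> \<epsilon>" "0 \<le> r" "s \<le> 1" "V r = W r"
      then have "V x = W x" by (intro side[of r x]) auto
      then show "V s = W s" using rs x by (intro side[of x s]) auto
    qed
  qed
  then show ?thesis using eq by simp
qed

lemma parallel_transport_eqI:
  assumes "piecewise_smooth_loop A p \<gamma>" "parallel_along A D \<gamma> V" "V 0 = v" "v \<in> tangent_space A p"
  shows "parallel_transport A D \<gamma> v = V 1"
proof -
  have \<gamma>: "continuous_on {0..1} \<gamma>" and p: "pathstart \<gamma> = p"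
    using assms(1) by (auto simp: piecewise_smooth_loop_def path_def)
  have "(THE w. \<exists>V. parallel_along A D \<gamma> V \<and> V 0 = v \<and> V 1 = w) = V 1"
    by (rule the_equality) (use assms parallel_field_unique[OF _ _ \<gamma>] in \<open>metis\<close>)+
  then show ?thesis using assms(4) p by (simp add: parallel_transport_def)
qed

end


section \<open>Gauge tensors intertwine the connections\<close>

locale gauge_manifold = smooth_manifold A
  for A :: "('a::{t2_space, second_countable_topology}, 'e::euclidean_space) chart set" +
  fixes D D' :: "('a, 'e) connection" and \<Theta> :: "('a, 'e) tensor11"
  assumes affine_D: "affine_connection A D" and affine_D': "affine_connection A D'"
    and torsion_free_D: "torsion_free A D"
    and tensor: "tensor_field11 A \<Theta>"
    and gauge: "X \<in> vector_fields A \<Longrightarrow> Y \<in> vector_fields A \<Longrightarrow> D X (tensor_app \<Theta> Y) = tensor_app \<Theta> (D' X Y)"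
begin

sublocale primal: affine_manifold A D by unfold_locales (rule affine_D)
sublocale dual: affine_manifold A D' by unfold_locales (rule affine_D')

lemma tensor_in: "v \<in> tangent_space A p \<Longrightarrow> \<Theta> p v \<in> tangent_space A p"
  using tensor unfolding tensor_field11_def by blast

lemma tensor_add: "v \<in> tangent_space A p \<Longrightarrow> w \<in> tangent_space A p \<Longrightarrow> \<Theta> p (v + w) = \<Theta> p v + \<Theta> p w"
  using tensor unfolding tensor_field11_def by blast

lemma tensor_scale: "v \<in> tangent_space A p \<Longrightarrow> \<Theta> p (r *\<^sub>R v) = r *\<^sub>R \<Theta> p v"
  using tensor unfolding tensor_field11_def by blast

lemma tensor_0: "\<Theta> p 0 = 0"
  using tensor_scale[OF subspace_0[OF subspace_tangent_space], of p 0] by simp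

lemma tensor_diff: "v \<in> tangent_space A p \<Longrightarrow> w \<in> tangent_space A p \<Longrightarrow> \<Theta> p (v - w) = \<Theta> p v - \<Theta> p w"
  using tensor_add[of v p "(-1) *\<^sub>R w"] tensor_scale[of w p "-1"] subspace_scale[OF subspace_tangent_space, of w p "-1"]
  by simp

lemma tensor_sum:
  "(\<And>i. i \<in> I \<Longrightarrow> v i \<in> tangent_space A p) \<Longrightarrow> \<Theta> p (\<Sum>i\<in>I. v i) = (\<Sum>i\<in>I. \<Theta> p (v i))"
proof (induction I rule: infinite_finite_induct)
  case (insert i I)
  have "(\<Sum>i\<in>I. v i) \<in> tangent_space A p" "v i \<in> tangent_space A p"
    using insert.prems by (auto intro: subspace_sum[OF subspace_tangent_space])
  moreover have "\<Theta> p (\<Sum>i\<in>I. v i) = (\<Sum>i\<in>I. \<Theta> p (v i))" using insert.prems by (intro insert.IH) auto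
  ultimately show ?case by (simp only: sum.insert[OF insert.hyps] tensor_add)
qed (simp_all only: sum.infinite sum.empty tensor_0 not_False_eq_True)

text \<open>The matrix of \<open>\<Theta>\<close> in the chart \<open>c\<close> at the point with coordinates \<open>x\<close>, as a linear map.\<close>

definition tensor_rep :: "('a, 'e) chart \<Rightarrow> 'e \<Rightarrow> 'e \<Rightarrow> 'e" where
  "tensor_rep c x u = \<Theta> (chart_inv c x) (coord_vec A c (chart_inv c x) u) c"

lemma smooth_tensor_rep: "c \<in> A \<Longrightarrow> smooth_on (chart_img c) (\<lambda>x. tensor_rep c x u)"
  using tensor unfolding tensor_field11_def tensor_rep_def Let_def by blast

lemma linear_tensor_rep:
  assumes c: "c \<in> A" and x: "x \<in> chart_img c"
  shows "linear (tensor_rep c x)"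
proof -
  note q = chart_inv_in_dom[OF c x]
  note l = linear_coord_vec[OF c q] and i = coord_vec_in_tangent_space[OF c q]
  show ?thesis
    by (rule linearI) (simp_all add: tensor_rep_def linear_add[OF l] linear_scale[OF l] tensor_add[OF i i] tensor_scale[OF i])
qed

lemma tensor_rep_vf_rep:
  assumes c: "c \<in> A" and x: "x \<in> chart_img c" and Y: "\<And>q. Y q \<in> tangent_space A q"
  shows "tensor_rep c x (vf_rep c Y x) = vf_rep c (tensor_app \<Theta> Y) x"
  by (simp add: tensor_rep_def vf_rep_def tensor_app_def coord_vec_eq_tangent_vec[OF Y c chart_inv_in_dom[OF c x]])

lemma tensor_app_in:
  assumes Y: "Y \<in> vector_fields A"
  shows "tensor_app \<Theta> Y \<in> vector_fields A"
  unfolding vector_fields_def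
proof (intro CollectI conjI allI ballI)
  show "tensor_app \<Theta> Y q \<in> tangent_space A q" for q
    by (simp add: tensor_app_def tensor_in vector_field_in_tangent_space[OF Y])
  fix c assume c: "c \<in> A"
  show "smooth_on (chart_img c) (vf_rep c (tensor_app \<Theta> Y))"
  proof (rule smooth_on_cong[OF open_chart_img[OF c]])
    show "smooth_on (chart_img c) (\<lambda>x. tensor_rep c x (vf_rep c Y x))"
      by (rule smooth_on_linear_family[where M = "tensor_rep c", OF open_chart_img[OF c]
            linear_tensor_rep[OF c] smooth_tensor_rep[OF c] smooth_vf_rep[OF Y c]])
    show "tensor_rep c x (vf_rep c Y x) = vf_rep c (tensor_app \<Theta> Y) x" if "x \<in> chart_img c" for x
      by (rule tensor_rep_vf_rep[OF c that vector_field_in_tangent_space[OF Y]])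
  qed
qed

text \<open>For a torsion-free connection the bracket is a difference of covariant derivatives, so its
  smoothness and its transformation behaviour need no computation in coordinates.\<close>

lemma lie_bracket_in:
  assumes "X \<in> vector_fields A" "Y \<in> vector_fields A"
  shows "lie_bracket A X Y \<in> vector_fields A"
proof -
  have "lie_bracket A X Y = D X Y - D Y X"
    using torsion_free_D assms unfolding torsion_free_def by simp
  then show ?thesis by (simp only: vector_field_diff primal.connection_in assms)
qed

lemma curvature_gauge:
  assumes X: "X \<in> vector_fields A" and Y: "Y \<in> vector_fields A" and Z: "Z \<in> vector_fields A"
  shows "curvature A D X Y (tensor_app \<Theta> Z) = tensor_app \<Theta> (curvature A D' X Y Z)"
proof
  fix p
  note L = lie_bracket_in[OF X Y]
  note in_T = vector_field_in_tangent_space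
  have eq: "curvature A D X Y (tensor_app \<Theta> Z) =
      tensor_app \<Theta> (D' X (D' Y Z)) - tensor_app \<Theta> (D' Y (D' X Z)) - tensor_app \<Theta> (D' (lie_bracket A X Y) Z)"
    by (simp only: curvature_def gauge X Y Z L dual.connection_in)
  have in_T': "D' X (D' Y Z) p \<in> tangent_space A p" "D' Y (D' X Z) p \<in> tangent_space A p"
    "D' (lie_bracket A X Y) Z p \<in> tangent_space A p"
    by (simp_all only: in_T dual.connection_in X Y Z L)
  show "curvature A D X Y (tensor_app \<Theta> Z) p = tensor_app \<Theta> (curvature A D' X Y Z) p"
    unfolding eq
    by (simp only: curvature_def[of A D'] tensor_app_def minus_apply tensor_diff subspace_diff[OF subspace_tangent_space] in_T')
qed

lemma tensor_inv_in: "invertible_at A \<Theta> p \<Longrightarrow> v \<in> tangent_space A p \<Longrightarrow> tensor_inv A \<Theta> p v \<in> tangent_space A p"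
  unfolding invertible_at_def tensor_inv_def by (metis bij_betw_imp_surj_on inv_into_into)

lemma tensor_tensor_inv: "invertible_at A \<Theta> p \<Longrightarrow> v \<in> tangent_space A p \<Longrightarrow> \<Theta> p (tensor_inv A \<Theta> p v) = v"
  unfolding invertible_at_def tensor_inv_def by (metis bij_betw_imp_surj_on f_inv_into_f)

text \<open>In a chart, \<open>\<Theta>\<inverse>Z\<close> solves a linear system whose matrix \<open>\<Theta>\<close> and right-hand side \<open>Z\<close> are smooth.\<close>

lemma tensor_inv_app_in:
  assumes inv: "\<And>p. invertible_at A \<Theta> p" and Z: "Z \<in> vector_fields A"
  shows "tensor_app (tensor_inv A \<Theta>) Z \<in> vector_fields A"
  unfolding vector_fields_def
proof (intro CollectI conjI allI ballI)
  let ?Y = "tensor_app (tensor_inv A \<Theta>) Z"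
  show Y: "?Y q \<in> tangent_space A q" for q
    by (simp add: tensor_app_def tensor_inv_in[OF inv] vector_field_in_tangent_space[OF Z])
  have "tensor_app \<Theta> ?Y = Z"
    by (rule ext) (simp only: tensor_app_def tensor_tensor_inv[OF inv] vector_field_in_tangent_space[OF Z])
  fix c assume c: "c \<in> A"
  show "smooth_on (chart_img c) (vf_rep c ?Y)"
  proof (rule smooth_on_linear_family_solution[where M = "tensor_rep c"])
    show "tensor_rep c x (vf_rep c ?Y x) = vf_rep c Z x" if "x \<in> chart_img c" for x
      using tensor_rep_vf_rep[where Y = ?Y, OF c that Y] \<open>tensor_app \<Theta> ?Y = Z\<close> by simp
    show "inj (tensor_rep c x)" if x: "x \<in> chart_img c" for x
    proof (rule injI)
      let ?q = "chart_inv c x"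
      note q = chart_inv_in_dom[OF c x]
      fix u w assume "tensor_rep c x u = tensor_rep c x w"
      then have "\<Theta> ?q (coord_vec A c ?q u) = \<Theta> ?q (coord_vec A c ?q w)"
        unfolding tensor_rep_def
        by (rule tangent_vec_eqI[OF tensor_in[OF coord_vec_in_tangent_space[OF c q]]
              tensor_in[OF coord_vec_in_tangent_space[OF c q]] c q])
      then have "coord_vec A c ?q u = coord_vec A c ?q w"
        using inv[of ?q] coord_vec_in_tangent_space[OF c q] unfolding invertible_at_def
        by (metis bij_betw_imp_inj_on inj_onD)
      then show "u = w" using coord_vec_same[OF c q] by metis
    qed
  qed (use c Z in \<open>simp_all add: open_chart_img linear_tensor_rep smooth_tensor_rep smooth_vf_rep\<close>)
qed

text \<open>If \<open>V\<close> is written with the fields \<open>E\<^sub>i\<close>, then \<open>\<Theta>V\<close> is written with the fields \<open>\<Theta>E\<^sub>i\<close> and the same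
  coefficients; the gauge equation is applied to each \<open>E\<^sub>i\<close>.\<close>

lemma covariant_derivative_gauge:
  assumes cov: "has_covariant_derivative_along A D' \<gamma> S V t w"
  shows "has_covariant_derivative_along A D \<gamma> S (\<lambda>s. \<Theta> (\<gamma> s) (V s)) t (\<Theta> (\<gamma> t) w)"
proof -
  obtain n E \<alpha> \<alpha>' X U where X: "X \<in> vector_fields A" "X (\<gamma> t) = velocity A \<gamma> S t"
    and E: "\<And>i. i < n \<Longrightarrow> E i \<in> vector_fields A"
    and \<alpha>: "\<And>i. i < n \<Longrightarrow> (\<alpha> i has_real_derivative \<alpha>' i) (at t within S)"
    and U: "open U" "t \<in> U" "\<And>s. s \<in> S \<inter> U \<Longrightarrow> V s = (\<Sum>i<n::nat. \<alpha> i s *\<^sub>R E i (\<gamma> s))"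
    and w: "w = (\<Sum>i<n. \<alpha>' i *\<^sub>R E i (\<gamma> t) + \<alpha> i t *\<^sub>R D' X (E i) (\<gamma> t))"
    using cov unfolding has_covariant_derivative_along_def by blast
  note T = subspace_tangent_space
  have in_T: "E i q \<in> tangent_space A q" "D' X (E i) q \<in> tangent_space A q" if "i < n" for i q
    using vector_field_in_tangent_space dual.connection_in E[OF that] X(1) by blast+
  have 1: "\<Theta> (\<gamma> s) (V s) = (\<Sum>i<n. \<alpha> i s *\<^sub>R tensor_app \<Theta> (E i) (\<gamma> s))" if "s \<in> S \<inter> U" for s
    unfolding U(3)[OF that] tensor_app_def
    by (subst tensor_sum) (auto intro!: sum.cong tensor_scale subspace_scale[OF T] in_T)
  have 2: "\<Theta> (\<gamma> t) w = (\<Sum>i<n. \<alpha>' i *\<^sub>R tensor_app \<Theta> (E i) (\<gamma> t) + \<alpha> i t *\<^sub>R D X (tensor_app \<Theta> (E i)) (\<gamma> t))"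
  proof -
    have "\<Theta> (\<gamma> t) w = (\<Sum>i<n. \<Theta> (\<gamma> t) (\<alpha>' i *\<^sub>R E i (\<gamma> t) + \<alpha> i t *\<^sub>R D' X (E i) (\<gamma> t)))"
      unfolding w by (rule tensor_sum) (auto intro!: subspace_add[OF T] subspace_scale[OF T] in_T)
    also have "\<dots> = (\<Sum>i<n. \<alpha>' i *\<^sub>R tensor_app \<Theta> (E i) (\<gamma> t) + \<alpha> i t *\<^sub>R D X (tensor_app \<Theta> (E i)) (\<gamma> t))"
    proof (rule sum.cong[OF refl])
      fix i assume "i \<in> {..<n}"
      then have i: "i < n" by simp
      note g = gauge[OF X(1) E[OF i]]
      show "\<Theta> (\<gamma> t) (\<alpha>' i *\<^sub>R E i (\<gamma> t) + \<alpha> i t *\<^sub>R D' X (E i) (\<gamma> t)) =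
          \<alpha>' i *\<^sub>R tensor_app \<Theta> (E i) (\<gamma> t) + \<alpha> i t *\<^sub>R D X (tensor_app \<Theta> (E i)) (\<gamma> t)"
        unfolding g unfolding tensor_app_def
        by (simp only: tensor_add subspace_scale[OF T] in_T[OF i] tensor_scale)
    qed
    finally show ?thesis .
  qed
  have 3: "\<forall>i<n. tensor_app \<Theta> (E i) \<in> vector_fields A \<and> (\<alpha> i has_real_derivative \<alpha>' i) (at t within S)"
    using tensor_app_in E \<alpha> by blast
  show ?thesis unfolding has_covariant_derivative_along_def
    by (intro exI[of _ n] exI[of _ "\<lambda>i. tensor_app \<Theta> (E i)"] exI[of _ \<alpha>] exI[of _ \<alpha>'] exI[of _ X] exI[of _ U] conjI X U(1,2) 2 3)
      (use 1 in blast)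
qed

lemma parallel_along_gauge:
  assumes "parallel_along A D' \<gamma> V"
  shows "parallel_along A D \<gamma> (\<lambda>s. \<Theta> (\<gamma> s) (V s))"
proof -
  obtain m \<tau> where \<tau>: "smooth_subdivision A \<gamma> m \<tau>" and V: "\<And>i t. i < m \<Longrightarrow> t \<in> {\<tau> i..\<tau> (Suc i)} \<Longrightarrow>
      has_covariant_derivative_along A D' \<gamma> {\<tau> i..\<tau> (Suc i)} V t 0"
    using assms unfolding parallel_along_def by blast
  have "has_covariant_derivative_along A D \<gamma> {\<tau> i..\<tau> (Suc i)} (\<lambda>s. \<Theta> (\<gamma> s) (V s)) t 0"
    if "i < m" "t \<in> {\<tau> i..\<tau> (Suc i)}" for i t
    using covariant_derivative_gauge[OF V[OF that]] by (simp only: tensor_0)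
  then show ?thesis using \<tau> unfolding parallel_along_def by blast
qed

text \<open>Existence of a parallel field for the dual connection is essential here: without it the right-hand
  side would be a definite description of nothing.\<close>

lemma parallel_transport_gauge:
  assumes loop: "piecewise_smooth_loop A p \<gamma>" and v: "v \<in> tangent_space A p"
  shows "parallel_transport A D \<gamma> (\<Theta> p v) = \<Theta> p (parallel_transport A D' \<gamma> v)"
proof -
  obtain m \<tau> where \<tau>: "smooth_subdivision A \<gamma> m \<tau>" and \<gamma>: "continuous_on {0..1} \<gamma>" "\<gamma> 0 = p" "\<gamma> 1 = p"
    using loop unfolding piecewise_smooth_loop_def path_def pathstart_def pathfinish_def by blast
  have v': "v \<in> tangent_space A (\<gamma> 0)" using v \<gamma>(2) by simp
  obtain V where V: "parallel_along A D' \<gamma> V" "V 0 = v"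
    by (rule dual.parallel_field_exists[OF \<tau> \<gamma>(1) v']) (rule that)
  have "parallel_transport A D \<gamma> (\<Theta> p v) = \<Theta> (\<gamma> 1) (V 1)"
    by (rule primal.parallel_transport_eqI[OF loop parallel_along_gauge[OF V(1)] _ tensor_in[OF v]])
      (simp only: V(2) \<gamma>(2))
  also have "V 1 = parallel_transport A D' \<gamma> v"
    using dual.parallel_transport_eqI[OF loop V v] by simp
  finally show ?thesis by (simp only: \<gamma>(3))
qed

lemma holonomy_gauge:
  assumes inv: "invertible_at A \<Theta> p"
  shows "holonomy A D p =
    (\<lambda>h. \<lambda>v\<in>tangent_space A p. \<Theta> p (h (tensor_inv A \<Theta> p v))) ` holonomy A D' p"
proof -
  have eq: "parallel_transport A D \<gamma> = (\<lambda>v\<in>tangent_space A p. \<Theta> p (parallel_transport A D' \<gamma> (tensor_inv A \<Theta> p v)))"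
    if loop: "piecewise_smooth_loop A p \<gamma>" for \<gamma>
  proof
    fix v
    show "parallel_transport A D \<gamma> v =
        (\<lambda>v\<in>tangent_space A p. \<Theta> p (parallel_transport A D' \<gamma> (tensor_inv A \<Theta> p v))) v"
    proof (cases "v \<in> tangent_space A p")
      case True
      then show ?thesis
        using parallel_transport_gauge[OF loop tensor_inv_in[OF inv True]]
        by (simp only: tensor_tensor_inv[OF inv True] restrict_apply if_True)
    next
      case False
      have "pathstart \<gamma> = p" using loop unfolding piecewise_smooth_loop_def by blast
      with False show ?thesis by (simp only: parallel_transport_def restrict_apply if_False)
    qed
  qed
  show ?thesis
  proof (intro equalityI subsetI)
    fix h assume "h \<in> holonomy A D p"
    then obtain \<gamma> where loop: "piecewise_smooth_loop A p \<gamma>" and h: "h = parallel_transport A D \<gamma>"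
      unfolding holonomy_def by blast
    show "h \<in> (\<lambda>h. \<lambda>v\<in>tangent_space A p. \<Theta> p (h (tensor_inv A \<Theta> p v))) ` holonomy A D' p"
      unfolding h eq[OF loop] by (rule imageI) (use loop in \<open>unfold holonomy_def, blast\<close>)
  next
    fix h assume "h \<in> (\<lambda>h. \<lambda>v\<in>tangent_space A p. \<Theta> p (h (tensor_inv A \<Theta> p v))) ` holonomy A D' p"
    then obtain \<gamma> where loop: "piecewise_smooth_loop A p \<gamma>"
      and h: "h = (\<lambda>v\<in>tangent_space A p. \<Theta> p (parallel_transport A D' \<gamma> (tensor_inv A \<Theta> p v)))"
      unfolding holonomy_def by blast
    show "h \<in> holonomy A D p"
      unfolding h eq[OF loop, symmetric] using loop unfolding holonomy_def by blast
  qed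
qed

end

theorem proposition2p4:
  fixes A :: "('a::{t2_space, second_countable_topology}, 'e::euclidean_space) chart set"
    and g :: "'a \<Rightarrow> ('a, 'e) tvec \<Rightarrow> ('a, 'e) tvec \<Rightarrow> real"
    and D D' :: "('a, 'e) connection"
    and \<Theta> :: "('a, 'e) tensor11"
  assumes "theta_statistical_manifold A g D D' \<Theta>"
  shows "(\<forall>X\<in>vector_fields A. \<forall>Y\<in>vector_fields A. \<forall>Z\<in>vector_fields A.
            curvature A D X Y (tensor_app \<Theta> Z) = tensor_app \<Theta> (curvature A D' X Y Z)) \<and>
         ((\<forall>p. invertible_at A \<Theta> p) \<longrightarrow>
            (\<forall>X\<in>vector_fields A. \<forall>Y\<in>vector_fields A. \<forall>Z\<in>vector_fields A.
               curvature A D X Y Z =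
                 tensor_app \<Theta> (curvature A D' X Y (tensor_app (tensor_inv A \<Theta>) Z)))) \<and>
         (\<forall>p \<gamma>. piecewise_smooth_loop A p \<gamma> \<longrightarrow>
            (\<forall>v\<in>tangent_space A p.
               parallel_transport A D \<gamma> (\<Theta> p v) = \<Theta> p (parallel_transport A D' \<gamma> v))) \<and>
         (\<forall>p. invertible_at A \<Theta> p \<longrightarrow>
            holonomy A D p =
              (\<lambda>h. \<lambda>v\<in>tangent_space A p. \<Theta> p (h (tensor_inv A \<Theta> p v))) ` holonomy A D' p)"
proof -
  have "smooth_atlas A" "affine_connection A D" "affine_connection A D'" "torsion_free A D" "tensor_field11 A \<Theta>"
    "\<forall>X\<in>vector_fields A. \<forall>Y\<in>vector_fields A. D X (tensor_app \<Theta> Y) = tensor_app \<Theta> (D' X Y)"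
    using assms unfolding theta_statistical_manifold_def statistical_manifold_def statistical_gauge_tensor_def
    by blast+
  then interpret gauge_manifold A D D' \<Theta>
    by (simp add: gauge_manifold_def smooth_manifold_def gauge_manifold_axioms_def)
  have "curvature A D X Y Z = tensor_app \<Theta> (curvature A D' X Y (tensor_app (tensor_inv A \<Theta>) Z))"
    if inv: "\<forall>p. invertible_at A \<Theta> p"
      and XYZ: "X \<in> vector_fields A" "Y \<in> vector_fields A" "Z \<in> vector_fields A" for X Y Z
  proof -
    have "tensor_app \<Theta> (tensor_app (tensor_inv A \<Theta>) Z) = Z"
      by (rule ext) (simp only: tensor_app_def tensor_tensor_inv[OF spec[OF inv]] vector_field_in_tangent_space[OF XYZ(3)])
    then show ?thesis
      using curvature_gauge[OF XYZ(1,2) tensor_inv_app_in[OF spec[OF inv] XYZ(3)]] by (simp only:)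
  qed
  then show ?thesis
    using curvature_gauge parallel_transport_gauge holonomy_gauge by (intro conjI allI impI ballI)
qed

end
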